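(* Let $(S\times\mathbb{R},g_L)$ be a standard stationary spacetime and let $H_S$ be a $C^{2}$ embedded hypersurface in $S$. The hypersurface $H=H_S\times\mathbb{R}$ in $S\times\mathbb{R}$ is infinitesimally light-convex if and only if it is locally light-convex.
   Context: Standard stationary spacetime: $S\times\mathbb{R}$ with $g_L\big((y,\tau),(y,\tau)\big)=g_0(y,y)+2\omega_0(y)\tau-\beta(x)\tau^2$ for $(y,\tau)\in T_xS\times\mathbb{R}$, where $g_0$ is a Riemannian metric, $\omega_0$ a one-form and $\beta>0$ a function on $S$. Infinitesimal light-convexity of $H$: every point of $H$ has a neighborhood $U_0$ with a $C^2$ function $\Phi:U_0\to\mathbb{R}$ such that $\Phi^{-1}(0)=U_0\cap H$, $\mathrm{d}\Phi\ne0$ on $U_0\cap H$ (for $H=H_S\times\mathbb{R}$ one takes $\Phi(x,t)=\phi(x)$), and $H^{g_L}_\Phi(v,v)\le0$ for all $z\in U_0\cap H$ and all lightlike $v\in T_zH$, where $H^{g_L}_\Phi$ is the Hessian for the Levi-Civita connection of $g_L$. Local light-convexity of $H$: for each $z\in H$ there is a small enough neighborhood $U$ of $z$ such that all lightlike geodesics in $U$ issuing from $z$ and tangent to $H$ at $z$ lie in the closure of one of the two connected parts of $U\setminus H$ (the local exterior). The local exterior corresponds to the side $\{\Phi<0\}$ for a $C^2$ function $\Phi:U_0\to\mathbb{R}$, defined on a neighborhood $U_0$ of the given point of $H$, such that $\Phi^{-1}(0)=U_0\cap H$ and $\mathrm{d}\Phi\ne0$ on $U_0\cap H$ (for $H=H_S\times\mathbb{R}$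 one takes $\Phi(x,t)=\phi(x)$), i.e. the choice of side is the same for all points of $H$ near any given point. *)

theory Defs
  imports "HOL-Analysis.Analysis"
begin

section \<open>Functions of class \<open>C\<^sup>k\<close> on open subsets of Euclidean spaces\<close>

text \<open>
  The derivatives are taken with the full filter \<open>at x\<close>, so the definition is meant for open \<open>A\<close>;
  the \<open>k\<close>-th derivative is handled through its iterated directional components, which in
  finite dimension gives the usual class \<open>C\<^sup>k\<close>.
\<close>

fun Ck_on :: "nat \<Rightarrow> 'a::euclidean_space set \<Rightarrow> ('a \<Rightarrow> 'b::real_normed_vector) \<Rightarrow> bool" where
  "Ck_on 0 A f \<longleftrightarrow> continuous_on A f"
| "Ck_on (Suc k) A f \<longleftrightarrow>
     (\<forall>x\<in>A. f differentiable (at x)) \<and> (\<forall>v. Ck_on k A (\<lambda>x. frechet_derivative f (at x) v))"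

definition smooth_on :: "'a::euclidean_space set \<Rightarrow> ('a \<Rightarrow> 'b::real_normed_vector) \<Rightarrow> bool" where
  "smooth_on A f \<longleftrightarrow> (\<forall>k. Ck_on k A f)"


section \<open>Manifolds, given by an indexed atlas\<close>

text \<open>
  The underlying space is a whole type \<open>'a\<close>. The atlas is indexed so that the product
  \<open>S \<times> \<real>\<close> can use the same index set as \<open>S\<close>.
\<close>

record ('i, 'a, 'e) atlas =
  idx :: "'i set"
  chart_dom :: "'i \<Rightarrow> 'a set"
  chart_map :: "'i \<Rightarrow> 'a \<Rightarrow> 'e"

definition param :: "('i, 'a, 'e) atlas \<Rightarrow> 'i \<Rightarrow> 'e \<Rightarrow> 'a" where
  "param M i = inv_into (chart_dom M i) (chart_map M i)"

text \<open>\<open>\<psi>\<close> is a chart with domain \<open>W\<close> whose coordinate changes with the atlas are \<open>C\<^sup>k\<close>.\<close>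

definition Ck_chart ::
    "nat \<Rightarrow> ('i, 'a::topological_space, 'e::euclidean_space) atlas \<Rightarrow> 'a set \<Rightarrow> ('a \<Rightarrow> 'e) \<Rightarrow> bool" where
  "Ck_chart k M W \<psi> \<longleftrightarrow>
     open W \<and> open (\<psi> ` W) \<and> homeomorphism W (\<psi> ` W) \<psi> (inv_into W \<psi>) \<and>
     (\<forall>i\<in>idx M. Ck_on k (chart_map M i ` (W \<inter> chart_dom M i)) (\<psi> \<circ> param M i) \<and>
                Ck_on k (\<psi> ` (W \<inter> chart_dom M i)) (chart_map M i \<circ> inv_into W \<psi>))"

definition smooth_manifold ::
    "('i, 'a::{t2_space,second_countable_topology}, 'e::euclidean_space) atlas \<Rightarrow> bool" where
  "smooth_manifold M \<longleftrightarrow>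
     (\<Union>i\<in>idx M. chart_dom M i) = UNIV \<and>
     (\<forall>i\<in>idx M. \<forall>k. Ck_chart k M (chart_dom M i) (chart_map M i))"

definition Ck_function ::
    "nat \<Rightarrow> ('i, 'a, 'e::euclidean_space) atlas \<Rightarrow> 'a set \<Rightarrow> ('a \<Rightarrow> real) \<Rightarrow> bool" where
  "Ck_function k M U f \<longleftrightarrow>
     (\<forall>i\<in>idx M. Ck_on k (chart_map M i ` (U \<inter> chart_dom M i)) (f \<circ> param M i))"

text \<open>
  A tangent vector at \<open>x\<close> is represented, for each chart \<open>i\<close> around \<open>x\<close>, by its vector of components
  in \<open>'e\<close>; \<open>transition M i j x\<close> turns components in chart \<open>i\<close> into components in chart \<open>j\<close>.
  Covariant tensor fields are given by their components in each chart, subject to the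
  transformation law.
\<close>

definition transition ::
    "('i, 'a, 'e::euclidean_space) atlas \<Rightarrow> 'i \<Rightarrow> 'i \<Rightarrow> 'a \<Rightarrow> 'e \<Rightarrow> 'e" where
  "transition M i j x = frechet_derivative (chart_map M j \<circ> param M i) (at (chart_map M i x))"

type_synonym ('i, 'a, 'e) one_form_field = "'i \<Rightarrow> 'a \<Rightarrow> 'e \<Rightarrow> real"
type_synonym ('i, 'a, 'e) bilinear_field = "'i \<Rightarrow> 'a \<Rightarrow> 'e \<Rightarrow> 'e \<Rightarrow> real"

definition smooth_one_form ::
    "('i, 'a, 'e::euclidean_space) atlas \<Rightarrow> ('i, 'a, 'e) one_form_field \<Rightarrow> bool" where
  "smooth_one_form M \<omega> \<longleftrightarrow>
     (\<forall>i\<in>idx M. \<forall>x\<in>chart_dom M i. linear (\<omega> i x)) \<and>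
     (\<forall>i\<in>idx M. \<forall>j\<in>idx M. \<forall>x\<in>chart_dom M i \<inter> chart_dom M j. \<forall>v.
        \<omega> i x v = \<omega> j x (transition M i j x v)) \<and>
     (\<forall>i\<in>idx M. \<forall>v. smooth_on (chart_map M i ` chart_dom M i) (\<lambda>y. \<omega> i (param M i y) v))"

definition riemannian_metric ::
    "('i, 'a, 'e::euclidean_space) atlas \<Rightarrow> ('i, 'a, 'e) bilinear_field \<Rightarrow> bool" where
  "riemannian_metric M g \<longleftrightarrow>
     (\<forall>i\<in>idx M. \<forall>x\<in>chart_dom M i.
        bilinear (g i x) \<and> (\<forall>v w. g i x v w = g i x w v) \<and> (\<forall>v. v \<noteq> 0 \<longrightarrow> 0 < g i x v v)) \<and>
     (\<forall>i\<in>idx M. \<forall>j\<in>idx M. \<forall>x\<in>chart_dom M i \<inter> chart_dom M j. \<forall>v w.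
        g i x v w = g j x (transition M i j x v) (transition M i j x w)) \<and>
     (\<forall>i\<in>idx M. \<forall>v w. smooth_on (chart_map M i ` chart_dom M i) (\<lambda>y. g i (param M i y) v w))"


section \<open>Levi-Civita connection, Hessian, geodesics\<close>

text \<open>
  The Christoffel map of \<open>g\<close> in chart \<open>i\<close> at \<open>p\<close>: \<open>christoffel M g i p v w\<close> is the component
  vector of \<open>\<nabla>\<^sub>v w\<close> for vector fields \<open>v\<close>, \<open>w\<close> with constant components. It is
  determined by the two properties characterizing the Levi-Civita connection: absence of torsion
  (symmetry) and compatibility with the metric.
\<close>

definition christoffel ::
    "('i, 'a, 'e::euclidean_space) atlas \<Rightarrow> ('i, 'a, 'e) bilinear_field \<Rightarrow> 'i \<Rightarrow> 'a \<Rightarrow> 'e \<Rightarrow> 'e \<Rightarrow> 'e" where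
  "christoffel M g i p = (THE \<Gamma>.
     bilinear \<Gamma> \<and> (\<forall>v w. \<Gamma> v w = \<Gamma> w v) \<and>
     (\<forall>u v w. frechet_derivative (\<lambda>y. g i (param M i y) v w) (at (chart_map M i p)) u
              = g i p (\<Gamma> u v) w + g i p v (\<Gamma> u w)))"

definition differential ::
    "('i, 'a, 'e::euclidean_space) atlas \<Rightarrow> ('a \<Rightarrow> real) \<Rightarrow> 'i \<Rightarrow> 'a \<Rightarrow> 'e \<Rightarrow> real" where
  "differential M f i p = frechet_derivative (f \<circ> param M i) (at (chart_map M i p))"

text \<open>\<open>v(w f) - (\<nabla>\<^sub>v w) f\<close> for \<open>v\<close>, \<open>w\<close> extended with constant components.\<close>

definition hessian ::
    "('i, 'a, 'e::euclidean_space) atlas \<Rightarrow> ('i, 'a, 'e) bilinear_field \<Rightarrow> ('a \<Rightarrow> real) \<Rightarrow>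
     'i \<Rightarrow> 'a \<Rightarrow> 'e \<Rightarrow> 'e \<Rightarrow> real" where
  "hessian M g f i p v w =
     frechet_derivative (\<lambda>y. frechet_derivative (f \<circ> param M i) (at y) w) (at (chart_map M i p)) v
     - differential M f i p (christoffel M g i p v w)"

definition lightlike ::
    "('i, 'a, 'e::euclidean_space) bilinear_field \<Rightarrow> 'i \<Rightarrow> 'a \<Rightarrow> 'e \<Rightarrow> bool" where
  "lightlike g i p v \<longleftrightarrow> v \<noteq> 0 \<and> g i p v v = 0"

definition velocity ::
    "('i, 'a, 'e::euclidean_space) atlas \<Rightarrow> real set \<Rightarrow> (real \<Rightarrow> 'a) \<Rightarrow> 'i \<Rightarrow> real \<Rightarrow> 'e" where
  "velocity M I \<gamma> i s = vector_derivative (chart_map M i \<circ> \<gamma>) (at s within I)"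

definition geodesic_on ::
    "('i, 'a::topological_space, 'e::euclidean_space) atlas \<Rightarrow> ('i, 'a, 'e) bilinear_field \<Rightarrow>
     real set \<Rightarrow> (real \<Rightarrow> 'a) \<Rightarrow> bool" where
  "geodesic_on M g I \<gamma> \<longleftrightarrow>
     continuous_on I \<gamma> \<and>
     (\<forall>s\<in>I. \<forall>i\<in>idx M. \<gamma> s \<in> chart_dom M i \<longrightarrow>
        (chart_map M i \<circ> \<gamma>) differentiable (at s within I) \<and>
        (velocity M I \<gamma> i has_vector_derivative
           - christoffel M g i (\<gamma> s) (velocity M I \<gamma> i s) (velocity M I \<gamma> i s)) (at s within I))"

definition lightlike_geodesic_on ::
    "('i, 'a::topological_space, 'e::euclidean_space) atlas \<Rightarrow> ('i, 'a, 'e) bilinear_field \<Rightarrow>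
     real set \<Rightarrow> (real \<Rightarrow> 'a) \<Rightarrow> bool" where
  "lightlike_geodesic_on M g I \<gamma> \<longleftrightarrow>
     geodesic_on M g I \<gamma> \<and>
     (\<forall>s\<in>I. \<forall>i\<in>idx M. \<gamma> s \<in> chart_dom M i \<longrightarrow> lightlike g i (\<gamma> s) (velocity M I \<gamma> i s))"


section \<open>Hypersurfaces\<close>

text \<open>Slice charts; the hyperplane is the orthogonal complement of \<open>b\<close>.\<close>

definition Ck_embedded_hypersurface ::
    "nat \<Rightarrow> ('i, 'a::topological_space, 'e::euclidean_space) atlas \<Rightarrow> 'a set \<Rightarrow> bool" where
  "Ck_embedded_hypersurface k M H \<longleftrightarrow>
     (\<forall>p\<in>H. \<exists>W \<psi> b. p \<in> W \<and> Ck_chart k M W \<psi> \<and> b \<noteq> 0 \<and>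
        \<psi> ` (W \<inter> H) = {y \<in> \<psi> ` W. y \<bullet> b = 0})"

text \<open>\<open>v \<in> T\<^sub>pH\<close>: \<open>v\<close> is the velocity at \<open>p\<close> of a curve lying in \<open>H\<close>.\<close>

definition tangent_to ::
    "('i, 'a, 'e::euclidean_space) atlas \<Rightarrow> 'a set \<Rightarrow> 'i \<Rightarrow> 'a \<Rightarrow> 'e \<Rightarrow> bool" where
  "tangent_to M H i p v \<longleftrightarrow>
     (\<exists>c :: real \<Rightarrow> 'a. c 0 = p \<and> (\<forall>t. c t \<in> H \<inter> chart_dom M i) \<and>
        ((chart_map M i \<circ> c) has_vector_derivative v) (at 0))"

definition defining_function ::
    "('i, 'a::topological_space, 'e::euclidean_space) atlas \<Rightarrow> 'a set \<Rightarrow> 'a set \<Rightarrow> ('a \<Rightarrow> real) \<Rightarrow> bool" where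
  "defining_function M H U\<^sub>0 \<Phi> \<longleftrightarrow>
     open U\<^sub>0 \<and> Ck_function 2 M U\<^sub>0 \<Phi> \<and> {z \<in> U\<^sub>0. \<Phi> z = 0} = U\<^sub>0 \<inter> H \<and>
     (\<forall>z\<in>U\<^sub>0 \<inter> H. \<forall>i\<in>idx M. z \<in> chart_dom M i \<longrightarrow> (\<exists>v. differential M \<Phi> i z v \<noteq> 0))"


section \<open>Light-convexity with respect to a defining function\<close>

definition hessian_light_convex ::
    "('i, 'a, 'e::euclidean_space) atlas \<Rightarrow> ('i, 'a, 'e) bilinear_field \<Rightarrow> 'a set \<Rightarrow>
     'a set \<Rightarrow> ('a \<Rightarrow> real) \<Rightarrow> bool" where
  "hessian_light_convex M g H U\<^sub>0 \<Phi> \<longleftrightarrow>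
     (\<forall>z\<in>U\<^sub>0 \<inter> H. \<forall>i\<in>idx M. z \<in> chart_dom M i \<longrightarrow>
        (\<forall>v. lightlike g i z v \<and> tangent_to M H i z v \<longrightarrow> hessian M g \<Phi> i z v v \<le> 0))"

text \<open>
  The neighborhood \<open>U\<close> may depend on \<open>z\<close>, whereas the side \<open>{\<Phi> < 0}\<close> is the same for all
  \<open>z \<in> U\<^sub>0 \<inter> H\<close>.
\<close>

definition geodesically_light_convex ::
    "('i, 'a::topological_space, 'e::euclidean_space) atlas \<Rightarrow> ('i, 'a, 'e) bilinear_field \<Rightarrow>
     'a set \<Rightarrow> 'a set \<Rightarrow> ('a \<Rightarrow> real) \<Rightarrow> bool" where
  "geodesically_light_convex M g H U\<^sub>0 \<Phi> \<longleftrightarrow>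
     (\<forall>z\<in>U\<^sub>0 \<inter> H. \<exists>U. open U \<and> z \<in> U \<and> U \<subseteq> U\<^sub>0 \<and>
        components (U - H) = {{q \<in> U. \<Phi> q < 0}, {q \<in> U. 0 < \<Phi> q}} \<and>
        (\<forall>b>0. \<forall>\<gamma>. lightlike_geodesic_on M g {0..<b} \<gamma> \<and> \<gamma> ` {0..<b} \<subseteq> U \<and> \<gamma> 0 = z \<and>
           (\<forall>i\<in>idx M. z \<in> chart_dom M i \<longrightarrow> tangent_to M H i z (velocity M {0..<b} \<gamma> i 0))
           \<longrightarrow> \<gamma> ` {0..<b} \<subseteq> closure {q \<in> U. \<Phi> q < 0}))"


section \<open>Standard stationary spacetimes\<close>

definition product_line :: "('i, 'a, 'e) atlas \<Rightarrow> ('i, 'a \<times> real, 'e \<times> real) atlas" where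
  "product_line M = \<lparr>idx = idx M, chart_dom = (\<lambda>i. chart_dom M i \<times> UNIV),
     chart_map = (\<lambda>i p. (chart_map M i (fst p), snd p))\<rparr>"

definition standard_stationary ::
    "('i, 'a::{t2_space,second_countable_topology}, 'e::euclidean_space) atlas \<Rightarrow>
     ('i, 'a, 'e) bilinear_field \<Rightarrow> ('i, 'a, 'e) one_form_field \<Rightarrow> ('a \<Rightarrow> real) \<Rightarrow> bool" where
  "standard_stationary M g\<^sub>0 \<omega>\<^sub>0 \<beta> \<longleftrightarrow>
     smooth_manifold M \<and> riemannian_metric M g\<^sub>0 \<and> smooth_one_form M \<omega>\<^sub>0 \<and>
     (\<forall>k. Ck_function k M UNIV \<beta>) \<and> (\<forall>x. 0 < \<beta> x)"

text \<open>The polarization of \<open>g\<^sub>0(y,y) + 2 \<omega>\<^sub>0(y) \<tau> - \<beta>(x) \<tau>\<^sup>2\<close>, in the charts of \<open>product_line\<close>.\<close>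

definition stationary_metric ::
    "('i, 'a, 'e) bilinear_field \<Rightarrow> ('i, 'a, 'e) one_form_field \<Rightarrow> ('a \<Rightarrow> real) \<Rightarrow>
     ('i, 'a \<times> real, 'e \<times> real) bilinear_field" where
  "stationary_metric g\<^sub>0 \<omega>\<^sub>0 \<beta> i p v w =
     g\<^sub>0 i (fst p) (fst v) (fst w) + \<omega>\<^sub>0 i (fst p) (fst v) * snd w + \<omega>\<^sub>0 i (fst p) (fst w) * snd v
     - \<beta> (fst p) * snd v * snd w"

text \<open>
  For \<open>H = H\<^sub>S \<times> \<real>\<close> the defining functions are those of the form \<open>\<Phi>(x,t) = \<phi>(x)\<close>.
\<close>

definition infinitesimally_light_convex ::
    "('i, 'a::topological_space, 'e::euclidean_space) atlas \<Rightarrow>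
     ('i, 'a \<times> real, 'e \<times> real) bilinear_field \<Rightarrow> 'a set \<Rightarrow> bool" where
  "infinitesimally_light_convex M g H\<^sub>S \<longleftrightarrow>
     (\<forall>p \<in> H\<^sub>S \<times> UNIV. \<exists>U\<^sub>0 \<phi>. p \<in> U\<^sub>0 \<and>
        defining_function (product_line M) (H\<^sub>S \<times> UNIV) U\<^sub>0 (\<lambda>(x, t). \<phi> x) \<and>
        hessian_light_convex (product_line M) g (H\<^sub>S \<times> UNIV) U\<^sub>0 (\<lambda>(x, t). \<phi> x))"

definition locally_light_convex ::
    "('i, 'a::topological_space, 'e::euclidean_space) atlas \<Rightarrow>
     ('i, 'a \<times> real, 'e \<times> real) bilinear_field \<Rightarrow> 'a set \<Rightarrow> bool" where
  "locally_light_convex M g H\<^sub>S \<longleftrightarrow>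
     (\<forall>p \<in> H\<^sub>S \<times> UNIV. \<exists>U\<^sub>0 \<phi>. p \<in> U\<^sub>0 \<and>
        defining_function (product_line M) (H\<^sub>S \<times> UNIV) U\<^sub>0 (\<lambda>(x, t). \<phi> x) \<and>
        geodesically_light_convex (product_line M) g (H\<^sub>S \<times> UNIV) U\<^sub>0 (\<lambda>(x, t). \<phi> x))"

end

theory Submission
  imports Defs
begin

text \<open>
  Along a geodesic \<open>\<gamma>\<close> the function \<open>\<rho> = \<Phi> \<circ> \<gamma>\<close> has second derivative \<open>H\<^sub>\<Phi>(\<gamma>', \<gamma>')\<close>. If lightlike
  geodesics tangent to \<open>H\<close> stay in \<open>{\<Phi> \<le> 0}\<close>, then \<open>\<rho>\<close> is maximal at its starting point, where
  \<open>\<rho> = \<rho>' = 0\<close>, hence \<open>H\<^sub>\<Phi> \<le> 0\<close>.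

  Conversely, write \<open>H\<^sub>S\<close> locally as a graph and take the defining function \<open>\<psi>\<close> with \<open>\<psi>(x + s n) = \<psi>(x) + s\<close>
  for a transverse vector \<open>n\<close>. The first two derivatives of \<open>\<psi>\<close> are constant in the direction \<open>n\<close>, so comparing the
  Hessian at a point with the Hessian at its projection to \<open>H\<close> along \<open>n\<close> only involves the (smooth) Christoffel
  symbols and no modulus of continuity of the second derivatives of \<open>\<psi>\<close>. This gives
  \<open>\<rho>'' \<le> C (\<bar>\<rho>\<bar> + \<bar>\<rho>'\<bar>)\<close> for lightlike geodesics, and \<open>\<rho>(0) = \<rho>'(0) = 0\<close> then forces \<open>\<rho> \<le> 0\<close> for a short
  time. A geodesic that stays in a sufficiently small neighbourhood only lives for such a short time.
\<close>

section \<open>Calculus of maps of class \<open>C\<^sup>k\<close>\<close>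

text \<open>The Hessian condition holds only on the hypersurface, while a geodesic leaves it at
  once. Passing to nearby points costs an error, and one that merely tends to zero would be useless
  against zero initial data: it has to be bounded linearly by \<open>\<bar>\<rho>\<bar>\<close> and
  the absolute value of its derivative. The price of the special defining function is that the
  Hessian inequality must be carried over from the given one, although the quotient of the two need
  not be twice differentiable.

  A second constraint is that the neighbourhood is fixed before the geodesic, whose parameter has an
  arbitrary scale. All estimates are therefore homogeneous in the velocity: a speed bound
  \<open>N\<close> and a lifetime \<open>b\<close> matter only through \<open>b N\<close>, and
  \<open>b N\<close> is controlled by the size of the neighbourhood.

  The stationary splitting serves to repair null vectors. The time direction is tangent to
  \<open>H\<close>, so a tangent vector that is almost null can be made null by changing its time
  component, without affecting its projection to \<open>S\<close>.\<close>

lemma Ck_on_subset: "Ck_on k B f \<Longrightarrow> A \<subseteq> B \<Longrightarrow> Ck_on k A f"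
  by (induction k arbitrary: f) (auto intro: continuous_on_subset)

lemma Ck_on_imp_continuous_on: "Ck_on k A f \<Longrightarrow> continuous_on A f"
  by (cases k) (auto intro!: continuous_at_imp_continuous_on differentiable_imp_continuous_within)

lemma Ck_on_SucD: "Ck_on (Suc k) A f \<Longrightarrow> Ck_on k A f"
proof (induction k arbitrary: f)
  case 0
  then show ?case using Ck_on_imp_continuous_on[OF 0] by simp
next
  case (Suc k)
  then have "Ck_on (Suc k) A (\<lambda>x. frechet_derivative f (at x) v)" for v by simp
  then have "Ck_on k A (\<lambda>x. frechet_derivative f (at x) v)" for v by (rule Suc.IH)
  with Suc.prems show ?case by simp
qed

lemma Ck_on_mono: "Ck_on k A f \<Longrightarrow> j \<le> k \<Longrightarrow> Ck_on j A f"
  by (induction k) (auto simp: le_Suc_eq dest: Ck_on_SucD simp del: Ck_on.simps)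

text \<open>Openness turns agreement on \<open>A\<close> into agreement near each of its points, so
  the derivatives, taken with the full filter, agree as well.\<close>

lemma Ck_on_cong:
  assumes "open A" "\<And>x. x \<in> A \<Longrightarrow> f x = g x"
  shows "Ck_on k A f \<longleftrightarrow> Ck_on k A g"
proof -
  have "Ck_on k A g" if "Ck_on k A f" "\<And>x. x \<in> A \<Longrightarrow> f x = g x" for f g :: "'a \<Rightarrow> 'b"
    using that
  proof (induction k arbitrary: f g)
    case 0
    then show ?case using continuous_on_cong by auto
  next
    case (Suc k)
    have d: "g differentiable (at x)" if "x \<in> A" for x
    proof -
      have "f differentiable at x" using Suc.prems(1) that by simp
      then obtain f' where "(f has_derivative f') (at x)" unfolding differentiable_def ..
      then have "(g has_derivative f') (at x)"
        using has_derivative_transform_within_open assms(1) that Suc.prems(2) by blast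
      then show ?thesis by (auto simp: differentiable_def)
    qed
    have eq: "frechet_derivative f (at x) = frechet_derivative g (at x)" if "x \<in> A" for x
      using frechet_derivative_transform_within_open[OF _ assms(1) that Suc.prems(2)]
        Suc.prems(1) that by simp
    have "Ck_on k A (\<lambda>x. frechet_derivative g (at x) v)" for v
      by (rule Suc.IH[of "\<lambda>x. frechet_derivative f (at x) v"]) (use Suc.prems(1) eq in simp_all)
    with d show ?case by simp
  qed
  from this[of f g] this[of g f] assms(2) show ?thesis by fastforce
qed

text \<open>Allows an explicitly known derivative in place of \<open>frechet_derivative\<close>;
  most closure properties below are inductions through this rule.\<close>

lemma Ck_on_SucI:
  assumes "open A" "\<And>x. x \<in> A \<Longrightarrow> (f has_derivative f' x) (at x)" "\<And>v. Ck_on k A (\<lambda>x. f' x v)"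
  shows "Ck_on (Suc k) A f"
proof -
  have "Ck_on k A (\<lambda>x. frechet_derivative f (at x) v)" for v
    using Ck_on_cong[OF assms(1), of "\<lambda>x. f' x v" "\<lambda>x. frechet_derivative f (at x) v" k]
      frechet_derivative_at[OF assms(2)] assms(3)[of v] by fastforce
  moreover have "f differentiable at x" if "x \<in> A" for x
    using assms(2)[OF that] by (rule differentiableI)
  ultimately show ?thesis by simp
qed

lemma Ck_on_Suc_has_derivative:
  "Ck_on (Suc k) A f \<Longrightarrow> x \<in> A \<Longrightarrow> (f has_derivative frechet_derivative f (at x)) (at x)"
  using frechet_derivative_works by auto

lemma Ck_on_const: "Ck_on k A (\<lambda>x. c)"
  by (induction k arbitrary: c) auto

lemma Ck_on_bounded_linear_compose:
  assumes "bounded_linear L" "open A" "Ck_on k A f"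
  shows "Ck_on k A (\<lambda>x. L (f x))"
  using assms(3)
proof (induction k arbitrary: f)
  case 0
  then show ?case using assms(1) bounded_linear.continuous_on by auto
next
  case (Suc k)
  show ?case
  proof (rule Ck_on_SucI[OF assms(2) bounded_linear.has_derivative[OF assms(1)
          Ck_on_Suc_has_derivative[OF Suc.prems]]])
    show "Ck_on k A (\<lambda>x. L (frechet_derivative f (at x) v))" for v
      by (rule Suc.IH) (use Suc.prems in simp)
  qed
qed

lemma Ck_on_id: "Ck_on k A (\<lambda>x. x)"
  by (cases k) (auto simp: Ck_on_const)

lemma Ck_on_bounded_linear:
  "bounded_linear L \<Longrightarrow> open A \<Longrightarrow> Ck_on k A L"
  using Ck_on_bounded_linear_compose[OF _ _ Ck_on_id] .

lemma Ck_on_add: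
  assumes "open A" "Ck_on k A f" "Ck_on k A g"
  shows "Ck_on k A (\<lambda>x. f x + g x)"
  using assms(2,3)
proof (induction k arbitrary: f g)
  case 0
  then show ?case by (auto intro: continuous_intros)
next
  case (Suc k)
  show ?case
  proof (rule Ck_on_SucI[OF assms(1) has_derivative_add[OF
          Ck_on_Suc_has_derivative[OF Suc.prems(1)] Ck_on_Suc_has_derivative[OF Suc.prems(2)]]])
    show "Ck_on k A (\<lambda>x. frechet_derivative f (at x) v + frechet_derivative g (at x) v)" for v
      by (rule Suc.IH) (use Suc.prems in simp_all)
  qed
qed

lemma Ck_on_sum:
  assumes "open A" "\<And>i. i \<in> I \<Longrightarrow> Ck_on k A (f i)"
  shows "Ck_on k A (\<lambda>x. \<Sum>i\<in>I. f i x)"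
  using assms(2)
proof (induction I rule: infinite_finite_induct)
  case (insert i I)
  then show ?case using Ck_on_add[OF assms(1), of k "f i" "\<lambda>x. \<Sum>i\<in>I. f i x"] by simp
qed (auto simp: Ck_on_const)

lemma Ck_on_scaleR:
  assumes "open A" "Ck_on k A f" "Ck_on k A g"
  shows "Ck_on k A (\<lambda>x. f x *\<^sub>R g x)"
  using assms(2,3)
proof (induction k arbitrary: f g)
  case 0
  then show ?case by (auto intro: continuous_intros)
next
  case (Suc k)
  have "Ck_on k A (\<lambda>x. f x *\<^sub>R frechet_derivative g (at x) v + frechet_derivative f (at x) v *\<^sub>R g x)" for v
    using Suc.prems Suc.prems[THEN Ck_on_SucD]
    by (intro Ck_on_add Suc.IH assms(1)) simp_all
  then show ?case
    using Ck_on_SucI[OF assms(1) has_derivative_scaleR[OF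
          Ck_on_Suc_has_derivative[OF Suc.prems(1)] Ck_on_Suc_has_derivative[OF Suc.prems(2)]]]
    by blast
qed

lemma Ck_on_mult:
  fixes f g :: "_ \<Rightarrow> real"
  shows "open A \<Longrightarrow> Ck_on k A f \<Longrightarrow> Ck_on k A g \<Longrightarrow> Ck_on k A (\<lambda>x. f x * g x)"
  using Ck_on_scaleR[of A k f g] by simp

lemma Ck_on_minus:
  "open A \<Longrightarrow> Ck_on k A f \<Longrightarrow> Ck_on k A (\<lambda>x. - f x)"
  using Ck_on_bounded_linear_compose[of uminus] bounded_linear_minus[OF bounded_linear_ident] by blast

lemma Ck_on_diff:
  "open A \<Longrightarrow> Ck_on k A f \<Longrightarrow> Ck_on k A g \<Longrightarrow> Ck_on k A (\<lambda>x. f x - g x)"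
  using Ck_on_add[of A k f "\<lambda>x. - g x"] Ck_on_minus[of A k g] by simp

lemma Ck_on_inverse:
  fixes f :: "_ \<Rightarrow> real"
  assumes "open A" "Ck_on k A f" "\<And>x. x \<in> A \<Longrightarrow> f x \<noteq> 0"
  shows "Ck_on k A (\<lambda>x. inverse (f x))"
  using assms(2)
proof (induction k)
  case 0
  then show ?case using assms(3) by (auto intro: continuous_intros)
next
  case (Suc k)
  have "Ck_on k A (\<lambda>x. - (inverse (f x) * frechet_derivative f (at x) v * inverse (f x)))" for v
    using Suc.IH[OF Ck_on_SucD[OF Suc.prems]] Suc.prems
    by (intro Ck_on_minus Ck_on_mult assms(1)) simp_all
  then show ?case
    using Ck_on_SucI[OF assms(1) Deriv.has_derivative_inverse[OF assms(3)
          Ck_on_Suc_has_derivative[OF Suc.prems]]] by blast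
qed

section \<open>Linear and bilinear maps expanded in a basis\<close>

lemma linear_eq_sum_Basis:
  fixes F :: "'b::euclidean_space \<Rightarrow> 'c::real_normed_vector"
  assumes "linear F"
  shows "F w = (\<Sum>b\<in>Basis. (w \<bullet> b) *\<^sub>R F b)"
proof -
  have "F w = F (\<Sum>b\<in>Basis. (w \<bullet> b) *\<^sub>R b)" by (simp add: euclidean_representation)
  then show ?thesis using assms by (simp add: linear_sum linear_scale)
qed

lemma bilinear_eq_sum_Basis:
  fixes F :: "'b::euclidean_space \<Rightarrow> 'd::euclidean_space \<Rightarrow> 'c::real_normed_vector"
  assumes "bilinear F"
  shows "F v w = (\<Sum>a\<in>Basis. \<Sum>b\<in>Basis. ((v \<bullet> a) * (w \<bullet> b)) *\<^sub>R F a b)"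
proof -
  have "F v w = (\<Sum>a\<in>Basis. (v \<bullet> a) *\<^sub>R F a w)"
    using assms by (intro linear_eq_sum_Basis) (auto simp: bilinear_def)
  moreover have "F a w = (\<Sum>b\<in>Basis. (w \<bullet> b) *\<^sub>R F a b)" for a
    using assms by (intro linear_eq_sum_Basis) (auto simp: bilinear_def)
  ultimately show ?thesis by (simp add: scaleR_sum_right)
qed

lemma Ck_on_compose:
  fixes f :: "'a::euclidean_space \<Rightarrow> 'b::euclidean_space" and g :: "'b \<Rightarrow> 'c::real_normed_vector"
  assumes "open A" "open B" "Ck_on k A f" "Ck_on k B g" "f ` A \<subseteq> B"
  shows "Ck_on k A (\<lambda>x. g (f x))"
  using assms(3,4)
proof (induction k arbitrary: g)
  case 0
  then show ?case using assms(5) by (auto intro: continuous_on_compose2)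
next
  case (Suc k)
  \<comment> \<open>The derivative of \<open>g\<close> is applied to a direction that varies with
    \<open>x\<close>, whereas the induction hypothesis covers fixed directions only; expanding in
    the basis separates the two.\<close>
  let ?D = "\<lambda>x v. \<Sum>b\<in>Basis. (frechet_derivative f (at x) v \<bullet> b) *\<^sub>R frechet_derivative g (at (f x)) b"
  have "Ck_on k A (\<lambda>x. ?D x v)" for v
  proof (intro Ck_on_sum Ck_on_scaleR assms(1))
    show "Ck_on k A (\<lambda>x. frechet_derivative f (at x) v \<bullet> i)" for i
      by (rule Ck_on_bounded_linear_compose[OF bounded_linear_inner_left assms(1)])
        (use Suc.prems in auto)
    show "Ck_on k A (\<lambda>x. frechet_derivative g (at (f x)) i)" for i
      using Suc.prems(1)[THEN Ck_on_SucD] Suc.prems(2) by (intro Suc.IH) simp_all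
  qed
  moreover have "((\<lambda>x. g (f x)) has_derivative ?D x) (at x)" if "x \<in> A" for x
  proof -
    have g: "(g has_derivative frechet_derivative g (at (f x))) (at (f x))"
      using Ck_on_Suc_has_derivative[OF Suc.prems(2)] that assms(5) by auto
    have "((\<lambda>x. g (f x)) has_derivative
        (\<lambda>v. frechet_derivative g (at (f x)) (frechet_derivative f (at x) v))) (at x)"
      using has_derivative_compose[OF Ck_on_Suc_has_derivative[OF Suc.prems(1) that] g] .
    moreover have "frechet_derivative g (at (f x)) (frechet_derivative f (at x) v) = ?D x v" for v
      using linear_eq_sum_Basis has_derivative_linear[OF g] by blast
    ultimately show ?thesis by simp
  qed
  ultimately show ?case using Ck_on_SucI[OF assms(1), where f' = ?D] by blast
qed

lemma Ck_on_Pair: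
  fixes f :: "'a::euclidean_space \<Rightarrow> 'b::real_normed_vector" and g :: "'a \<Rightarrow> 'c::real_normed_vector"
  assumes "open A" "Ck_on k A f" "Ck_on k A g"
  shows "Ck_on k A (\<lambda>x. (f x, g x))"
proof -
  have l1: "bounded_linear (\<lambda>x::'b. (x, 0::'c))"
    by (intro bounded_linear_Pair bounded_linear_ident bounded_linear_zero)
  have l2: "bounded_linear (\<lambda>x::'c. (0::'b, x))"
    by (intro bounded_linear_Pair bounded_linear_ident bounded_linear_zero)
  show ?thesis
    using Ck_on_add[OF assms(1) Ck_on_bounded_linear_compose[OF l1 assms(1,2)]
        Ck_on_bounded_linear_compose[OF l2 assms(1,3)]] by simp
qed

text \<open>Componentwise differentiability suffices, because \<open>F y w\<close> is a finite sum
  of coordinates of \<open>w\<close> times values on the basis. The joint derivative in base point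
  and vector is what differentiating a differential along a moving vector requires.\<close>

lemma has_derivative_linear_field:
  fixes F :: "'a::real_normed_vector \<Rightarrow> 'b::euclidean_space \<Rightarrow> 'c::real_normed_vector"
  assumes "open A" "x \<in> A" "\<And>y. y \<in> A \<Longrightarrow> linear (F y)"
    and D: "\<And>w. ((\<lambda>y. F y w) has_derivative (\<lambda>u. F' u w)) (at x)"
  shows "linear (F' u)"
    and "((\<lambda>p. F (fst p) (snd p)) has_derivative (\<lambda>h. F' (fst h) w + F x (snd h))) (at (x, w))"
proof -
  have eq: "F' u w = (\<Sum>b\<in>Basis. (w \<bullet> b) *\<^sub>R F' u b)" for u w
  proof -
    have "((\<lambda>y. \<Sum>b\<in>Basis. (w \<bullet> b) *\<^sub>R F y b) has_derivative (\<lambda>u. \<Sum>b\<in>Basis. (w \<bullet> b) *\<^sub>R F' u b)) (at x)"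
      by (intro has_derivative_sum has_derivative_scaleR_right D)
    then have "((\<lambda>y. F y w) has_derivative (\<lambda>u. \<Sum>b\<in>Basis. (w \<bullet> b) *\<^sub>R F' u b)) (at x)"
      by (rule has_derivative_transform_within_open[OF _ assms(1,2)])
        (rule linear_eq_sum_Basis[OF assms(3), symmetric])
    then show ?thesis by (rule fun_cong[OF has_derivative_unique[OF D]])
  qed
  show "linear (F' u)"
  proof (rule linearI)
    show "F' u (v + w) = F' u v + F' u w" for v w
      by (subst (1 2 3) eq) (simp add: inner_add_left scaleR_add_left sum.distrib)
    show "F' u (r *\<^sub>R v) = r *\<^sub>R F' u v" for r v
      by (subst (1 2) eq) (simp add: scaleR_sum_right)
  qed
  have "((\<lambda>p. \<Sum>b\<in>Basis. (snd p \<bullet> b) *\<^sub>R F (fst p) b) has_derivative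
        (\<lambda>h. \<Sum>b\<in>Basis. (w \<bullet> b) *\<^sub>R F' (fst h) b + (snd h \<bullet> b) *\<^sub>R F x b)) (at (x, w))"
  proof (intro has_derivative_sum)
    fix b :: 'b
    have "((\<lambda>p. F (fst p) b) has_derivative (\<lambda>h. F' (fst h) b)) (at (x, w))"
      by (rule has_derivative_compose[OF has_derivative_fst[OF has_derivative_ident]]) (use D in simp)
    moreover have "((\<lambda>p. snd p \<bullet> b) has_derivative (\<lambda>h. snd h \<bullet> b)) (at (x, w))"
      by (auto intro!: derivative_eq_intros)
    ultimately show "((\<lambda>p. (snd p \<bullet> b) *\<^sub>R F (fst p) b) has_derivative
        (\<lambda>h. (w \<bullet> b) *\<^sub>R F' (fst h) b + (snd h \<bullet> b) *\<^sub>R F x b)) (at (x, w))"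
      using has_derivative_scaleR by fastforce
  qed
  moreover have "(\<Sum>b\<in>Basis. (w \<bullet> b) *\<^sub>R F' (fst h) b + (snd h \<bullet> b) *\<^sub>R F x b) = F' (fst h) w + F x (snd h)"
    for h :: "'a \<times> 'b"
    using eq[of "fst h" w] linear_eq_sum_Basis[OF assms(3)[OF assms(2)], of "snd h"]
    by (simp add: sum.distrib)
  ultimately have *: "((\<lambda>p. \<Sum>b\<in>Basis. (snd p \<bullet> b) *\<^sub>R F (fst p) b) has_derivative
        (\<lambda>h. F' (fst h) w + F x (snd h))) (at (x, w))" by simp
  show "((\<lambda>p. F (fst p) (snd p)) has_derivative (\<lambda>h. F' (fst h) w + F x (snd h))) (at (x, w))"
  proof (rule has_derivative_transform_within_open[OF *, of "A \<times> UNIV"])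
    fix p :: "'a \<times> 'b" assume "p \<in> A \<times> UNIV"
    then show "(\<Sum>b\<in>Basis. (snd p \<bullet> b) *\<^sub>R F (fst p) b) = F (fst p) (snd p)"
      by (intro linear_eq_sum_Basis[symmetric] assms(3)) auto
  qed (use assms(1,2) open_Times in auto)
qed

text \<open>By currying: the form is linear in its last slot over the base of pairs
  \<open>(y, v)\<close>, so the linear case applies twice.\<close>

lemma has_derivative_bilinear_field:
  fixes G :: "'a::real_normed_vector \<Rightarrow> 'b::euclidean_space \<Rightarrow> 'd::euclidean_space \<Rightarrow> 'c::real_normed_vector"
  assumes "open A" "x \<in> A" "\<And>y. y \<in> A \<Longrightarrow> bilinear (G y)"
    and D: "\<And>v w. ((\<lambda>y. G y v w) has_derivative (\<lambda>u. G' u v w)) (at x)"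
  shows "bilinear (G' u)"
    and "((\<lambda>p. G (fst p) (fst (snd p)) (snd (snd p))) has_derivative
           (\<lambda>h. G' (fst h) v w + G x (fst (snd h)) w + G x v (snd (snd h)))) (at (x, v, w))"
proof -
  have lin: "linear (\<lambda>v. G y v w)" "linear (\<lambda>w. G y v w)" if "y \<in> A" for y v w
    using assms(3)[OF that] by (auto simp: bilinear_def)
  note 1 = has_derivative_linear_field[OF assms(1,2), where F = "\<lambda>y v. G y v w" and F' = "\<lambda>u v. G' u v w" for w, OF lin(1) D]
  show "bilinear (G' u)"
    unfolding bilinear_def
    using 1(1) has_derivative_linear_field(1)[OF assms(1,2), where F = "\<lambda>y w. G y v w" and F' = "\<lambda>u w. G' u v w" for v, OF lin(2) D]
    by auto
  have l: "linear (G (fst p) (snd p))" if "p \<in> A \<times> UNIV" for p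
    using that lin by auto
  have "((\<lambda>p. G (fst (fst p)) (snd (fst p)) (snd p)) has_derivative
           (\<lambda>h. (G' (fst (fst h)) v w + G x (snd (fst h)) w) + G (fst (x, v)) (snd (x,v)) (snd h))) (at ((x, v), w))"
    by (rule has_derivative_linear_field(2)[OF open_Times[OF assms(1) open_UNIV],
          where F = "\<lambda>p. G (fst p) (snd p)" and F' = "\<lambda>h w. G' (fst h) v w + G x (snd h) w"])
      (use assms(2) l 1(2) in auto)
  then have *: "((\<lambda>p. G (fst (fst p)) (snd (fst p)) (snd p)) has_derivative
           (\<lambda>h. G' (fst (fst h)) v w + G x (snd (fst h)) w + G x v (snd h))) (at ((x, v), w))" by simp
  have "((\<lambda>p. ((fst p, fst (snd p)), snd (snd p))) has_derivative (\<lambda>h. ((fst h, fst (snd h)), snd (snd h))))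
      (at (x, v, w))" by (auto intro!: derivative_eq_intros)
  from has_derivative_compose[OF this, of "\<lambda>p. G (fst (fst p)) (snd (fst p)) (snd p)"
      "\<lambda>h. G' (fst (fst h)) v w + G x (snd (fst h)) w + G x v (snd h)"] *
  show "((\<lambda>p. G (fst p) (fst (snd p)) (snd (snd p))) has_derivative
           (\<lambda>h. G' (fst h) v w + G x (fst (snd h)) w + G x v (snd (snd h)))) (at (x, v, w))"
    by simp
qed

lemma has_vector_derivative_linear_field:
  fixes F :: "'a::real_normed_vector \<Rightarrow> 'b::euclidean_space \<Rightarrow> 'c::real_normed_vector"
  assumes "open A" "c s \<in> A" "\<And>y. y \<in> A \<Longrightarrow> linear (F y)"
    and "\<And>w. ((\<lambda>y. F y w) has_derivative (\<lambda>u. F' u w)) (at (c s))"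
    and "(c has_vector_derivative c') (at s within I)" "(v has_vector_derivative v') (at s within I)"
  shows "((\<lambda>s. F (c s) (v s)) has_vector_derivative (F' c' (v s) + F (c s) v')) (at s within I)"
proof -
  have F: "((\<lambda>p. F (fst p) (snd p)) has_derivative (\<lambda>h. F' (fst h) (v s) + F (c s) (snd h))) (at (c s, v s))"
    using has_derivative_linear_field(2)[OF assms(1-4)] .
  have "((\<lambda>s. (c s, v s)) has_derivative (\<lambda>h. (h *\<^sub>R c', h *\<^sub>R v'))) (at s within I)"
    using assms(5,6) unfolding has_vector_derivative_def by (intro has_derivative_Pair)
  from has_derivative_compose[OF this F]
  have "((\<lambda>s. F (c s) (v s)) has_derivative (\<lambda>h. F' (h *\<^sub>R c') (v s) + F (c s) (h *\<^sub>R v'))) (at s within I)"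
    by simp
  moreover have "F' (h *\<^sub>R c') (v s) + F (c s) (h *\<^sub>R v') = h *\<^sub>R (F' c' (v s) + F (c s) v')" for h
    using linear_scale[OF has_derivative_linear[OF assms(4)]] linear_scale[OF assms(3)[OF assms(2)]]
    by (simp add: scaleR_add_right)
  ultimately show ?thesis by (simp add: has_vector_derivative_def)
qed

lemma has_vector_derivative_compose_field:
  assumes "(f has_derivative f') (at (c s))" "(c has_vector_derivative c') (at s within I)"
  shows "((\<lambda>s. f (c s)) has_vector_derivative f' c') (at s within I)"
proof -
  have "((\<lambda>s. f (c s)) has_derivative (\<lambda>h. f' (h *\<^sub>R c'))) (at s within I)"
    using has_derivative_compose[of c "\<lambda>h. h *\<^sub>R c'", OF _ assms(1)] assms(2)
    by (simp add: has_vector_derivative_def)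
  then show ?thesis
    using linear_scale[OF has_derivative_linear[OF assms(1)]] by (simp add: has_vector_derivative_def)
qed

section \<open>Symmetry of the second derivative\<close>

lemma second_difference_mean_value:
  fixes f :: "'a::euclidean_space \<Rightarrow> real"
  assumes "open A" "Ck_on 2 A f" "s > 0"
    and in_A: "\<And>a b. a \<in> {0..s} \<Longrightarrow> b \<in> {0..s} \<Longrightarrow> x + a *\<^sub>R u + b *\<^sub>R v \<in> A"
  shows "\<exists>a\<in>{0..s}. \<exists>b\<in>{0..s}.
    f (x + s *\<^sub>R u + s *\<^sub>R v) - f (x + s *\<^sub>R u) - f (x + s *\<^sub>R v) + f x =
    s * s * frechet_derivative (\<lambda>y. frechet_derivative f (at y) u) (at (x + a *\<^sub>R u + b *\<^sub>R v)) v"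
proof -
  let ?D = "\<lambda>y. frechet_derivative f (at y)"
  have f: "(f has_derivative ?D y) (at y)" if "y \<in> A" for y
    using Ck_on_Suc_has_derivative[of 1 A f] assms(2) that by (simp add: numeral_2_eq_2)
  have Df: "((\<lambda>y. ?D y u) has_derivative frechet_derivative (\<lambda>y. ?D y u) (at y)) (at y)" if "y \<in> A" for y
    using Ck_on_Suc_has_derivative[of 0 A "\<lambda>y. ?D y u"] assms(2) that by (simp add: numeral_2_eq_2)
  let ?g = "\<lambda>a. f (x + a *\<^sub>R u + s *\<^sub>R v) - f (x + a *\<^sub>R u)"
  have "\<exists>a\<in>{0<..<s}. ?g s - ?g 0 = (\<lambda>h. h * (?D (x + a *\<^sub>R u + s *\<^sub>R v) u - ?D (x + a *\<^sub>R u) u)) (s - 0)"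
  proof (rule mvt_simple[OF assms(3)])
    fix a assume a: "0 \<le> a" "a \<le> s"
    have 1: "((\<lambda>a. f (x + a *\<^sub>R u + b *\<^sub>R v)) has_vector_derivative ?D (x + a *\<^sub>R u + b *\<^sub>R v) u) (at a within {0..s})"
      if "b \<in> {0..s}" for b
      by (rule has_vector_derivative_compose_field[OF f])
        (use in_A a that assms(3) in \<open>auto intro!: derivative_eq_intros\<close>)
    show "(?g has_derivative (\<lambda>h. h * (?D (x + a *\<^sub>R u + s *\<^sub>R v) u - ?D (x + a *\<^sub>R u) u))) (at a within {0..s})"
      using has_vector_derivative_diff[OF 1[of s] 1[of 0]] assms(3)
      by (simp add: has_vector_derivative_def)
  qed
  then obtain a where a: "a \<in> {0<..<s}" "?g s - ?g 0 = s * (?D (x + a *\<^sub>R u + s *\<^sub>R v) u - ?D (x + a *\<^sub>R u) u)"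
    by auto
  let ?h = "\<lambda>b. ?D (x + a *\<^sub>R u + b *\<^sub>R v) u"
  have "\<exists>b\<in>{0<..<s}. ?h s - ?h 0 = (\<lambda>h. h * (frechet_derivative (\<lambda>y. ?D y u) (at (x + a *\<^sub>R u + b *\<^sub>R v)) v)) (s - 0)"
  proof (rule mvt_simple[OF assms(3)])
    fix b assume b: "0 \<le> b" "b \<le> s"
    have "(?h has_vector_derivative frechet_derivative (\<lambda>y. ?D y u) (at (x + a *\<^sub>R u + b *\<^sub>R v)) v) (at b within {0..s})"
      by (rule has_vector_derivative_compose_field[OF Df])
        (use in_A a b in \<open>auto intro!: derivative_eq_intros\<close>)
    then show "(?h has_derivative (\<lambda>h. h * (frechet_derivative (\<lambda>y. ?D y u) (at (x + a *\<^sub>R u + b *\<^sub>R v)) v))) (at b within {0..s})"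
      by (simp add: has_vector_derivative_def)
  qed
  then obtain b where b: "b \<in> {0<..<s}" "?h s - ?h 0 = s * (frechet_derivative (\<lambda>y. ?D y u) (at (x + a *\<^sub>R u + b *\<^sub>R v)) v)"
    by auto
  show ?thesis
    using a b by (intro bexI[of _ a] bexI[of _ b]) (auto simp: algebra_simps)
qed

text \<open>The second difference over the parallelogram spanned by \<open>s u\<close> and
  \<open>s v\<close> is symmetric in \<open>u\<close> and \<open>v\<close>. It equals
  \<open>s^2\<close> times either mixed derivative at some point of the parallelogram, and
  continuity carries the equality to the corner \<open>x\<close>.\<close>

lemma second_derivative_symmetric_real:
  fixes f :: "'a::euclidean_space \<Rightarrow> real"
  assumes "open A" "x \<in> A" "Ck_on 2 A f"
  shows "frechet_derivative (\<lambda>y. frechet_derivative f (at y) u) (at x) v =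
         frechet_derivative (\<lambda>y. frechet_derivative f (at y) v) (at x) u"
proof -
  let ?D2 = "\<lambda>u v y. frechet_derivative (\<lambda>y. frechet_derivative f (at y) u) (at y) v"
  have cont: "continuous_on A (?D2 u v)" for u v
    using assms(3) by (simp add: numeral_2_eq_2)
  have "dist (?D2 u v x) (?D2 v u x) \<le> e" if "e > 0" for e
  proof -
    have e2: "e/2 > 0" using that by simp
    obtain d1 where d1: "d1 > 0" "\<And>y. y \<in> A \<Longrightarrow> dist y x < d1 \<Longrightarrow> dist (?D2 u v y) (?D2 u v x) < e/2"
      using cont[of u v] e2 assms(2) unfolding continuous_on_iff by blast
    obtain d2 where d2: "d2 > 0" "\<And>y. y \<in> A \<Longrightarrow> dist y x < d2 \<Longrightarrow> dist (?D2 v u y) (?D2 v u x) < e/2"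
      using cont[of v u] e2 assms(2) unfolding continuous_on_iff by blast
    obtain r where r: "r > 0" "ball x r \<subseteq> A" using assms(1,2) open_contains_ball by blast
    define d where "d = min r (min d1 d2)"
    \<comment> \<open>The factor 2 keeps the whole parallelogram strictly within distance
      \<open>d\<close> of \<open>x\<close>; the summand 1 covers the case that both vectors
      vanish.\<close>
    define s where "s = d / (2 * (norm u + norm v + 1))"
    have d: "d > 0" using r d1 d2 by (simp add: d_def)
    have pos: "norm u + norm v + 1 > 0" by (smt (verit) norm_ge_zero)
    have s: "s > 0" using d pos by (simp add: s_def)
    have near: "dist (x + a *\<^sub>R u + b *\<^sub>R v) x < d" if "a \<in> {0..s}" "b \<in> {0..s}" for a b
    proof -
      have "norm (a *\<^sub>R u + b *\<^sub>R v) \<le> s * norm u + s * norm v"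
        using that by (intro norm_triangle_le add_mono) (auto intro!: mult_right_mono)
      also have "\<dots> < s * (2 * (norm u + norm v + 1))"
        using s by (simp add: algebra_simps) (smt (verit) mult_nonneg_nonneg norm_ge_zero)
      also have "\<dots> = d" using pos by (simp add: s_def)
      finally show ?thesis by (simp add: dist_norm algebra_simps)
    qed
    have in_A: "x + a *\<^sub>R u + b *\<^sub>R v \<in> A" if "a \<in> {0..s}" "b \<in> {0..s}" for a b
      using near[OF that] r by (auto simp: d_def dist_commute subset_iff)
    have in_A': "x + b *\<^sub>R v + a *\<^sub>R u \<in> A" if "b \<in> {0..s}" "a \<in> {0..s}" for a b
      using in_A that by (simp add: add.commute add.left_commute add.assoc)
    obtain a b where 1: "a \<in> {0..s}" "b \<in> {0..s}"
      "f (x + s *\<^sub>R u + s *\<^sub>R v) - f (x + s *\<^sub>R u) - f (x + s *\<^sub>R v) + f x = s * s * ?D2 u v (x + a *\<^sub>R u + b *\<^sub>R v)"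
      using second_difference_mean_value[OF assms(1,3) s in_A] by blast
    obtain a' b' where 2: "a' \<in> {0..s}" "b' \<in> {0..s}"
      "f (x + s *\<^sub>R v + s *\<^sub>R u) - f (x + s *\<^sub>R v) - f (x + s *\<^sub>R u) + f x = s * s * ?D2 v u (x + a' *\<^sub>R v + b' *\<^sub>R u)"
      using second_difference_mean_value[OF assms(1,3) s in_A'] by blast
    have swap: "x + s *\<^sub>R v + s *\<^sub>R u = x + s *\<^sub>R u + s *\<^sub>R v" by (simp add: algebra_simps)
    have "s * s * ?D2 u v (x + a *\<^sub>R u + b *\<^sub>R v) = s * s * ?D2 v u (x + a' *\<^sub>R v + b' *\<^sub>R u)"
      using 1(3) 2(3)[unfolded swap] by linarith
    then have eq: "?D2 u v (x + a *\<^sub>R u + b *\<^sub>R v) = ?D2 v u (x + a' *\<^sub>R v + b' *\<^sub>R u)"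
      using s by simp
    have "x + a' *\<^sub>R v + b' *\<^sub>R u = x + b' *\<^sub>R u + a' *\<^sub>R v" by simp
    then have "dist (x + a' *\<^sub>R v + b' *\<^sub>R u) x < d2"
      using near[OF 2(2,1)] unfolding d_def by (simp only: min_less_iff_conj)
    with in_A'[OF 2(1,2)] have "dist (?D2 v u (x + a' *\<^sub>R v + b' *\<^sub>R u)) (?D2 v u x) < e/2"
      by (rule d2(2))
    moreover have "dist (x + a *\<^sub>R u + b *\<^sub>R v) x < d1"
      using near[OF 1(1,2)] by (simp add: d_def)
    with in_A[OF 1(1,2)] have "dist (?D2 u v (x + a *\<^sub>R u + b *\<^sub>R v)) (?D2 u v x) < e/2"
      by (rule d1(2))
    ultimately show ?thesis unfolding eq dist_real_def by linarith
  qed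
  then have "dist (?D2 u v x) (?D2 v u x) \<le> 0 + e" if "e > 0" for e
    using that by simp
  then have "dist (?D2 u v x) (?D2 v u x) \<le> 0" by (rule field_le_epsilon)
  then show ?thesis by simp
qed

lemma second_derivative_symmetric:
  fixes f :: "'a::euclidean_space \<Rightarrow> 'b::euclidean_space"
  assumes "open A" "x \<in> A" "Ck_on 2 A f"
  shows "frechet_derivative (\<lambda>y. frechet_derivative f (at y) u) (at x) v =
         frechet_derivative (\<lambda>y. frechet_derivative f (at y) v) (at x) u"
proof (rule euclidean_eqI)
  fix b :: 'b
  have f: "(f has_derivative frechet_derivative f (at y)) (at y)" if "y \<in> A" for y
    using Ck_on_Suc_has_derivative[of 1 A f] assms(3) that by (simp add: numeral_2_eq_2)
  have Df: "((\<lambda>y. frechet_derivative f (at y) u) has_derivative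
      frechet_derivative (\<lambda>y. frechet_derivative f (at y) u) (at y)) (at y)" if "y \<in> A" for y u
    using Ck_on_Suc_has_derivative[of 0 A "\<lambda>y. frechet_derivative f (at y) u"] assms(3) that
    by (simp add: numeral_2_eq_2)
  have 1: "frechet_derivative (\<lambda>y. f y \<bullet> b) (at y) = (\<lambda>u. frechet_derivative f (at y) u \<bullet> b)" if "y \<in> A" for y
    using frechet_derivative_at[OF has_derivative_inner_left[OF f[OF that]]] by simp
  have 2: "frechet_derivative (\<lambda>y. frechet_derivative (\<lambda>y. f y \<bullet> b) (at y) u) (at x) v =
      frechet_derivative (\<lambda>y. frechet_derivative f (at y) u) (at x) v \<bullet> b" for u v
  proof -
    have "((\<lambda>y. frechet_derivative (\<lambda>y. f y \<bullet> b) (at y) u) has_derivative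
        (\<lambda>v. frechet_derivative (\<lambda>y. frechet_derivative f (at y) u) (at x) v \<bullet> b)) (at x)"
      by (rule has_derivative_transform_within_open[OF has_derivative_inner_left[OF Df[OF assms(2)]] assms(1,2)])
        (simp add: 1)
    then show ?thesis using frechet_derivative_at by metis
  qed
  have "Ck_on 2 A (\<lambda>y. f y \<bullet> b)"
    by (rule Ck_on_bounded_linear_compose[OF bounded_linear_inner_left assms(1,3)])
  from second_derivative_symmetric_real[OF assms(1,2) this, of u v]
  show "frechet_derivative (\<lambda>y. frechet_derivative f (at y) u) (at x) v \<bullet> b =
         frechet_derivative (\<lambda>y. frechet_derivative f (at y) v) (at x) u \<bullet> b"
    using 2 by simp
qed

section \<open>Uniform bounds on compact balls\<close>

lemma compact_bounded_above:
  fixes f :: "'a::topological_space \<Rightarrow> real"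
  assumes "compact K" "continuous_on K f"
  shows "\<exists>L. \<forall>x\<in>K. f x \<le> L"
  using bounded_imp_bdd_above[OF compact_imp_bounded[OF compact_continuous_image[OF assms(2,1)]]]
  by (auto simp: bdd_above_def)

text \<open>The derivative is bounded by compactness, and convexity of the ball turns this into a
  Lipschitz bound. It will be applied to the components of the metric and to combinations of their
  first derivatives.\<close>

lemma Ck_on_1_lipschitz_cball:
  fixes f :: "'a::euclidean_space \<Rightarrow> 'b::real_normed_vector"
  assumes "open A" "Ck_on 1 A f" "cball z r \<subseteq> A"
  shows "\<exists>L\<ge>0. \<forall>x\<in>cball z r. \<forall>y\<in>cball z r. norm (f x - f y) \<le> L * norm (x - y)"
proof -
  let ?D = "\<lambda>x. frechet_derivative f (at x)"
  have c: "continuous_on (cball z r) (\<lambda>x. \<Sum>b\<in>Basis. norm (?D x b))"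
    using assms(2,3) by (intro continuous_intros) (auto intro: continuous_on_subset)
  obtain L where L: "\<And>x. x \<in> cball z r \<Longrightarrow> (\<Sum>b\<in>Basis. norm (?D x b)) \<le> L"
    using compact_bounded_above[OF compact_cball c] by blast
  have "norm (f x - f y) \<le> max L 0 * norm (x - y)" if "x \<in> cball z r" "y \<in> cball z r" for x y
  proof (rule differentiable_bound[OF convex_cball _ _ that(1,2)])
    fix w assume w: "w \<in> cball z r"
    show d: "(f has_derivative ?D w) (at w within cball z r)"
      using has_derivative_at_withinI[OF Ck_on_Suc_has_derivative[of 0 A f w]]
        assms(2) subsetD[OF assms(3) w] by simp
    have "norm (?D w h) \<le> max L 0 * norm h" for h
    proof -
      have "norm (?D w h) = norm (\<Sum>b\<in>Basis. (h \<bullet> b) *\<^sub>R ?D w b)"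
        using linear_eq_sum_Basis[OF has_derivative_linear[OF d]] by metis
      also have "\<dots> \<le> (\<Sum>b\<in>Basis. norm h * norm (?D w b))"
        by (intro sum_norm_le) (auto intro!: mult_right_mono Basis_le_norm)
      also have "\<dots> \<le> max L 0 * norm h"
        using L[OF w] unfolding sum_distrib_left[symmetric] by (simp add: mult.commute mult_left_mono)
      finally show ?thesis .
    qed
    then show "onorm (?D w) \<le> max L 0" by (intro onorm_bound) auto
  qed
  then show ?thesis by (intro exI[of _ "max L 0"]) auto
qed

section \<open>Local existence for ordinary differential equations\<close>

text \<open>Precomposing \<open>F\<close> with the nearest-point projection onto the ball, which
  does not increase distances, gives a bounded and globally Lipschitz field \<open>H\<close>. The
  integral operator is then a contraction on all bounded continuous functions on the line; its fixed
  point stays in the ball, where \<open>H\<close> and \<open>F\<close> agree.\<close>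

lemma picard_local_existence:
  fixes F :: "'a::euclidean_space \<Rightarrow> 'a"
  assumes "R > 0"
    and lip: "\<And>x y. x \<in> cball x0 R \<Longrightarrow> y \<in> cball x0 R \<Longrightarrow> norm (F x - F y) \<le> L * norm (x - y)"
  shows "\<exists>e>0. \<exists>c. c 0 = x0 \<and>
    (\<forall>s\<in>{0..e}. c s \<in> cball x0 R \<and> (c has_vector_derivative F (c s)) (at s within {0..e}))"
proof -
  let ?B = "cball x0 R"
  define L' where "L' = max L 0"
  have lip': "norm (F x - F y) \<le> L' * norm (x - y)" if "x \<in> ?B" "y \<in> ?B" for x y
  proof -
    have "L * norm (x - y) \<le> L' * norm (x - y)" by (rule mult_right_mono) (simp_all add: L'_def)
    with lip[OF that] show ?thesis by linarith
  qed
  have B: "convex ?B" "closed ?B" "?B \<noteq> {}" "x0 \<in> ?B" using assms(1) by auto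
  define P where "P = closest_point ?B"
  have P_in: "P x \<in> ?B" for x unfolding P_def by (rule closest_point_in_set[OF B(2,3)])
  have P_id: "P x = x" if "x \<in> ?B" for x unfolding P_def by (rule closest_point_self[OF that])
  have P_lip: "norm (P x - P y) \<le> norm (x - y)" for x y
    using closest_point_lipschitz[OF B(1-3), of x y] by (simp add: P_def dist_norm)
  define H where "H x = F (P x)" for x
  have H_lip: "norm (H x - H y) \<le> L' * norm (x - y)" for x y
  proof -
    have "norm (H x - H y) \<le> L' * norm (P x - P y)" unfolding H_def by (rule lip'[OF P_in P_in])
    also have "\<dots> \<le> L' * norm (x - y)" by (rule mult_left_mono[OF P_lip]) (simp add: L'_def)
    finally show ?thesis .
  qed
  define N where "N = norm (F x0) + L' * R"
  have N: "N \<ge> 0" using assms(1) by (simp add: N_def L'_def)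
  have H_bound: "norm (H x) \<le> N" for x
  proof -
    have "norm (H x) \<le> norm (F x0) + norm (F (P x) - F x0)"
      unfolding H_def by (metis add.commute norm_triangle_sub)
    also have "norm (F (P x) - F x0) \<le> L' * norm (P x - x0)" by (rule lip'[OF P_in B(4)])
    also have "\<dots> \<le> L' * R"
      using P_in[of x] by (intro mult_left_mono) (simp_all add: dist_norm norm_minus_commute L'_def)
    finally show ?thesis by (simp add: N_def)
  qed
  have H_cont: "continuous_on UNIV H"
    using lipschitz_on_continuous_on[of L' UNIV H] H_lip
    by (auto simp: lipschitz_on_def dist_norm L'_def)
  \<comment> \<open>The first bound makes the integral operator a contraction with factor 1/2, the
    second keeps its values within distance \<open>R\<close> of \<open>x0\<close>. The added ones
    avoid division by zero.\<close>
  define e where "e = min (1 / (2 * (L' + 1))) (R / (N + 1))"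
  have L'0: "L' \<ge> 0" by (simp add: L'_def)
  have e: "e > 0" using assms(1) N L'0 by (simp add: e_def)
  have eL: "e * L' \<le> 1/2"
  proof -
    have "e * L' \<le> (1 / (2 * (L' + 1))) * L'" by (rule mult_right_mono) (simp_all add: e_def L'0)
    also have "\<dots> \<le> 1/2" using L'0 by (simp add: field_simps)
    finally show ?thesis .
  qed
  have eN: "e * N \<le> R"
  proof -
    have "e * N \<le> (R / (N + 1)) * N" by (rule mult_right_mono) (simp_all add: e_def N)
    also have "\<dots> \<le> R" using N assms(1) by (simp add: field_simps)
    finally show ?thesis .
  qed
  \<comment> \<open>Time is clamped to \<open>[0, e]\<close>, so that the iterates are bounded
    continuous functions on the whole line, the complete space in which the fixed point is
    sought.\<close>
  define cl where "cl t = max 0 (min t e)" for t :: real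
  have cl: "cl t \<in> {0..e}" for t using e by (auto simp: cl_def)
  have cl_id: "cl t = t" if "t \<in> {0..e}" for t using that by (auto simp: cl_def)
  define T where "T f t = x0 + integral {0..cl t} (\<lambda>s. H (apply_bcontfun f s))" for f :: "real \<Rightarrow>\<^sub>C 'a" and t
  have contH: "continuous_on S (\<lambda>s. H (apply_bcontfun f s))" for f :: "real \<Rightarrow>\<^sub>C 'a" and S
    by (rule continuous_on_compose2[OF H_cont]) (auto intro: continuous_intros)
  have intH: "(\<lambda>s. H (apply_bcontfun f s)) integrable_on {0..t}" for f :: "real \<Rightarrow>\<^sub>C 'a" and t
    by (rule integrable_continuous_real[OF contH])
  have T_bound: "norm (T f t - x0) \<le> R" for f t
  proof -
    have "norm (integral {0..cl t} (\<lambda>s. H (apply_bcontfun f s))) \<le> N * (cl t - 0)"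
      by (rule integral_bound[OF _ contH]) (use cl[of t] H_bound in auto)
    also have "\<dots> \<le> N * e" using cl[of t] N by (intro mult_left_mono) auto
    also have "\<dots> \<le> R" using eN by (simp add: mult.commute)
    finally show ?thesis by (simp add: T_def)
  qed
  have T_cont: "continuous_on UNIV (T f)" for f
  proof -
    have "continuous_on {0..e} (\<lambda>t. integral {0..t} (\<lambda>s. H (apply_bcontfun f s)))"
      by (rule indefinite_integral_continuous_1[OF intH])
    then have "continuous_on UNIV (\<lambda>t. integral {0..cl t} (\<lambda>s. H (apply_bcontfun f s)))"
      by (rule continuous_on_compose2) (use cl in \<open>auto simp: cl_def intro!: continuous_intros\<close>)
    then show ?thesis unfolding T_def[abs_def] by (intro continuous_intros)
  qed
  have T_in: "T f \<in> bcontfun" for f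
    unfolding bcontfun_def
  proof (intro CollectI conjI T_cont)
    have "range (T f) \<subseteq> ?B" using T_bound[of f] by (auto simp: dist_norm norm_minus_commute)
    then show "bounded (range (T f))" using bounded_cball bounded_subset by blast
  qed
  define TT where "TT f = Bcontfun (T f)" for f
  have TT: "apply_bcontfun (TT f) = T f" for f
    unfolding TT_def by (rule Bcontfun_inverse[OF T_in])
  have "\<exists>!f\<in>UNIV. TT f = f"
  proof (rule Banach_fix[where c = "1/2"])
    show "complete (UNIV :: (real \<Rightarrow>\<^sub>C 'a) set)" by (rule complete_UNIV)
    show "dist (TT f) (TT g) \<le> 1/2 * dist f g" for f g
    proof (rule dist_bound)
      fix t
      let ?h = "\<lambda>s. H (apply_bcontfun f s) - H (apply_bcontfun g s)"
      have "T f t - T g t = integral {0..cl t} ?h"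
        unfolding T_def using integral_diff[OF intH intH] by simp
      also have "norm \<dots> \<le> (L' * dist f g) * (cl t - 0)"
      proof (rule integral_bound)
        show "continuous_on {0..cl t} ?h" by (intro continuous_on_diff contH)
        fix s
        have "norm (?h s) \<le> L' * norm (apply_bcontfun f s - apply_bcontfun g s)" by (rule H_lip)
        also have "\<dots> \<le> L' * dist f g"
          using dist_bounded[of f s g] by (intro mult_left_mono L'0) (simp add: dist_norm)
        finally show "norm (?h s) \<le> L' * dist f g" .
      qed (use cl[of t] in auto)
      also have "\<dots> \<le> (L' * dist f g) * e"
        using cl[of t] L'0 by (intro mult_left_mono) auto
      also have "\<dots> = (e * L') * dist f g" by simp
      also have "\<dots> \<le> 1/2 * dist f g" by (rule mult_right_mono[OF eL]) simp
      finally show "dist (apply_bcontfun (TT f) t) (apply_bcontfun (TT g) t) \<le> 1/2 * dist f g"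
        by (simp add: TT dist_norm)
    qed
  qed auto
  then obtain f where f: "TT f = f" by blast
  define c where "c = apply_bcontfun f"
  have c_eq: "c = T f" using TT[of f] f by (simp add: c_def)
  have c_in: "c t \<in> ?B" for t
    using T_bound[of f t] by (simp add: c_eq dist_norm norm_minus_commute)
  have "(c has_vector_derivative F (c s)) (at s within {0..e})" if s: "s \<in> {0..e}" for s
  proof -
    have "((\<lambda>t. x0 + integral {0..t} (\<lambda>s. H (c s))) has_vector_derivative (0 + H (c s))) (at s within {0..e})"
      by (intro has_vector_derivative_add has_vector_derivative_const integral_has_vector_derivative)
        (use s contH[of "{0..e}" f] in \<open>simp_all add: c_def\<close>)
    then have "((\<lambda>t. x0 + integral {0..t} (\<lambda>s. H (c s))) has_vector_derivative F (c s)) (at s within {0..e})"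
      using P_id[OF c_in] by (simp add: H_def)
    moreover have "c t = x0 + integral {0..t} (\<lambda>s. H (c s))" if "t \<in> {0..e}" for t
      using fun_cong[OF c_eq, of t] cl_id[OF that] by (simp add: T_def c_def)
    ultimately show ?thesis
      by (intro has_vector_derivative_transform[OF s, of c])
  qed
  moreover have "c 0 = x0" using cl_id[of 0] e by (simp add: c_eq T_def)
  ultimately show ?thesis using e c_in by (intro exI[of _ e] exI[of _ c] conjI ballI) auto
qed

section \<open>The Levi-Civita connection of a metric in coordinates\<close>

text \<open>The characterisation used in \<open>christoffel\<close>, as a predicate for metrics on a
  vector space; existence and uniqueness are settled there before charts come in.\<close>

definition levi_civita :: "('e::euclidean_space \<Rightarrow> 'e \<Rightarrow> 'e \<Rightarrow> real) \<Rightarrow> 'e \<Rightarrow> ('e \<Rightarrow> 'e \<Rightarrow> 'e) \<Rightarrow> bool" where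
  "levi_civita G y \<Gamma> \<longleftrightarrow> bilinear \<Gamma> \<and> (\<forall>v w. \<Gamma> v w = \<Gamma> w v) \<and>
     (\<forall>u v w. frechet_derivative (\<lambda>z. G z v w) (at y) u = G y (\<Gamma> u v) w + G y v (\<Gamma> u w))"

text \<open>One constant serves for size and for variation: a bound at the centre plus the variation
  over the ball bounds the form everywhere, and \<open>r + 1\<close> instead of \<open>r\<close>
  keeps the constant above the Lipschitz constant \<open>S\<close>.\<close>

lemma bilinear_field_lipschitz:
  fixes B :: "'a::euclidean_space \<Rightarrow> 'b::euclidean_space \<Rightarrow> 'd::euclidean_space \<Rightarrow> 'c::real_normed_vector"
  assumes bil: "\<And>x. x \<in> cball z r \<Longrightarrow> bilinear (B x)" and "r \<ge> 0"
    and lip: "\<And>a b. a \<in> Basis \<Longrightarrow> b \<in> Basis \<Longrightarrow>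
      \<exists>L\<ge>0. \<forall>x\<in>cball z r. \<forall>y\<in>cball z r. norm (B x a b - B y a b) \<le> L * norm (x - y)"
  shows "\<exists>K\<ge>0. (\<forall>x\<in>cball z r. \<forall>v w. norm (B x v w) \<le> K * norm v * norm w) \<and>
    (\<forall>x\<in>cball z r. \<forall>y\<in>cball z r. \<forall>v w. norm (B x v w - B y v w) \<le> K * norm (x - y) * norm v * norm w)"
proof -
  obtain L where L: "\<And>a b. a \<in> Basis \<Longrightarrow> b \<in> Basis \<Longrightarrow> L a b \<ge> 0"
    "\<And>a b x y. a \<in> Basis \<Longrightarrow> b \<in> Basis \<Longrightarrow> x \<in> cball z r \<Longrightarrow> y \<in> cball z r \<Longrightarrow>
      norm (B x a b - B y a b) \<le> L a b * norm (x - y)"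
    using lip by metis
  define S where "S = (\<Sum>a\<in>(Basis::'b set). \<Sum>b\<in>(Basis::'d set). L a b)"
  have S0: "S \<ge> 0" unfolding S_def by (intro sum_nonneg L(1))
  have dif: "norm (B x v w - B y v w) \<le> S * norm (x - y) * norm v * norm w"
    if "x \<in> cball z r" "y \<in> cball z r" for x y v w
  proof -
    have "B x v w - B y v w = (\<Sum>a\<in>Basis. \<Sum>b\<in>Basis. ((v \<bullet> a) * (w \<bullet> b)) *\<^sub>R (B x a b - B y a b))"
      unfolding bilinear_eq_sum_Basis[OF bil[OF that(1)], of v w] bilinear_eq_sum_Basis[OF bil[OF that(2)], of v w]
      by (simp add: sum_subtractf[symmetric] scaleR_diff_right)
    also have "norm \<dots> \<le> (\<Sum>a\<in>Basis. \<Sum>b\<in>Basis. (norm v * norm w) * (L a b * norm (x - y)))"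
    proof (intro sum_norm_le)
      fix a :: 'b and b :: 'd assume ab: "a \<in> Basis" "b \<in> Basis"
      have "\<bar>(v \<bullet> a) * (w \<bullet> b)\<bar> \<le> norm v * norm w"
        unfolding abs_mult by (intro mult_mono Basis_le_norm ab) auto
      then show "norm (((v \<bullet> a) * (w \<bullet> b)) *\<^sub>R (B x a b - B y a b)) \<le> (norm v * norm w) * (L a b * norm (x - y))"
        unfolding norm_scaleR by (intro mult_mono L(2) ab that) auto
    qed
    also have "\<dots> = S * norm (x - y) * norm v * norm w"
      by (simp add: S_def sum_distrib_left sum_distrib_right mult_ac)
    finally show ?thesis .
  qed
  have z: "z \<in> cball z r" using assms(2) by simp
  obtain K0 where K0: "K0 > 0" "\<And>v w. norm (B z v w) \<le> K0 * norm v * norm w"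
    using bilinear_bounded_pos[OF bil[OF z]] by blast
  have "norm (B x v w) \<le> (K0 + S * (r + 1)) * norm v * norm w" if x: "x \<in> cball z r" for x v w
  proof -
    have "norm (B x v w) \<le> norm (B z v w) + norm (B x v w - B z v w)" by (rule norm_triangle_sub)
    also have "\<dots> \<le> K0 * norm v * norm w + S * norm (x - z) * norm v * norm w"
      by (intro add_mono K0 dif x z)
    also have "\<dots> \<le> K0 * norm v * norm w + S * (r + 1) * norm v * norm w"
      using x S0 by (intro add_left_mono mult_right_mono mult_left_mono)
        (auto simp: dist_norm norm_minus_commute)
    finally show ?thesis by (simp add: algebra_simps)
  qed
  moreover have "norm (B x v w - B y v w) \<le> (K0 + S * (r + 1)) * norm (x - y) * norm v * norm w"
    if xy: "x \<in> cball z r" "y \<in> cball z r" for x y v w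
  proof -
    have "S * 1 \<le> S * (r + 1)" using S0 assms(2) by (intro mult_left_mono) auto
    then have "S \<le> K0 + S * (r + 1)" using K0(1) by linarith
    then have "S * norm (x - y) * norm v * norm w \<le> (K0 + S * (r + 1)) * norm (x - y) * norm v * norm w"
      by (intro mult_right_mono) auto
    with dif[OF xy, of v w] show ?thesis by linarith
  qed
  moreover have "K0 + S * (r + 1) \<ge> 0" using K0(1) S0 assms(2) by auto
  ultimately show ?thesis by blast
qed

text \<open>A metric read in one chart. Nondegeneracy makes the Koszul equation uniquely solvable.
  C^2 components give it a C^1 right-hand side, hence a Lipschitz Christoffel map and geodesics for
  all initial data.\<close>

locale pseudo_riemannian =
  fixes A :: "'e::euclidean_space set" and G :: "'e \<Rightarrow> 'e \<Rightarrow> 'e \<Rightarrow> real"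
  assumes open_A: "open A"
    and bilinear_G: "y \<in> A \<Longrightarrow> bilinear (G y)"
    and sym_G: "y \<in> A \<Longrightarrow> G y v w = G y w v"
    and nondegenerate: "y \<in> A \<Longrightarrow> (\<And>w. G y v w = 0) \<Longrightarrow> v = 0"
    and C2_G: "Ck_on 2 A (\<lambda>y. G y v w)"
begin

definition D :: "'e \<Rightarrow> 'e \<Rightarrow> 'e \<Rightarrow> 'e \<Rightarrow> real" where
  "D y u v w = frechet_derivative (\<lambda>z. G z v w) (at y) u"

definition chr :: "'e \<Rightarrow> 'e \<Rightarrow> 'e \<Rightarrow> 'e" where
  "chr y = (THE \<Gamma>. levi_civita G y \<Gamma>)"

lemma D_derivative: "y \<in> A \<Longrightarrow> ((\<lambda>z. G z v w) has_derivative (\<lambda>u. D y u v w)) (at y)"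
  using Ck_on_Suc_has_derivative[of 1 A "\<lambda>y. G y v w"] C2_G by (simp add: numeral_2_eq_2 D_def)

lemma Ck_1_D: "Ck_on 1 A (\<lambda>y. D y u v w)"
  using C2_G[of v w] by (simp add: numeral_2_eq_2 D_def)

lemma Ck_1_G: "Ck_on 1 A (\<lambda>y. G y v w)"
  using Ck_on_mono[OF C2_G, of 1] by simp

lemma bilinear_D: "y \<in> A \<Longrightarrow> bilinear (D y u)"
  by (rule has_derivative_bilinear_field(1)[OF open_A _ bilinear_G D_derivative])

lemma linear_D: "y \<in> A \<Longrightarrow> linear (\<lambda>u. D y u v w)"
  using has_derivative_linear[OF D_derivative] .

lemma sym_D:
  assumes "y \<in> A"
  shows "D y u v w = D y u w v"
proof -
  have "((\<lambda>z. G z v w) has_derivative (\<lambda>u. D y u w v)) (at y)"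
    by (rule has_derivative_transform_within_open[OF D_derivative open_A]) (use assms sym_G in auto)
  from has_derivative_unique[OF this D_derivative[OF assms]] show ?thesis by (simp add: fun_eq_iff)
qed

lemmas G_lin = bilinear_ladd[OF bilinear_G] bilinear_radd[OF bilinear_G] bilinear_lmul[OF bilinear_G]
  bilinear_rmul[OF bilinear_G] bilinear_lsub[OF bilinear_G] bilinear_rsub[OF bilinear_G]
  bilinear_lzero[OF bilinear_G] bilinear_rzero[OF bilinear_G]
  bilinear_lneg[OF bilinear_G] bilinear_rneg[OF bilinear_G]

lemmas D_lin = bilinear_ladd[OF bilinear_D] bilinear_radd[OF bilinear_D] bilinear_lmul[OF bilinear_D]
  bilinear_rmul[OF bilinear_D] linear_add[OF linear_D] linear_scale[OF linear_D]

lemma G_eqI: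
  assumes "y \<in> A" "\<And>w. G y v w = G y v' w"
  shows "v = v'"
proof -
  have "v - v' = 0" by (rule nondegenerate[OF assms(1)]) (simp add: G_lin assms)
  then show ?thesis by simp
qed

text \<open>In the alternating sum of the three derivatives, compatibility and symmetry cancel all
  terms but one. As the right-hand side no longer contains the connection, it gives uniqueness here
  and a definition in the existence proof.\<close>

lemma koszul:
  assumes "y \<in> A" "levi_civita G y \<Gamma>"
  shows "2 * G y (\<Gamma> u v) w = D y u v w + D y v u w - D y w u v"
proof -
  have s: "\<Gamma> a b = \<Gamma> b a" for a b using assms(2) by (simp add: levi_civita_def)
  have c: "D y a b c = G y (\<Gamma> a b) c + G y b (\<Gamma> a c)" for a b c
    using assms(2) by (simp add: levi_civita_def D_def)
  show ?thesis
    unfolding c s[of v u] s[of w u] s[of w v]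
    using sym_G[OF assms(1)] by (simp add: add.commute)
qed

lemma levi_civita_unique:
  assumes "y \<in> A" "levi_civita G y \<Gamma>" "levi_civita G y \<Gamma>'"
  shows "\<Gamma> = \<Gamma>'"
proof (intro ext G_eqI[OF assms(1)])
  fix u v w
  show "G y (\<Gamma> u v) w = G y (\<Gamma>' u v) w"
    using koszul[OF assms(1,2), of u v w] koszul[OF assms(1,3), of u v w] by linarith
qed

text \<open>The map sending \<open>v\<close> to the coefficient vector of its functional is
  injective by nondegeneracy, hence surjective in finite dimension.\<close>

lemma riesz_representation:
  assumes "y \<in> A" "linear f"
  shows "\<exists>v. \<forall>w. G y v w = f w"
proof -
  let ?L = "\<lambda>v. \<Sum>b\<in>Basis. G y v b *\<^sub>R b"
  have lin: "linear (\<lambda>w. G y v w)" for v using bilinear_G[OF assms(1)] by (auto simp: bilinear_def)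
  have L: "linear ?L"
    by (intro linearI) (simp_all add: G_lin assms scaleR_add_left sum.distrib scaleR_sum_right)
  have inner: "?L v \<bullet> b = G y v b" if "b \<in> Basis" for v b
    using that by (simp add: inner_sum_left inner_Basis if_distrib cong: if_cong)
  have "inj ?L"
    unfolding linear_injective_0[OF L]
  proof (intro allI impI)
    fix v assume v: "?L v = 0"
    have "G y v b = 0" if "b \<in> Basis" for b using inner[OF that, of v] v by simp
    then have "G y v w = 0" for w using linear_eq_sum_Basis[OF lin, of v w] by simp
    then show "v = 0" by (rule nondegenerate[OF assms(1)])
  qed
  then have "surj ?L" using linear_injective_imp_surjective[OF L] by blast
  then obtain v where "(\<Sum>b\<in>Basis. f b *\<^sub>R b) = ?L v" by (rule surjE)
  note v = this
  have "G y v b = f b" if "b \<in> Basis" for b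
    using inner[OF that, of v, folded v] that by (simp add: inner_sum_left inner_Basis if_distrib cong: if_cong)
  then have "G y v w = f w" for w
    using linear_eq_sum_Basis[OF lin, of v w] linear_eq_sum_Basis[OF assms(2), of w] by simp
  then show ?thesis by blast
qed

text \<open>The Koszul formula is read backwards: its right-hand side \<open>?k\<close> is linear in
  \<open>w\<close>, so it is represented by a vector, which is taken as the value of the
  connection.\<close>

lemma levi_civita_exists:
  assumes "y \<in> A"
  shows "\<exists>\<Gamma>. levi_civita G y \<Gamma>"
proof -
  let ?k = "\<lambda>u v w. (D y u v w + D y v u w - D y w u v) / 2"
  have "linear (?k u v)" for u v
    by (rule linearI) (simp_all add: D_lin assms field_simps)
  then have ex: "\<exists>x. \<forall>w. G y x w = ?k u v w" for u v by (rule riesz_representation[OF assms])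
  define \<Gamma> where "\<Gamma> u v = (SOME x. \<forall>w. G y x w = ?k u v w)" for u v
  have \<Gamma>: "G y (\<Gamma> u v) w = ?k u v w" for u v w
    using someI_ex[OF ex[of u v]] unfolding \<Gamma>_def by blast
  have "bilinear \<Gamma>"
    unfolding bilinear_def
    by (intro conjI allI linearI G_eqI[OF assms])
      (simp_all add: G_lin D_lin assms \<Gamma> add_divide_distrib diff_divide_distrib algebra_simps)
  moreover have "\<Gamma> u v = \<Gamma> v u" for u v
    by (rule G_eqI[OF assms]) (simp add: \<Gamma> sym_D[OF assms, of _ u v])
  moreover have "frechet_derivative (\<lambda>z. G z v w) (at y) u = G y (\<Gamma> u v) w + G y v (\<Gamma> u w)" for u v w
  proof -
    have "D y u v w = ?k u v w + ?k u w v"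
      by (simp add: sym_D[OF assms, of u w v] field_simps)
    then show ?thesis unfolding sym_G[OF assms, of v "\<Gamma> u w"] \<Gamma> D_def .
  qed
  ultimately show ?thesis unfolding levi_civita_def by blast
qed

lemma levi_civita_chr: "y \<in> A \<Longrightarrow> levi_civita G y (chr y)"
  unfolding chr_def using ex_ex1I[OF levi_civita_exists levi_civita_unique] by (rule theI')

lemma chr_eqI: "y \<in> A \<Longrightarrow> levi_civita G y \<Gamma> \<Longrightarrow> chr y = \<Gamma>"
  by (rule levi_civita_unique[OF _ levi_civita_chr])

lemma bilinear_chr: "y \<in> A \<Longrightarrow> bilinear (chr y)"
  using levi_civita_chr by (simp add: levi_civita_def)

lemma sym_chr: "y \<in> A \<Longrightarrow> chr y v w = chr y w v"
  using levi_civita_chr by (simp add: levi_civita_def)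

lemma metric_compatible: "y \<in> A \<Longrightarrow> D y u v w = G y (chr y u v) w + G y v (chr y u w)"
  using levi_civita_chr by (simp add: levi_civita_def D_def)

lemma G_lipschitz:
  assumes "cball z r \<subseteq> A" "r \<ge> 0"
  shows "\<exists>K\<ge>0. (\<forall>x\<in>cball z r. \<forall>v w. norm (G x v w) \<le> K * norm v * norm w) \<and>
    (\<forall>x\<in>cball z r. \<forall>y\<in>cball z r. \<forall>v w. norm (G x v w - G y v w) \<le> K * norm (x - y) * norm v * norm w)"
proof (rule bilinear_field_lipschitz[OF _ assms(2)])
  show "bilinear (G x)" if "x \<in> cball z r" for x
    using bilinear_G subsetD[OF assms(1) that] .
  show "\<exists>L\<ge>0. \<forall>x\<in>cball z r. \<forall>y\<in>cball z r. norm (G x a b - G y a b) \<le> L * norm (x - y)" for a b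
    by (rule Ck_on_1_lipschitz_cball[OF open_A Ck_1_G assms(1)])
qed

text \<open>The constant is a minimum over the compact product of the ball with the unit sphere. It
  bounds the inverse of the metric without forming an inverse matrix.\<close>

lemma uniformly_nondegenerate:
  assumes "cball z r \<subseteq> A"
  shows "\<exists>c>0. \<forall>x\<in>cball z r. \<forall>v. c * norm v \<le> (\<Sum>b\<in>Basis. \<bar>G x v b\<bar>)"
proof -
  let ?f = "\<lambda>p. \<Sum>b\<in>Basis. \<bar>\<Sum>a\<in>Basis. (snd p \<bullet> a) * G (fst p) a b\<bar>"
  have lin: "linear (\<lambda>v. G x v b)" if "x \<in> A" for x b
    using bilinear_G[OF that] by (auto simp: bilinear_def)
  have eq: "?f (x, v) = (\<Sum>b\<in>Basis. \<bar>G x v b\<bar>)" if "x \<in> cball z r" for x v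
  proof -
    have "x \<in> A" using that assms by blast
    then have "G x v b = (\<Sum>a\<in>Basis. (v \<bullet> a) * G x a b)" for b
      using linear_eq_sum_Basis[OF lin[where b = b], of x v] by simp
    then show ?thesis by (simp only: fst_conv snd_conv)
  qed
  let ?K = "cball z r \<times> sphere (0::'e) 1"
  have cG: "continuous_on A (\<lambda>x. G x a b)" for a b by (rule Ck_on_imp_continuous_on[OF C2_G])
  have "continuous_on ?K (\<lambda>p. G (fst p) a b)" for a b
    by (rule continuous_on_compose2[OF cG continuous_on_fst[OF continuous_on_id]]) (use assms in auto)
  then have cont: "continuous_on ?K ?f" by (intro continuous_intros)
  have comp: "compact ?K" by (intro compact_Times compact_cball compact_sphere)
  show ?thesis
  proof (cases "?K = {}")
    case True
    then have "cball z r = {}" by (metis Sigma_empty1 SigmaI ex_in_conv vector_choose_size sphere_eq_empty zero_le_one linorder_not_less)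
    then show ?thesis using zero_less_one by blast
  next
    case False
    obtain p where p: "p \<in> ?K" "\<And>q. q \<in> ?K \<Longrightarrow> ?f p \<le> ?f q"
      using continuous_attains_inf[OF comp False cont] by blast
    obtain x v where xv: "p = (x, v)" "x \<in> cball z r" "norm v = 1" using p(1) by (cases p) auto
    have "?f p > 0"
    proof (rule ccontr)
      assume "\<not> ?f p > 0"
      moreover have "(\<Sum>b\<in>Basis. \<bar>G x v b\<bar>) \<ge> 0" by (intro sum_nonneg) simp
      ultimately have "(\<Sum>b\<in>Basis. \<bar>G x v b\<bar>) = 0"
        using eq[OF xv(2), of v] unfolding xv(1) by linarith
      then have "\<forall>b\<in>Basis. G x v b = 0" by (subst (asm) sum_nonneg_eq_0_iff) auto
      moreover have xA: "x \<in> A" using xv assms by blast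
      moreover have "linear (\<lambda>w. G x v w)" using bilinear_G[OF xA] by (auto simp: bilinear_def)
      ultimately have "G x v w = 0" for w using linear_eq_sum_Basis[of "\<lambda>w. G x v w" w] by simp
      then have "v = 0" by (rule nondegenerate[OF xA])
      then show False using xv by simp
    qed
    moreover have "?f p * norm v \<le> (\<Sum>b\<in>Basis. \<bar>G x v b\<bar>)" if "x \<in> cball z r" for x v
    proof (cases "v = 0")
      case True
      then show ?thesis by (simp add: sum_nonneg)
    next
      case False
      let ?v = "(1 / norm v) *\<^sub>R v"
      have "?f p \<le> ?f (x, ?v)" using False that by (intro p(2)) simp
      also have "\<dots> = (\<Sum>b\<in>Basis. \<bar>G x ?v b\<bar>)" by (rule eq[OF that])
      also have "\<dots> = (\<Sum>b\<in>Basis. \<bar>G x v b\<bar>) / norm v"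
        using assms that by (subst G_lin) (auto simp: abs_mult sum_divide_distrib)
      finally show ?thesis using False by (simp add: field_simps)
    qed
    ultimately show ?thesis by blast
  qed
qed

text \<open>Everything is read off the equation \<open>G x (chr x u v) w = k x u v w\<close>.
  Subtracting it at two points expresses the difference of the Christoffel maps through differences
  of \<open>k\<close> and of \<open>G\<close>, and \<open>uniformly_nondegenerate\<close> divides by
  the metric.\<close>

lemma chr_lipschitz:
  assumes "cball z r \<subseteq> A" "r \<ge> 0"
  shows "\<exists>K\<ge>0. (\<forall>x\<in>cball z r. \<forall>v w. norm (chr x v w) \<le> K * norm v * norm w) \<and>
    (\<forall>x\<in>cball z r. \<forall>y\<in>cball z r. \<forall>v w. norm (chr x v w - chr y v w) \<le> K * norm (x - y) * norm v * norm w)"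
proof -
  have in_A: "x \<in> A" if "x \<in> cball z r" for x using that assms(1) by blast
  obtain c where c: "c > 0" "\<And>x v. x \<in> cball z r \<Longrightarrow> c * norm v \<le> (\<Sum>b\<in>Basis. \<bar>G x v b\<bar>)"
    using uniformly_nondegenerate[OF assms(1)] by blast
  obtain M where M: "M \<ge> 0"
    "\<And>x y v w. x \<in> cball z r \<Longrightarrow> y \<in> cball z r \<Longrightarrow> norm (G x v w - G y v w) \<le> M * norm (x - y) * norm v * norm w"
    using G_lipschitz[OF assms] by blast
  define k where "k x u v w = (D x u v w + D x v u w - D x w u v) / 2" for x u v w
  have Gchr: "G x (chr x u v) w = k x u v w" if "x \<in> cball z r" for x u v w
    using koszul[OF in_A[OF that] levi_civita_chr[OF in_A[OF that]], of u v w] by (simp add: k_def)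
  have "\<exists>K\<ge>0. (\<forall>x\<in>cball z r. \<forall>u v. norm (k x u v w) \<le> K * norm u * norm v) \<and>
    (\<forall>x\<in>cball z r. \<forall>y\<in>cball z r. \<forall>u v. norm (k x u v w - k y u v w) \<le> K * norm (x - y) * norm u * norm v)" for w
  proof (rule bilinear_field_lipschitz[OF _ assms(2)])
    show "bilinear (\<lambda>u v. k x u v w)" if "x \<in> cball z r" for x
      unfolding bilinear_def k_def
      by (intro conjI allI linearI) (simp_all add: D_lin in_A[OF that] field_simps)
    fix a b :: 'e
    have "Ck_on 1 A (\<lambda>x. k x a b w)"
      unfolding k_def divide_inverse
      by (intro Ck_on_mult Ck_on_add Ck_on_diff open_A Ck_1_D Ck_on_const)
    then show "\<exists>L\<ge>0. \<forall>x\<in>cball z r. \<forall>y\<in>cball z r. norm (k x a b w - k y a b w) \<le> L * norm (x - y)"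
      by (rule Ck_on_1_lipschitz_cball[OF open_A _ assms(1)])
  qed
  then obtain K where K: "\<And>w. K w \<ge> 0"
    "\<And>w x u v. x \<in> cball z r \<Longrightarrow> norm (k x u v w) \<le> K w * norm u * norm v"
    "\<And>w x y u v. x \<in> cball z r \<Longrightarrow> y \<in> cball z r \<Longrightarrow> norm (k x u v w - k y u v w) \<le> K w * norm (x - y) * norm u * norm v"
    by metis
  define S where "S = (\<Sum>b\<in>(Basis::'e set). K b)"
  have S: "S \<ge> 0" unfolding S_def by (intro sum_nonneg K(1))
  have bound: "norm (chr x u v) \<le> S / c * norm u * norm v" if x: "x \<in> cball z r" for x u v
  proof -
    have "c * norm (chr x u v) \<le> (\<Sum>b\<in>Basis. \<bar>G x (chr x u v) b\<bar>)" by (rule c(2)[OF x])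
    also have "\<dots> \<le> (\<Sum>b\<in>Basis. K b * norm u * norm v)"
      using K(2)[OF x] by (intro sum_mono) (simp add: Gchr[OF x])
    also have "\<dots> = S * norm u * norm v" by (simp add: S_def sum_distrib_right)
    finally show ?thesis using c(1) by (simp add: field_simps)
  qed
  define N where "N = (S + M * real DIM('e) * (S / c)) / c"
  have lip: "norm (chr x u v - chr y u v) \<le> N * norm (x - y) * norm u * norm v"
    if x: "x \<in> cball z r" and y: "y \<in> cball z r" for x y u v
  proof -
    have "c * norm (chr x u v - chr y u v) \<le> (\<Sum>b\<in>Basis. \<bar>G x (chr x u v - chr y u v) b\<bar>)" by (rule c(2)[OF x])
    also have "\<dots> \<le> (\<Sum>b\<in>Basis. K b * norm (x - y) * norm u * norm v + M * norm (x - y) * (S / c * norm u * norm v))"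
    proof (rule sum_mono)
      fix b :: 'e assume b: "b \<in> Basis"
      have "G x (chr x u v - chr y u v) b = (k x u v b - k y u v b) - (G x (chr y u v) b - G y (chr y u v) b)"
        by (simp add: G_lin in_A[OF x] Gchr[OF x] Gchr[OF y])
      also have "\<bar>\<dots>\<bar> \<le> norm (k x u v b - k y u v b) + norm (G x (chr y u v) b - G y (chr y u v) b)"
        unfolding real_norm_def by (rule abs_triangle_ineq4)
      also have "\<dots> \<le> K b * norm (x - y) * norm u * norm v + M * norm (x - y) * norm (chr y u v) * norm b"
        by (intro add_mono K(3) M(2) x y)
      also have "\<dots> \<le> K b * norm (x - y) * norm u * norm v + M * norm (x - y) * (S / c * norm u * norm v)"
        using b mult_left_mono[OF bound[OF y, of u v], of "M * norm (x - y)"] M(1) by simp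
      finally show "\<bar>G x (chr x u v - chr y u v) b\<bar> \<le> K b * norm (x - y) * norm u * norm v + M * norm (x - y) * (S / c * norm u * norm v)" .
    qed
    also have "\<dots> = c * (N * norm (x - y) * norm u * norm v)"
      using c(1) unfolding sum.distrib sum_distrib_right[symmetric] S_def[symmetric]
      by (simp add: N_def field_simps)
    finally show ?thesis using c(1) by simp
  qed
  have "S / c \<le> S / c + \<bar>N\<bar>" "N \<le> S / c + \<bar>N\<bar>" using S c(1) by (auto simp: add_increasing)
  then have "norm (chr x u v) \<le> (S / c + \<bar>N\<bar>) * norm u * norm v" if x: "x \<in> cball z r" for x u v
    by (intro order_trans[OF bound[OF x]] mult_right_mono) auto
  moreover have "norm (chr x u v - chr y u v) \<le> (S / c + \<bar>N\<bar>) * norm (x - y) * norm u * norm v"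
    if x: "x \<in> cball z r" and y: "y \<in> cball z r" for x y u v
    using \<open>N \<le> S / c + \<bar>N\<bar>\<close> by (intro order_trans[OF lip[OF x y]] mult_right_mono) auto
  moreover have "S / c + \<bar>N\<bar> \<ge> 0" using S c(1) by simp
  ultimately show ?thesis by blast
qed

text \<open>By compatibility the derivative of the metric along the curve contributes
  \<open>2 G (chr v v) v\<close>, which the two acceleration terms cancel. Hence a geodesic that
  starts null remains null.\<close>

lemma const_speed_derivative:
  assumes "c s \<in> A" "(c has_vector_derivative v s) (at s within I)"
    "(v has_vector_derivative - chr (c s) (v s) (v s)) (at s within I)"
  shows "((\<lambda>s. G (c s) (v s) (v s)) has_vector_derivative 0) (at s within I)"
proof -
  have "((\<lambda>s. (c s, v s, v s)) has_vector_derivative (v s, - chr (c s) (v s) (v s), - chr (c s) (v s) (v s))) (at s within I)"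
    using assms(2,3) by (intro has_vector_derivative_Pair)
  from has_vector_derivative_compose_field[where c = "\<lambda>s. (c s, v s, v s)",
      OF has_derivative_bilinear_field(2)[OF open_A assms(1) bilinear_G D_derivative[OF assms(1)]] this]
  show ?thesis
    by (simp add: metric_compatible[OF assms(1)] G_lin assms(1))
qed

end

section \<open>Second derivatives along curves and existence of geodesics\<close>

lemma Ck_on_2_has_derivative:
  assumes "Ck_on 2 A f" "x \<in> A"
  shows "(f has_derivative frechet_derivative f (at x)) (at x)"
    and "((\<lambda>y. frechet_derivative f (at y) w) has_derivative
          frechet_derivative (\<lambda>y. frechet_derivative f (at y) w) (at x)) (at x)"
    and "Ck_on 1 A (\<lambda>y. frechet_derivative f (at y) w)"
  using Ck_on_Suc_has_derivative[of 1 A f] Ck_on_Suc_has_derivative[of 0 A "\<lambda>y. frechet_derivative f (at y) w"]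
    assms by (simp_all add: numeral_2_eq_2)

lemma bilinear_second_derivative:
  fixes f :: "'a::euclidean_space \<Rightarrow> 'b::real_normed_vector"
  assumes "open A" "x \<in> A" "Ck_on 2 A f"
  shows "bilinear (\<lambda>u w. frechet_derivative (\<lambda>y. frechet_derivative f (at y) w) (at x) u)"
  unfolding bilinear_def
proof (intro conjI allI)
  show "linear (\<lambda>u. frechet_derivative (\<lambda>y. frechet_derivative f (at y) w) (at x) u)" for w
    using has_derivative_linear[OF Ck_on_2_has_derivative(2)[OF assms(3,2)]] .
  show "linear (\<lambda>w. frechet_derivative (\<lambda>y. frechet_derivative f (at y) w) (at x) u)" for u
    using has_derivative_linear_field(1)[OF assms(1,2),
        where F = "\<lambda>y w. frechet_derivative f (at y) w"
          and F' = "\<lambda>u w. frechet_derivative (\<lambda>y. frechet_derivative f (at y) w) (at x) u",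
        OF has_derivative_linear[OF Ck_on_2_has_derivative(1)[OF assms(3)]]
          Ck_on_2_has_derivative(2)[OF assms(3,2)]] .
qed

text \<open>If \<open>v\<close> is the velocity of \<open>c\<close> and \<open>v'\<close> is minus
  the Christoffel term, the right-hand side is the Hessian of \<open>f\<close> at the velocity. The
  vector \<open>v\<close> is kept independent of \<open>c\<close> because constant vectors are
  needed too.\<close>

lemma second_derivative_along_curve:
  fixes f :: "'a::euclidean_space \<Rightarrow> 'b::real_normed_vector"
  assumes "open A" "Ck_on 2 A f" "c s \<in> A"
    and "(c has_vector_derivative c') (at s within I)" "(v has_vector_derivative v') (at s within I)"
  shows "((\<lambda>s. frechet_derivative f (at (c s)) (v s)) has_vector_derivative
          (frechet_derivative (\<lambda>y. frechet_derivative f (at y) (v s)) (at (c s)) c'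
            + frechet_derivative f (at (c s)) v')) (at s within I)"
  using has_vector_derivative_linear_field[OF assms(1), where c = c and s = s and v = v
        and F = "\<lambda>y w. frechet_derivative f (at y) w"
        and F' = "\<lambda>u w. frechet_derivative (\<lambda>y. frechet_derivative f (at y) w) (at (c s)) u",
      OF assms(3) has_derivative_linear[OF Ck_on_2_has_derivative(1)[OF assms(2)]]
        Ck_on_2_has_derivative(2)[OF assms(2,3)] assms(4,5)] .

text \<open>The geodesic equation is a first-order system for position and velocity. On a ball
  around \<open>(x0, v0)\<close> the speed is at most \<open>N\<close>, so the right-hand side,
  although quadratic in the velocity, is Lipschitz there.\<close>

lemma (in pseudo_riemannian) geodesic_exists:
  assumes "x0 \<in> A"
  shows "\<exists>e>0. \<exists>c v. c 0 = x0 \<and> v 0 = v0 \<and> (\<forall>s\<in>{0..e}. c s \<in> A \<and>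
    (c has_vector_derivative v s) (at s within {0..e}) \<and>
    (v has_vector_derivative - chr (c s) (v s) (v s)) (at s within {0..e}))"
proof -
  obtain R where R: "R > 0" "cball x0 R \<subseteq> A" using open_A assms open_contains_cball by blast
  obtain K where K: "K \<ge> 0"
    "\<And>x v w. x \<in> cball x0 R \<Longrightarrow> norm (chr x v w) \<le> K * norm v * norm w"
    "\<And>x y v w. x \<in> cball x0 R \<Longrightarrow> y \<in> cball x0 R \<Longrightarrow>
      norm (chr x v w - chr y v w) \<le> K * norm (x - y) * norm v * norm w"
    using chr_lipschitz[OF R(2)] R(1) by (meson less_imp_le)
  define F where "F p = (snd p, - chr (fst p) (snd p) (snd p))" for p :: "'e \<times> 'e"
  define N where "N = norm v0 + R"
  have N: "N \<ge> 0" using R(1) by (simp add: N_def)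
  have "norm (F p - F q) \<le> (1 + K * N * N + 2 * K * N) * norm (p - q)"
    if pq: "p \<in> cball (x0, v0) R" "q \<in> cball (x0, v0) R" for p q
  proof -
    have in_ball: "fst p \<in> cball x0 R" "norm (snd p) \<le> N" if "p \<in> cball (x0, v0) R" for p
    proof -
      have d: "norm (p - (x0, v0)) \<le> R" using that by (simp add: dist_norm norm_minus_commute)
      have "norm (fst p - x0) \<le> norm (p - (x0, v0))"
        using norm_fst_le[of "fst p - x0" "snd p - v0"] by (metis fst_conv snd_conv minus_prod_def prod.collapse)
      with d show "fst p \<in> cball x0 R" by (simp add: dist_norm norm_minus_commute)
      have "norm (snd p - v0) \<le> norm (p - (x0, v0))"
        using norm_snd_le[of "snd p - v0" "fst p - x0"] by (metis fst_conv snd_conv minus_prod_def prod.collapse)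
      with d show "norm (snd p) \<le> N" using norm_triangle_sub[of "snd p" v0] by (simp add: N_def)
    qed
    obtain x v y w where p: "p = (x, v)" and q: "q = (y, w)" by (cases p, cases q)
    have x: "x \<in> cball x0 R" "norm v \<le> N" and y: "y \<in> cball x0 R" "norm w \<le> N"
      using in_ball[OF pq(1)] in_ball[OF pq(2)] by (simp_all add: p q)
    have xy: "norm (x - y) \<le> norm (p - q)" and vw: "norm (v - w) \<le> norm (p - q)"
      using norm_fst_le[of "x - y" "v - w"] norm_snd_le[of "v - w" "x - y"] by (simp_all add: p q)
    note bil = bilinear_chr[OF subsetD[OF R(2) y(1)]]
    \<comment> \<open>First the base point is changed, then each vector argument in turn; these
      steps give the summands \<open>K N^2\<close> and \<open>2 K N\<close> of the Lipschitz
      constant.\<close>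
    have eq: "chr x v v - chr y w w = (chr x v v - chr y v v) + (chr y (v - w) v + chr y w (v - w))"
      by (simp add: bilinear_lsub[OF bil] bilinear_rsub[OF bil])
    have a: "norm (chr x v v - chr y v v) \<le> K * N * N * norm (p - q)"
    proof -
      have "norm (chr x v v - chr y v v) \<le> K * norm (x - y) * norm v * norm v" by (rule K(3)[OF x(1) y(1)])
      also have "\<dots> \<le> K * norm (p - q) * N * N"
        by (intro mult_mono xy x(2)) (simp_all add: K(1) N)
      finally show ?thesis by (simp add: mult_ac)
    qed
    have b: "norm (chr y (v - w) v) \<le> K * N * norm (p - q)"
    proof -
      have "norm (chr y (v - w) v) \<le> K * norm (v - w) * norm v" by (rule K(2)[OF y(1)])
      also have "\<dots> \<le> K * norm (p - q) * N"
        by (intro mult_mono vw x(2)) (simp_all add: K(1) N)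
      finally show ?thesis by (simp add: mult_ac)
    qed
    have c: "norm (chr y w (v - w)) \<le> K * N * norm (p - q)"
    proof -
      have "norm (chr y w (v - w)) \<le> K * norm w * norm (v - w)" by (rule K(2)[OF y(1)])
      also have "\<dots> \<le> K * N * norm (p - q)"
        by (intro mult_mono vw y(2)) (simp_all add: K(1) N)
      finally show ?thesis .
    qed
    have "F p - F q = (v - w, - (chr x v v - chr y w w))" by (simp add: F_def p q)
    then have "norm (F p - F q) \<le> norm (v - w) + norm (chr x v v - chr y w w)"
      using norm_Pair_le[of "v - w" "- (chr x v v - chr y w w)"] unfolding norm_minus_cancel by simp
    also have "\<dots> \<le> norm (p - q) + (K * N * N * norm (p - q) + (K * N * norm (p - q) + K * N * norm (p - q)))"
      unfolding eq by (intro add_mono vw order_trans[OF norm_triangle_ineq] a b c)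
    also have "\<dots> = (1 + K * N * N + 2 * K * N) * norm (p - q)" by (simp add: algebra_simps)
    finally show ?thesis .
  qed
  from picard_local_existence[OF R(1) this]
  obtain e z where e: "e > 0" "z 0 = (x0, v0)"
    "\<And>s. s \<in> {0..e} \<Longrightarrow> z s \<in> cball (x0, v0) R"
    "\<And>s. s \<in> {0..e} \<Longrightarrow> (z has_vector_derivative F (z s)) (at s within {0..e})"
    by blast
  have "fst (z s) \<in> A \<and> ((\<lambda>s. fst (z s)) has_vector_derivative snd (z s)) (at s within {0..e}) \<and>
    ((\<lambda>s. snd (z s)) has_vector_derivative - chr (fst (z s)) (snd (z s)) (snd (z s))) (at s within {0..e})"
    if s: "s \<in> {0..e}" for s
  proof (intro conjI)
    have "dist x0 (fst (z s)) \<le> dist (x0, v0) (z s)" using dist_fst_le[of "(x0, v0)" "z s"] by simp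
    then show "fst (z s) \<in> A" using e(3)[OF s] R(2) by auto
    show "((\<lambda>s. fst (z s)) has_vector_derivative snd (z s)) (at s within {0..e})"
      using bounded_linear.has_vector_derivative[OF bounded_linear_fst e(4)[OF s]] by (simp add: F_def)
    show "((\<lambda>s. snd (z s)) has_vector_derivative - chr (fst (z s)) (snd (z s)) (snd (z s))) (at s within {0..e})"
      using bounded_linear.has_vector_derivative[OF bounded_linear_snd e(4)[OF s]] by (simp add: F_def)
  qed
  then show ?thesis using e(1,2)
    by (intro exI[of _ e] conjI exI[of _ "\<lambda>s. fst (z s)"] exI[of _ "\<lambda>s. snd (z s)"]) auto
qed

text \<open>
  The right-hand side is symmetric because second derivatives commute, and it is compatible with
  the metric; hence it is the Christoffel map of the target by uniqueness.
\<close>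
lemma chr_transform:
  fixes \<tau> :: "'e::euclidean_space \<Rightarrow> 'e"
  assumes "pseudo_riemannian A G" "pseudo_riemannian B G'"
    and \<tau>: "Ck_on 2 A \<tau>" "\<tau> ` A \<subseteq> B"
    and iso: "\<And>y v w. y \<in> A \<Longrightarrow>
      G y v w = G' (\<tau> y) (frechet_derivative \<tau> (at y) v) (frechet_derivative \<tau> (at y) w)"
    and x: "x \<in> A"
  shows "pseudo_riemannian.chr G' (\<tau> x) (frechet_derivative \<tau> (at x) v) (frechet_derivative \<tau> (at x) w) =
    frechet_derivative \<tau> (at x) (pseudo_riemannian.chr G x v w)
    - frechet_derivative (\<lambda>y. frechet_derivative \<tau> (at y) w) (at x) v"
proof -
  interpret G: pseudo_riemannian A G by fact
  interpret G': pseudo_riemannian B G' by fact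
  let ?T = "frechet_derivative \<tau> (at x)"
  define D2 where "D2 u w = frechet_derivative (\<lambda>y. frechet_derivative \<tau> (at y) w) (at x) u" for u w
  have \<tau>x: "\<tau> x \<in> B" using \<tau>(2) x by blast
  note d\<tau> = Ck_on_2_has_derivative(1)[OF \<tau>(1)]
  have T: "linear ?T" by (rule has_derivative_linear[OF d\<tau>[OF x]])
  have D2: "bilinear D2"
    unfolding D2_def by (rule bilinear_second_derivative[OF G.open_A x \<tau>(1)])
  have D2_sym: "D2 u w = D2 w u" for u w
    unfolding D2_def by (rule second_derivative_symmetric[OF G.open_A x \<tau>(1)])
  \<comment> \<open>The derivative of \<open>\<tau>\<close> is injective because it pulls the second
    metric back to a nondegenerate one.\<close>
  have "inj ?T"
    unfolding linear_injective_0[OF T]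
  proof (intro allI impI)
    fix v assume "?T v = 0"
    then have "G x v w = 0" for w by (simp add: iso[OF x] G'.G_lin \<tau>x)
    then show "v = 0" by (rule G.nondegenerate[OF x])
  qed
  then have bij: "bij ?T" using linear_injective_imp_surjective[OF T] by (simp add: bij_def)
  define S where "S = inv ?T"
  have TS: "?T (S a) = a" for a unfolding S_def by (rule surj_f_inv_f[OF bij_is_surj[OF bij]])
  have ST: "S (?T a) = a" for a unfolding S_def by (rule inv_f_f[OF bij_is_inj[OF bij]])
  have S: "linear S"
  proof (rule linearI)
    show "S (a + b) = S a + S b" for a b
      using ST[of "S a + S b"] by (simp add: linear_add[OF T] TS)
    show "S (r *\<^sub>R a) = r *\<^sub>R S a" for r a
      using ST[of "r *\<^sub>R S a"] by (simp add: linear_scale[OF T] TS)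
  qed
  \<comment> \<open>The claimed transformation law, solved for the target connection. By uniqueness
    it remains to check the defining properties of the connection.\<close>
  define \<Gamma>' where "\<Gamma>' a b = ?T (G.chr x (S a) (S b)) - D2 (S a) (S b)" for a b
  note c_lin = bilinear_ladd[OF G.bilinear_chr] bilinear_radd[OF G.bilinear_chr]
    bilinear_lmul[OF G.bilinear_chr] bilinear_rmul[OF G.bilinear_chr]
  have "levi_civita G' (\<tau> x) \<Gamma>'"
    unfolding levi_civita_def
  proof (intro conjI allI)
    show "bilinear \<Gamma>'"
      unfolding bilinear_def \<Gamma>'_def
      by (intro conjI allI linearI)
        (simp_all add: linear_add[OF S] linear_scale[OF S] linear_add[OF T] linear_scale[OF T] c_lin x
          bilinear_ladd[OF D2] bilinear_radd[OF D2] bilinear_lmul[OF D2] bilinear_rmul[OF D2] scaleR_diff_right)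
    show "\<Gamma>' a b = \<Gamma>' b a" for a b
      by (simp add: \<Gamma>'_def G.sym_chr[OF x, of "S a" "S b"] D2_sym[of "S a" "S b"])
    fix a b c
    define u v w where uvw: "u = S a" "v = S b" "w = S c"
    have "((\<lambda>y. (\<tau> y, frechet_derivative \<tau> (at y) v, frechet_derivative \<tau> (at y) w)) has_derivative
        (\<lambda>h. (?T h, D2 h v, D2 h w))) (at x)"
      unfolding D2_def
      by (intro has_derivative_Pair d\<tau>[OF x] Ck_on_2_has_derivative(2)[OF \<tau>(1) x])
    from has_derivative_compose[OF this
        has_derivative_bilinear_field(2)[OF G'.open_A \<tau>x G'.bilinear_G G'.D_derivative[OF \<tau>x]]]
    have "((\<lambda>y. G' (\<tau> y) (frechet_derivative \<tau> (at y) v) (frechet_derivative \<tau> (at y) w)) has_derivative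
       (\<lambda>h. G'.D (\<tau> x) (?T h) (?T v) (?T w) + G' (\<tau> x) (D2 h v) (?T w) + G' (\<tau> x) (?T v) (D2 h w))) (at x)"
      by simp
    then have "((\<lambda>y. G y v w) has_derivative
       (\<lambda>h. G'.D (\<tau> x) (?T h) (?T v) (?T w) + G' (\<tau> x) (D2 h v) (?T w) + G' (\<tau> x) (?T v) (D2 h w))) (at x)"
      by (rule has_derivative_transform_within_open[OF _ G.open_A x]) (rule iso[symmetric])
    \<comment> \<open>Comparing the two derivatives of the same function expresses the derivative of
      the target metric through the source connection and \<open>D2\<close>, which is the
      compatibility of \<open>\<Gamma>'\<close>.\<close>
    from fun_cong[OF has_derivative_unique[OF G.D_derivative[OF x] this], of u]
    have "G'.D (\<tau> x) (?T u) (?T v) (?T w) =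
      G.D x u v w - G' (\<tau> x) (D2 u v) (?T w) - G' (\<tau> x) (?T v) (D2 u w)" by simp
    also have "G.D x u v w = G x (G.chr x u v) w + G x v (G.chr x u w)"
      by (rule G.metric_compatible[OF x])
    finally have "G'.D (\<tau> x) (?T u) (?T v) (?T w) =
      G' (\<tau> x) (?T (G.chr x u v) - D2 u v) (?T w) + G' (\<tau> x) (?T v) (?T (G.chr x u w) - D2 u w)"
      by (simp add: iso[OF x] G'.G_lin \<tau>x)
    then have "G'.D (\<tau> x) a b c = G' (\<tau> x) (\<Gamma>' a b) c + G' (\<tau> x) b (\<Gamma>' a c)"
      by (simp add: uvw TS \<Gamma>'_def)
    then show "frechet_derivative (\<lambda>z. G' z b c) (at (\<tau> x)) a = G' (\<tau> x) (\<Gamma>' a b) c + G' (\<tau> x) b (\<Gamma>' a c)"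
      by (simp add: G'.D_def)
  qed
  then have "G'.chr (\<tau> x) = \<Gamma>'" by (rule G'.chr_eqI[OF \<tau>x])
  then show ?thesis by (simp add: \<Gamma>'_def ST D2_def)
qed

section \<open>Changes of chart\<close>

lemma smooth_manifold_chart:
  assumes "smooth_manifold N" "i \<in> idx N"
  shows "open (chart_dom N i)" "open (chart_map N i ` chart_dom N i)"
    "homeomorphism (chart_dom N i) (chart_map N i ` chart_dom N i) (chart_map N i) (param N i)"
proof -
  have "Ck_chart 0 N (chart_dom N i) (chart_map N i)"
    using assms unfolding smooth_manifold_def by blast
  then show "open (chart_dom N i)" "open (chart_map N i ` chart_dom N i)"
    "homeomorphism (chart_dom N i) (chart_map N i ` chart_dom N i) (chart_map N i) (param N i)"
    unfolding Ck_chart_def param_def by blast+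
qed

lemma param_chart_map [simp]:
  "smooth_manifold N \<Longrightarrow> i \<in> idx N \<Longrightarrow> p \<in> chart_dom N i \<Longrightarrow> param N i (chart_map N i p) = p"
  using homeomorphism_apply1[OF smooth_manifold_chart(3)] .

lemma chart_map_param [simp]:
  "smooth_manifold N \<Longrightarrow> i \<in> idx N \<Longrightarrow> y \<in> chart_map N i ` chart_dom N i \<Longrightarrow>
    chart_map N i (param N i y) = y"
  using homeomorphism_apply2[OF smooth_manifold_chart(3)] .

lemma param_in_chart_dom:
  "smooth_manifold N \<Longrightarrow> i \<in> idx N \<Longrightarrow> y \<in> chart_map N i ` chart_dom N i \<Longrightarrow>
    param N i y \<in> chart_dom N i"
  by auto

lemma param_in_Int:
  "smooth_manifold N \<Longrightarrow> i \<in> idx N \<Longrightarrow> y \<in> chart_map N i ` (U \<inter> chart_dom N i) \<Longrightarrow>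
    param N i y \<in> U \<inter> chart_dom N i"
  by auto

lemma open_chart_image:
  assumes "smooth_manifold N" "i \<in> idx N" "open U"
  shows "open (chart_map N i ` (U \<inter> chart_dom N i))"
proof -
  note c = smooth_manifold_chart[OF assms(1,2)]
  have "openin (top_of_set (chart_dom N i)) (U \<inter> chart_dom N i)"
    using assms(3) by (auto simp: openin_open)
  from homeomorphism_imp_open_map[OF c(3) this]
  show ?thesis using c(2) by (meson openin_open_trans)
qed

lemma Ck_on_transition:
  assumes "smooth_manifold N" "i \<in> idx N" "j \<in> idx N"
  shows "Ck_on k (chart_map N i ` (chart_dom N i \<inter> chart_dom N j)) (chart_map N j \<circ> param N i)"
proof -
  have "Ck_chart k N (chart_dom N i) (chart_map N i)"
    using assms unfolding smooth_manifold_def by blast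
  then show ?thesis using assms(3) unfolding Ck_chart_def param_def by blast
qed

section \<open>The product with the real line and its metric\<close>

lemma product_line_simps [simp]:
  "idx (product_line M) = idx M"
  "chart_dom (product_line M) i = chart_dom M i \<times> UNIV"
  "chart_map (product_line M) i p = (chart_map M i (fst p), snd p)"
  by (simp_all add: product_line_def)

lemma image_chart_product_line:
  "chart_map (product_line M) i ` (U \<times> V) = (chart_map M i ` U) \<times> V"
proof (intro subset_antisym subsetI)
  fix q assume "q \<in> (chart_map M i ` U) \<times> V"
  then obtain x t where "x \<in> U" "t \<in> V" "q = chart_map (product_line M) i (x, t)" by auto
  then show "q \<in> chart_map (product_line M) i ` (U \<times> V)" by blast
qed auto

lemma param_product_line:
  assumes "smooth_manifold M" "i \<in> idx M" "y \<in> chart_map M i ` chart_dom M i"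
  shows "param (product_line M) i (y, t) = (param M i y, t)"
proof -
  have "inj_on (chart_map M i) (chart_dom M i)"
    by (rule inj_on_inverseI[of _ "param M i"]) (simp add: assms)
  then have "inj_on (chart_map (product_line M) i) (chart_dom M i \<times> UNIV)"
    by (auto simp: inj_on_def)
  then have "inv_into (chart_dom M i \<times> UNIV) (chart_map (product_line M) i)
      (chart_map (product_line M) i (param M i y, t)) = (param M i y, t)"
    by (rule inv_into_f_f) (use param_in_chart_dom[OF assms] in simp)
  moreover have "chart_map (product_line M) i (param M i y, t) = (y, t)" by (simp add: assms)
  ultimately show ?thesis unfolding param_def[of "product_line M"] product_line_simps(2) by (simp only:)
qed

lemma smooth_manifold_product_line:
  fixes M :: "('i, 'a::{t2_space,second_countable_topology}, 'e::euclidean_space) atlas"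
  assumes M: "smooth_manifold M"
  shows "smooth_manifold (product_line M)"
proof -
  let ?N = "product_line M"
  have cover: "(\<Union>i\<in>idx M. chart_dom M i \<times> UNIV) = UNIV"
  proof -
    have "(\<Union>i\<in>idx M. chart_dom M i) = UNIV" using M by (simp only: smooth_manifold_def)
    then show ?thesis by (auto simp: set_eq_iff)
  qed
  have "Ck_chart k ?N (chart_dom ?N i) (chart_map ?N i)" if i: "i \<in> idx M" for i k
    unfolding Ck_chart_def
  proof (intro conjI ballI)
    note c = smooth_manifold_chart[OF M i]
    show "open (chart_dom ?N i)" using c(1) by (simp add: open_Times)
    show "open (chart_map ?N i ` chart_dom ?N i)"
      unfolding product_line_simps(2) image_chart_product_line by (intro open_Times c(2) open_UNIV)
    have cont: "continuous_on (chart_dom M i \<times> (UNIV::real set)) (\<lambda>p. (chart_map M i (fst p), snd p))"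
      by (intro continuous_intros continuous_on_compose2[OF homeomorphism_cont1[OF c(3)]]) auto
    have cont': "continuous_on (chart_map M i ` chart_dom M i \<times> (UNIV::real set)) (\<lambda>p. (param M i (fst p), snd p))"
      by (intro continuous_intros continuous_on_compose2[OF homeomorphism_cont2[OF c(3)]]) auto
    show "homeomorphism (chart_dom ?N i) (chart_map ?N i ` chart_dom ?N i) (chart_map ?N i)
      (inv_into (chart_dom ?N i) (chart_map ?N i))"
      unfolding param_def[symmetric, of ?N]
    proof (rule homeomorphismI)
      show "continuous_on (chart_dom ?N i) (chart_map ?N i)"
        using cont by (simp add: product_line_def)
      show "continuous_on (chart_map ?N i ` chart_dom ?N i) (param ?N i)"
        using cont' unfolding product_line_simps(2) image_chart_product_line
        by (rule continuous_on_cong[THEN iffD1, rotated 2])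
          (auto simp: param_product_line[OF M i])
    qed (auto simp: param_product_line[OF M i] param_chart_map[OF M i])
    fix j assume "j \<in> idx ?N"
    then have j: "j \<in> idx M" by simp
    have *: "Ck_on k (chart_map M i ` (chart_dom M i \<inter> chart_dom M j) \<times> (UNIV::real set))
      (chart_map ?N j \<circ> param ?N i)" if i: "i \<in> idx M" and j: "j \<in> idx M" for i j
    proof -
      let ?O = "chart_map M i ` (chart_dom M i \<inter> chart_dom M j)"
      have O: "open ?O"
        using open_chart_image[OF M i smooth_manifold_chart(1)[OF M j]] by (simp add: Int_commute)
      then have O': "open (?O \<times> (UNIV::real set))" by (simp add: open_Times)
      have "Ck_on k (?O \<times> (UNIV::real set)) (\<lambda>p. ((chart_map M j \<circ> param M i) (fst p), snd p))"
        by (intro Ck_on_Pair O' Ck_on_compose[OF O' O _ Ck_on_transition[OF M i j]]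
            Ck_on_bounded_linear bounded_linear_fst bounded_linear_snd) auto
      then show ?thesis
        by (rule Ck_on_cong[OF O', THEN iffD1, rotated]) (auto simp: param_product_line[OF M i])
    qed
    have sw: "chart_dom M i \<times> UNIV \<inter> chart_dom M j \<times> UNIV = (chart_dom M i \<inter> chart_dom M j) \<times> UNIV" by auto
    show "Ck_on k (chart_map ?N j ` (chart_dom ?N i \<inter> chart_dom ?N j)) (chart_map ?N i \<circ> param ?N j)"
      using *[OF j i] unfolding product_line_simps(2) sw image_chart_product_line by (simp add: Int_commute)
    show "Ck_on k (chart_map ?N i ` (chart_dom ?N i \<inter> chart_dom ?N j))
        (chart_map ?N j \<circ> inv_into (chart_dom ?N i) (chart_map ?N i))"
      unfolding param_def[symmetric, of ?N]
      using *[OF i j] unfolding product_line_simps(2) sw image_chart_product_line .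
  qed
  then show ?thesis unfolding smooth_manifold_def using cover by simp
qed

text \<open>The setting of the general facts on geodesics and Hessians. The signs of the metric on
  space and time directions enter separately, for the stationary metric.\<close>

definition semi_riemannian_metric :: "('i, 'b, 'f::euclidean_space) atlas \<Rightarrow> ('i, 'b, 'f) bilinear_field \<Rightarrow> bool" where
  "semi_riemannian_metric N g \<longleftrightarrow>
     (\<forall>i\<in>idx N. pseudo_riemannian (chart_map N i ` chart_dom N i) (\<lambda>y. g i (param N i y))) \<and>
     (\<forall>i\<in>idx N. \<forall>j\<in>idx N. \<forall>p\<in>chart_dom N i \<inter> chart_dom N j. \<forall>v w.
        g i p v w = g j p (transition N i j p v) (transition N i j p w))"

lemma transition_product_line:
  assumes M: "smooth_manifold M" "i \<in> idx M" "j \<in> idx M" and p: "fst p \<in> chart_dom M i \<inter> chart_dom M j"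
  shows "transition (product_line M) i j p v = (transition M i j (fst p) (fst v), snd v)"
proof -
  let ?O = "chart_map M i ` (chart_dom M i \<inter> chart_dom M j)"
  let ?x = "chart_map M i (fst p)"
  have O: "open ?O"
    using open_chart_image[OF M(1,2) smooth_manifold_chart(1)[OF M(1,3)]] by (simp add: Int_commute)
  have x: "?x \<in> ?O" using p by blast
  have \<tau>: "((chart_map M j \<circ> param M i) has_derivative transition M i j (fst p)) (at ?x)"
    unfolding transition_def
    by (rule Ck_on_Suc_has_derivative[OF Ck_on_transition[OF M] x])
  have "((\<lambda>q. ((chart_map M j \<circ> param M i) (fst q), snd q)) has_derivative
      (\<lambda>v. (transition M i j (fst p) (fst v), snd v))) (at (?x, snd p))"
    by (intro has_derivative_Pair has_derivative_snd has_derivative_ident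
        has_derivative_compose[OF has_derivative_fst[OF has_derivative_ident]]) (simp only: fst_conv \<tau>)
  then have "((chart_map (product_line M) j \<circ> param (product_line M) i) has_derivative
      (\<lambda>v. (transition M i j (fst p) (fst v), snd v))) (at (?x, snd p))"
    by (rule has_derivative_transform_within_open[OF _ open_Times[OF O open_UNIV]])
      (use x in \<open>auto simp: param_product_line[OF M(1,2)]\<close>)
  from frechet_derivative_at[OF this] show ?thesis
    unfolding transition_def product_line_simps by (metis (no_types))
qed

lemma semi_riemannian_stationary_metric:
  fixes M :: "('i, 'a::{t2_space,second_countable_topology}, 'e::euclidean_space) atlas"
  assumes "standard_stationary M g\<^sub>0 \<omega>\<^sub>0 \<beta>"
  shows "semi_riemannian_metric (product_line M) (stationary_metric g\<^sub>0 \<omega>\<^sub>0 \<beta>)"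
  unfolding semi_riemannian_metric_def
proof (intro conjI ballI allI)
  have M: "smooth_manifold M" and g: "riemannian_metric M g\<^sub>0" and \<omega>: "smooth_one_form M \<omega>\<^sub>0"
    and \<beta>: "\<And>k. Ck_function k M UNIV \<beta>" "\<And>x. 0 < \<beta> x"
    using assms by (auto simp: standard_stationary_def)
  let ?g = "stationary_metric g\<^sub>0 \<omega>\<^sub>0 \<beta>"
  fix i assume "i \<in> idx (product_line M)"
  then have i: "i \<in> idx M" by simp
  let ?O = "chart_map M i ` chart_dom M i"
  let ?A = "?O \<times> (UNIV::real set)"
  have O: "open ?O" by (rule smooth_manifold_chart(2)[OF M i])
  then have A: "open ?A" by (simp add: open_Times)
  have G: "?g i (param (product_line M) i y) v w =
      g\<^sub>0 i (param M i (fst y)) (fst v) (fst w) + \<omega>\<^sub>0 i (param M i (fst y)) (fst v) * snd w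
        + \<omega>\<^sub>0 i (param M i (fst y)) (fst w) * snd v - \<beta> (param M i (fst y)) * snd v * snd w"
    if "y \<in> ?A" for y v w
    using that by (cases y) (auto simp: stationary_metric_def param_product_line[OF M i])
  have g0: "bilinear (g\<^sub>0 i (param M i (fst y)))"
      "g\<^sub>0 i (param M i (fst y)) v w = g\<^sub>0 i (param M i (fst y)) w v"
      "v \<noteq> 0 \<Longrightarrow> 0 < g\<^sub>0 i (param M i (fst y)) v v"
      "linear (\<omega>\<^sub>0 i (param M i (fst y)))" if "y \<in> ?A" for y v w
  proof -
    have "param M i (fst y) \<in> chart_dom M i"
      by (rule param_in_chart_dom[OF M i]) (use that in auto)
    then show "bilinear (g\<^sub>0 i (param M i (fst y)))"
      "g\<^sub>0 i (param M i (fst y)) v w = g\<^sub>0 i (param M i (fst y)) w v"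
      "v \<noteq> 0 \<Longrightarrow> 0 < g\<^sub>0 i (param M i (fst y)) v v"
      "linear (\<omega>\<^sub>0 i (param M i (fst y)))"
      using g[unfolded riemannian_metric_def, THEN conjunct1] \<omega>[unfolded smooth_one_form_def, THEN conjunct1] i
      by blast+
  qed
  have "pseudo_riemannian ?A (\<lambda>y. ?g i (param (product_line M) i y))"
  proof
    show "open ?A" by fact
    fix y :: "'e \<times> real" assume y: "y \<in> ?A"
    show "bilinear (?g i (param (product_line M) i y))"
      unfolding bilinear_def G[OF y]
      by (intro conjI allI linearI)
        (simp_all add: bilinear_ladd[OF g0(1)[OF y]] bilinear_radd[OF g0(1)[OF y]]
          bilinear_lmul[OF g0(1)[OF y]] bilinear_rmul[OF g0(1)[OF y]]
          linear_add[OF g0(4)[OF y]] linear_scale[OF g0(4)[OF y]] algebra_simps)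
    show "?g i (param (product_line M) i y) v w = ?g i (param (product_line M) i y) w v" for v w
      unfolding G[OF y] using g0(2)[OF y, of "fst v" "fst w"] by simp
    fix v :: "'e \<times> real"
    assume "\<And>w. ?g i (param (product_line M) i y) v w = 0"
    \<comment> \<open>Testing against the time-reflected vector cancels the mixed terms with
      \<open>\<omega>\<^sub>0\<close> and leaves a sum of two nonnegative terms.\<close>
    from this[of "(fst v, - snd v)"]
    have "g\<^sub>0 i (param M i (fst y)) (fst v) (fst v) + \<beta> (param M i (fst y)) * (snd v * snd v) = 0"
      unfolding G[OF y] by simp
    moreover have "\<beta> (param M i (fst y)) * (snd v * snd v) \<ge> 0"
      using \<beta>(2)[of "param M i (fst y)"] by simp
    moreover have "g\<^sub>0 i (param M i (fst y)) (fst v) (fst v) \<ge> 0"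
      using g0(3)[OF y, of "fst v"] bilinear_lzero[OF g0(1)[OF y]] by (cases "fst v = 0") auto
    ultimately have "g\<^sub>0 i (param M i (fst y)) (fst v) (fst v) = 0" "\<beta> (param M i (fst y)) * (snd v * snd v) = 0"
      by linarith+
    then show "v = 0"
      using g0(3)[OF y, of "fst v"] \<beta>(2)[of "param M i (fst y)"] by (cases v) (auto simp: zero_prod_def)
  next
    fix v w :: "'e \<times> real"
    have f: "Ck_on 2 ?A (\<lambda>y. f (fst y))" if "Ck_on 2 ?O f" for f :: "'e \<Rightarrow> real"
      by (rule Ck_on_compose[OF A O Ck_on_bounded_linear[OF bounded_linear_fst A] that]) auto
    have c: "Ck_on 2 ?O (\<lambda>y. g\<^sub>0 i (param M i y) v w)" for v w
      using g[unfolded riemannian_metric_def smooth_on_def, THEN conjunct2, THEN conjunct2] i by blast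
    have c': "Ck_on 2 ?O (\<lambda>y. \<omega>\<^sub>0 i (param M i y) v)" for v
      using \<omega>[unfolded smooth_one_form_def smooth_on_def, THEN conjunct2, THEN conjunct2] i by blast
    have c'': "Ck_on 2 ?O (\<lambda>y. \<beta> (param M i y))"
      using \<beta>(1)[of 2] i unfolding Ck_function_def o_def by simp
    have "Ck_on 2 ?A (\<lambda>y. g\<^sub>0 i (param M i (fst y)) (fst v) (fst w) + \<omega>\<^sub>0 i (param M i (fst y)) (fst v) * snd w
        + \<omega>\<^sub>0 i (param M i (fst y)) (fst w) * snd v - \<beta> (param M i (fst y)) * snd v * snd w)"
      by (intro Ck_on_add Ck_on_diff Ck_on_mult A f c c' c'' Ck_on_const)
    then show "Ck_on 2 ?A (\<lambda>y. ?g i (param (product_line M) i y) v w)"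
      by (rule Ck_on_cong[OF A, THEN iffD1, rotated]) (rule G[symmetric])
  qed
  then show "pseudo_riemannian (chart_map (product_line M) i ` chart_dom (product_line M) i)
      (\<lambda>y. ?g i (param (product_line M) i y))"
    by (simp only: product_line_simps(2) image_chart_product_line)
  fix j and p :: "'a \<times> real" and v w :: "'e \<times> real"
  assume "j \<in> idx (product_line M)" "p \<in> chart_dom (product_line M) i \<inter> chart_dom (product_line M) j"
  then have j: "j \<in> idx M" and p: "fst p \<in> chart_dom M i \<inter> chart_dom M j" by auto
  have "g\<^sub>0 i (fst p) (fst v) (fst w) = g\<^sub>0 j (fst p) (transition M i j (fst p) (fst v)) (transition M i j (fst p) (fst w))"
    using g[unfolded riemannian_metric_def, THEN conjunct2, THEN conjunct1] i j p by blast
  moreover have "\<omega>\<^sub>0 i (fst p) u = \<omega>\<^sub>0 j (fst p) (transition M i j (fst p) u)" for u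
    using \<omega>[unfolded smooth_one_form_def, THEN conjunct2, THEN conjunct1] i j p by blast
  ultimately show "?g i p v w = ?g j p (transition (product_line M) i j p v) (transition (product_line M) i j p w)"
    unfolding transition_product_line[OF M i j p] stationary_metric_def by simp
qed

lemma pseudo_riemannian_subset:
  "pseudo_riemannian A G \<Longrightarrow> B \<subseteq> A \<Longrightarrow> open B \<Longrightarrow> pseudo_riemannian B G"
  unfolding pseudo_riemannian_def by (blast intro: Ck_on_subset)

lemma christoffel_eq_chr:
  assumes "smooth_manifold N" "semi_riemannian_metric N g" "i \<in> idx N" "p \<in> chart_dom N i"
  shows "christoffel N g i p = pseudo_riemannian.chr (\<lambda>y. g i (param N i y)) (chart_map N i p)"
proof -
  interpret pseudo_riemannian "chart_map N i ` chart_dom N i" "\<lambda>y. g i (param N i y)"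
    using assms by (simp add: semi_riemannian_metric_def)
  show ?thesis
    unfolding christoffel_def chr_def levi_civita_def using assms by simp
qed

lemma continuous_within_openD:
  fixes f :: "'a::metric_space \<Rightarrow> 'b::topological_space"
  assumes "continuous (at a within S) f" "open V" "f a \<in> V"
  shows "\<exists>e>0. \<forall>t\<in>S. dist t a < e \<longrightarrow> f t \<in> V"
proof -
  have "eventually (\<lambda>t. f t \<in> V) (at a within S)"
    using assms topological_tendstoD unfolding continuous_within by blast
  then obtain e where e: "e > 0" "\<And>t. t \<in> S \<Longrightarrow> t \<noteq> a \<Longrightarrow> dist t a < e \<Longrightarrow> f t \<in> V"
    unfolding eventually_at by blast
  have "f t \<in> V" if "t \<in> S" "dist t a < e" for t
    using e(2)[OF that(1) _ that(2)] assms(3) by (cases "t = a") simp_all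
  with e(1) show ?thesis by blast
qed

section \<open>Tangent vectors and defining functions in charts\<close>

lemma tangent_to_transition:
  assumes N: "smooth_manifold N" "i \<in> idx N" "j \<in> idx N"
    and p: "p \<in> chart_dom N i \<inter> chart_dom N j" and t: "tangent_to N H i p v"
  shows "tangent_to N H j p (transition N i j p v)"
proof -
  obtain c where c: "c 0 = p" "\<And>t. c t \<in> H \<inter> chart_dom N i" "((chart_map N i \<circ> c) has_vector_derivative v) (at (0::real))"
    using t unfolding tangent_to_def by blast
  let ?O = "chart_map N i ` (chart_dom N i \<inter> chart_dom N j)"
  have O: "open ?O"
    using open_chart_image[OF N(1,2) smooth_manifold_chart(1)[OF N(1,3)]] by (simp add: Int_commute)
  have p_O: "chart_map N i p \<in> ?O" using p by blast
  have "continuous (at 0) (chart_map N i \<circ> c)"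
    using c(3) by (rule has_vector_derivative_continuous)
  then obtain e where e: "e > 0" "\<And>t. dist t 0 < e \<Longrightarrow> (chart_map N i \<circ> c) t \<in> ?O"
    using continuous_within_openD[OF _ O, of 0 UNIV "chart_map N i \<circ> c"] p_O c(1) by auto
  have in_j: "c t \<in> chart_dom N j" if "dist t 0 < e" for t
  proof -
    have "param N i ((chart_map N i \<circ> c) t) \<in> chart_dom N j \<inter> chart_dom N i"
      by (rule param_in_Int[OF N(1,2)]) (use e(2)[OF that] in \<open>simp add: Int_commute\<close>)
    then show ?thesis using c(2)[of t] N by simp
  qed
  \<comment> \<open>\<open>tangent_to\<close> asks the curve to remain in the chart for all times.
    Freezing it at \<open>p\<close> outside a small interval achieves this and leaves the velocity
    at 0 unchanged.\<close>
  define d where "d t = (if dist t 0 < e then c t else p)" for t :: real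
  have vd: "((chart_map N i \<circ> d) has_vector_derivative v) (at 0)"
    using c(3) unfolding has_vector_derivative_def
    by (rule has_derivative_transform_within[OF _ e(1)]) (auto simp: d_def dist_commute)
  have \<tau>: "((chart_map N j \<circ> param N i) has_derivative transition N i j p) (at ((chart_map N i \<circ> d) 0))"
    unfolding transition_def
    using Ck_on_Suc_has_derivative[OF Ck_on_transition[OF N, of "Suc 0"] p_O] c(1) e(1) by (simp add: d_def)
  have "((\<lambda>t. (chart_map N j \<circ> param N i) ((chart_map N i \<circ> d) t)) has_vector_derivative transition N i j p v) (at 0)"
    by (rule has_vector_derivative_compose_field[OF \<tau> vd])
  moreover have d: "d t \<in> H \<inter> chart_dom N i" "d t \<in> chart_dom N j" for t
    using c(2)[of t] c(1) c(2)[of 0] in_j[of t] p by (auto simp: d_def)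
  have "(\<lambda>t. (chart_map N j \<circ> param N i) ((chart_map N i \<circ> d) t)) = chart_map N j \<circ> d"
    using d(1) N by (simp add: fun_eq_iff)
  ultimately have "((chart_map N j \<circ> d) has_vector_derivative transition N i j p v) (at 0)" by (simp only:)
  moreover have "d 0 = p" using c(1) by (simp add: d_def)
  moreover have "\<forall>t. d t \<in> H \<inter> chart_dom N j" using d by simp
  ultimately show ?thesis unfolding tangent_to_def by blast
qed

text \<open>Along a curve in the hypersurface the function is constantly 0, so its derivative in the
  direction of the velocity vanishes.\<close>

lemma tangent_to_defining_function:
  assumes N: "smooth_manifold N" "i \<in> idx N" and def: "defining_function N H U\<^sub>0 \<Phi>"
    and p: "p \<in> U\<^sub>0 \<inter> chart_dom N i" and t: "tangent_to N H i p v"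
  shows "differential N \<Phi> i p v = 0"
proof -
  obtain c where c: "c 0 = p" "\<And>t. c t \<in> H \<inter> chart_dom N i" "((chart_map N i \<circ> c) has_vector_derivative v) (at (0::real))"
    using t unfolding tangent_to_def by blast
  let ?O = "chart_map N i ` (U\<^sub>0 \<inter> chart_dom N i)"
  have O: "open ?O" using open_chart_image[OF N] def by (simp add: defining_function_def)
  have p_O: "chart_map N i p \<in> ?O" using p by blast
  have "continuous (at 0) (chart_map N i \<circ> c)"
    using c(3) by (rule has_vector_derivative_continuous)
  then obtain e where e: "e > 0" "\<And>t. dist t 0 < e \<Longrightarrow> (chart_map N i \<circ> c) t \<in> ?O"
    using continuous_within_openD[OF _ O, of 0 UNIV "chart_map N i \<circ> c"] p_O c(1) by auto
  have zero: "(\<Phi> \<circ> param N i) ((chart_map N i \<circ> c) t) = 0" if "dist t 0 < e" for t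
  proof -
    have "param N i ((chart_map N i \<circ> c) t) \<in> U\<^sub>0 \<inter> chart_dom N i"
      by (rule param_in_Int[OF N e(2)[OF that]])
    then have "c t \<in> U\<^sub>0 \<inter> H" using c(2)[of t] N by simp
    moreover have "{z \<in> U\<^sub>0. \<Phi> z = 0} = U\<^sub>0 \<inter> H" using def by (simp add: defining_function_def)
    ultimately show ?thesis using c(2)[of t] N by auto
  qed
  have "Ck_on 2 ?O (\<Phi> \<circ> param N i)"
    using def N by (simp add: defining_function_def Ck_function_def)
  from Ck_on_2_has_derivative(1)[OF this p_O]
  have "((\<Phi> \<circ> param N i) has_derivative differential N \<Phi> i p) (at ((chart_map N i \<circ> c) 0))"
    using c(1) by (simp add: differential_def)
  from has_vector_derivative_compose_field[OF this c(3)]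
  have 1: "((\<lambda>t. (\<Phi> \<circ> param N i) ((chart_map N i \<circ> c) t)) has_vector_derivative differential N \<Phi> i p v) (at 0)" .
  have "((\<lambda>t. (\<Phi> \<circ> param N i) ((chart_map N i \<circ> c) t)) has_vector_derivative 0) (at 0)"
    using has_vector_derivative_const[of 0 "at 0"] unfolding has_vector_derivative_def
    by (rule has_derivative_transform_within[OF _ e(1)]) (use zero in \<open>auto simp: dist_commute\<close>)
  from vector_derivative_unique_at[OF 1 this] show ?thesis .
qed

section \<open>Geodesics on the side of a hypersurface force the Hessian condition\<close>

text \<open>A positive \<open>h\<close> would make \<open>r\<close> positive just after 0, and the
  mean value theorem would push \<open>\<rho>\<close> above 0. One-sided derivatives are what a
  geodesic starting on the hypersurface provides.\<close>

lemma second_order_maximum_at_endpoint: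
  fixes \<rho> r :: "real \<Rightarrow> real"
  assumes "e > 0" and \<rho>: "\<And>s. s \<in> {0..<e} \<Longrightarrow> (\<rho> has_vector_derivative r s) (at s within {0..<e})"
    and r: "(r has_vector_derivative h) (at 0 within {0..<e})"
    and "r 0 = 0" "\<rho> 0 = 0" and le: "\<And>s. s \<in> {0..<e} \<Longrightarrow> \<rho> s \<le> 0"
  shows "h \<le> 0"
proof (rule ccontr)
  assume "\<not> h \<le> 0"
  then have h: "h > 0" by simp
  have "(r has_real_derivative h) (at 0 within {0..<e})"
    using r by (simp add: has_real_derivative_iff_has_vector_derivative)
  then obtain d where d: "d > 0" "\<And>s. s > 0 \<Longrightarrow> 0 + s \<in> {0..<e} \<Longrightarrow> s < d \<Longrightarrow> r 0 < r (0 + s)"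
    using has_real_derivative_pos_inc_right[OF _ h] by blast
  define s where "s = min d e / 2"
  have s: "0 < s" "s < d" "s < e" using d(1) assms(1) by (auto simp: s_def)
  have "\<exists>x\<in>{0<..<s}. \<rho> s - \<rho> 0 = (\<lambda>t. t * r x) (s - 0)"
  proof (rule mvt_simple[OF s(1)])
    fix x assume x: "0 \<le> x" "x \<le> s"
    then have "(\<rho> has_vector_derivative r x) (at x within {0..s})"
      by (intro has_vector_derivative_within_subset[OF \<rho>]) (use s in auto)
    then show "(\<rho> has_derivative (\<lambda>t. t * r x)) (at x within {0..s})"
      by (simp add: has_vector_derivative_def)
  qed
  then obtain x where x: "x \<in> {0<..<s}" "\<rho> s = s * r x" using assms(5) by auto
  have "r x > 0" using d(2)[of x] x(1) s assms(4) by simp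
  then have "\<rho> s > 0" using x(2) s(1) by simp
  with le[of s] s show False by simp
qed

lemma semi_riemannian_metricD:
  assumes "semi_riemannian_metric N g" "i \<in> idx N"
  shows "pseudo_riemannian (chart_map N i ` chart_dom N i) (\<lambda>y. g i (param N i y))"
    and "j \<in> idx N \<Longrightarrow> p \<in> chart_dom N i \<inter> chart_dom N j \<Longrightarrow>
      g i p v w = g j p (transition N i j p v) (transition N i j p w)"
  using assms unfolding semi_riemannian_metric_def by blast+

text \<open>The transition preserves the metric, so a vector in its kernel would be orthogonal to
  everything.\<close>

lemma transition_nonzero:
  assumes N: "smooth_manifold N" "semi_riemannian_metric N g" "i \<in> idx N" "j \<in> idx N"
    and p: "p \<in> chart_dom N i \<inter> chart_dom N j" and v: "v \<noteq> 0"
  shows "transition N i j p v \<noteq> 0"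
proof
  assume 0: "transition N i j p v = 0"
  interpret Gi: pseudo_riemannian "chart_map N i ` chart_dom N i" "\<lambda>y. g i (param N i y)"
    by (rule semi_riemannian_metricD(1)[OF N(2,3)])
  interpret Gj: pseudo_riemannian "chart_map N j ` chart_dom N j" "\<lambda>y. g j (param N j y)"
    by (rule semi_riemannian_metricD(1)[OF N(2,4)])
  have in_i: "chart_map N i p \<in> chart_map N i ` chart_dom N i" and in_j: "chart_map N j p \<in> chart_map N j ` chart_dom N j"
    using p by auto
  have "g i p v w = 0" for w
  proof -
    have "g i p v w = g j p (transition N i j p v) (transition N i j p w)"
      by (rule semi_riemannian_metricD(2)[OF N(2,3,4) p])
    also have "\<dots> = 0" using Gj.G_lin(7)[OF in_j] p N 0 by simp
    finally show ?thesis .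
  qed
  then have "v = 0" using Gi.nondegenerate[OF in_i, of v] p N by simp
  with v show False by simp
qed

text \<open>\<open>geodesic_on\<close> demands the equation in every chart that the curve meets,
  whereas the solution is constructed in chart \<open>i\<close>. The second derivative of the
  coordinate change appears both in the acceleration and in the transformation law of the
  Christoffel maps, and cancels.\<close>

lemma geodesic_in_all_charts:
  assumes N: "smooth_manifold N" "semi_riemannian_metric N g" "i \<in> idx N" "j \<in> idx N"
    and s: "s \<in> I" "at s within I \<noteq> bot"
    and c: "\<And>t. t \<in> I \<Longrightarrow> c t \<in> chart_map N i ` chart_dom N i"
      "\<And>t. t \<in> I \<Longrightarrow> (c has_vector_derivative v t) (at t within I)"
      "\<And>t. t \<in> I \<Longrightarrow> (v has_vector_derivative
          - pseudo_riemannian.chr (\<lambda>y. g i (param N i y)) (c t) (v t) (v t)) (at t within I)"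
    and nt: "\<And>t. t \<in> I \<Longrightarrow> at t within I \<noteq> bot"
    and j: "param N i (c s) \<in> chart_dom N j"
  defines "\<gamma> \<equiv> param N i \<circ> c"
  shows "(chart_map N j \<circ> \<gamma>) differentiable (at s within I)"
    and "velocity N I \<gamma> j s = transition N i j (\<gamma> s) (v s)"
    and "(velocity N I \<gamma> j has_vector_derivative
           - christoffel N g j (\<gamma> s) (velocity N I \<gamma> j s) (velocity N I \<gamma> j s)) (at s within I)"
proof -
  let ?A = "chart_map N i ` (chart_dom N i \<inter> chart_dom N j)"
  define \<tau> where "\<tau> = chart_map N j \<circ> param N i"
  let ?G = "\<lambda>y. g i (param N i y)" and ?G' = "\<lambda>y. g j (param N j y)"
  let ?T = "\<lambda>y. frechet_derivative \<tau> (at y)"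
  have A: "open ?A"
    using open_chart_image[OF N(1,3) smooth_manifold_chart(1)[OF N(1,4)]] by (simp add: Int_commute)
  have "pseudo_riemannian (chart_map N i ` chart_dom N i) ?G"
    by (rule semi_riemannian_metricD(1)[OF N(2,3)])
  then have G: "pseudo_riemannian ?A ?G" by (rule pseudo_riemannian_subset) (use A in auto)
  have G': "pseudo_riemannian (chart_map N j ` chart_dom N j) ?G'"
    by (rule semi_riemannian_metricD(1)[OF N(2,4)])
  have in_A: "c t \<in> ?A" if "t \<in> I" "param N i (c t) \<in> chart_dom N j" for t
  proof -
    have "param N i (c t) \<in> chart_dom N i" by (rule param_in_chart_dom[OF N(1,3) c(1)[OF that(1)]])
    moreover have "chart_map N i (param N i (c t)) = c t" by (rule chart_map_param[OF N(1,3) c(1)[OF that(1)]])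
    ultimately show ?thesis using that(2) by (metis IntI image_eqI)
  qed
  have dom: "param N i y \<in> chart_dom N i" "param N i y \<in> chart_dom N j" "chart_map N i (param N i y) = y"
    if "y \<in> ?A" for y using that N(1,3) by auto
  have C2: "Ck_on 2 ?A \<tau>" unfolding \<tau>_def by (rule Ck_on_transition[OF N(1,3,4)])
  have tr: "transition N i j (param N i y) = ?T y" if "y \<in> ?A" for y
    unfolding transition_def dom(3)[OF that] \<tau>_def by (rule refl)
  have \<tau>_in: "\<tau> ` ?A \<subseteq> chart_map N j ` chart_dom N j" using N(1,3) by (auto simp: \<tau>_def)
  have iso: "?G y u w = ?G' (\<tau> y) (?T y u) (?T y w)" if "y \<in> ?A" for y u w
  proof -
    have "g i (param N i y) u w = g j (param N i y) (?T y u) (?T y w)"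
      unfolding tr[OF that, symmetric]
      by (rule semi_riemannian_metricD(2)[OF N(2,3,4)]) (use dom[OF that] in blast)
    moreover have "param N j (\<tau> y) = param N i y"
      using dom(2)[OF that] N by (simp add: \<tau>_def)
    ultimately show ?thesis by simp
  qed
  have \<gamma>eq: "chart_map N j \<circ> \<gamma> = (\<lambda>t. \<tau> (c t))" by (simp add: \<gamma>_def \<tau>_def fun_eq_iff)
  have vd: "((\<lambda>t. \<tau> (c t)) has_vector_derivative ?T (c t) (v t)) (at t within I)"
    if t: "t \<in> I" "param N i (c t) \<in> chart_dom N j" for t
    by (rule has_vector_derivative_compose_field[OF Ck_on_2_has_derivative(1)[OF C2 in_A[OF t]] c(2)[OF t(1)]])
  show "(chart_map N j \<circ> \<gamma>) differentiable (at s within I)"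
    unfolding \<gamma>eq using vd[OF s(1) j] by (rule differentiableI_vector)
  have vel: "velocity N I \<gamma> j t = ?T (c t) (v t)" if t: "t \<in> I" "param N i (c t) \<in> chart_dom N j" for t
    unfolding velocity_def \<gamma>eq by (rule vector_derivative_within[OF nt[OF t(1)] vd[OF t]])
  show "velocity N I \<gamma> j s = transition N i j (\<gamma> s) (v s)"
    using vel[OF s(1) j] tr[OF in_A[OF s(1) j]] by (simp add: \<gamma>_def)
  let ?D2 = "\<lambda>u w. frechet_derivative (\<lambda>y. ?T y w) (at (c s)) u"
  have "((\<lambda>t. ?T (c t) (v t)) has_vector_derivative
      (?D2 (v s) (v s) + ?T (c s) (- pseudo_riemannian.chr ?G (c s) (v s) (v s)))) (at s within I)"
    by (rule second_derivative_along_curve[OF A C2 in_A[OF s(1) j] c(2)[OF s(1)] c(3)[OF s(1)]])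
  moreover have "?D2 (v s) (v s) + ?T (c s) (- pseudo_riemannian.chr ?G (c s) (v s) (v s)) =
    - pseudo_riemannian.chr ?G' (\<tau> (c s)) (?T (c s) (v s)) (?T (c s) (v s))"
    using chr_transform[OF G G' C2 \<tau>_in iso in_A[OF s(1) j], of "v s" "v s"]
      linear_neg[OF has_derivative_linear[OF Ck_on_2_has_derivative(1)[OF C2 in_A[OF s(1) j]]]]
    by (simp only: minus_diff_eq) simp
  ultimately have d: "((\<lambda>t. ?T (c t) (v t)) has_vector_derivative
      - pseudo_riemannian.chr ?G' (\<tau> (c s)) (?T (c s) (v s)) (?T (c s) (v s))) (at s within I)" by simp
  have chr: "christoffel N g j (\<gamma> s) = pseudo_riemannian.chr ?G' (\<tau> (c s))"
    using christoffel_eq_chr[OF N(1,2,4) j] by (simp add: \<gamma>_def \<tau>_def)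
  \<comment> \<open>The formula for the velocity in chart \<open>j\<close> is valid only while the
    curve is in that chart, so the derivative is transferred on a neighbourhood of
    \<open>s\<close>.\<close>
  have "continuous (at s within I) c"
    using has_vector_derivative_continuous c(2)[OF s(1)] by blast
  from continuous_within_openD[OF this A in_A[OF s(1) j]]
  obtain e where e: "e > 0" "\<And>t. t \<in> I \<Longrightarrow> dist t s < e \<Longrightarrow> c t \<in> ?A" by blast
  show "(velocity N I \<gamma> j has_vector_derivative
           - christoffel N g j (\<gamma> s) (velocity N I \<gamma> j s) (velocity N I \<gamma> j s)) (at s within I)"
    unfolding chr vel[OF s(1) j]
    using d unfolding has_vector_derivative_def
  proof (rule has_derivative_transform_within[OF _ e(1) s(1)])
    fix t assume t: "t \<in> I" "dist t s < e"
    show "?T (c t) (v t) = velocity N I \<gamma> j t"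
      by (rule vel[symmetric, OF t(1) dom(2)[OF e(2)[OF t]]])
  qed
qed

text \<open>Constancy of the squared speed propagates nullity from the starting point, and
  injectivity of the transitions keeps the velocity nonzero in every other chart.\<close>

lemma lightlike_geodesic_in_chart:
  assumes N: "smooth_manifold N" "semi_riemannian_metric N g" "i \<in> idx N"
    and e: "(e::real) > 0"
    and c: "\<And>t. t \<in> {0..<e} \<Longrightarrow> c t \<in> chart_map N i ` chart_dom N i"
      "\<And>t. t \<in> {0..<e} \<Longrightarrow> (c has_vector_derivative v t) (at t within {0..<e})"
      "\<And>t. t \<in> {0..<e} \<Longrightarrow> (v has_vector_derivative
          - pseudo_riemannian.chr (\<lambda>y. g i (param N i y)) (c t) (v t) (v t)) (at t within {0..<e})"
    and v: "\<And>t. t \<in> {0..<e} \<Longrightarrow> v t \<noteq> 0" and l: "g i (param N i (c 0)) (v 0) (v 0) = 0"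
  shows "lightlike_geodesic_on N g {0..<e} (param N i \<circ> c)"
    and "\<And>j. j \<in> idx N \<Longrightarrow> param N i (c 0) \<in> chart_dom N j \<Longrightarrow>
      velocity N {0..<e} (param N i \<circ> c) j 0 = transition N i j (param N i (c 0)) (v 0)"
proof -
  let ?I = "{0..<e}" and ?\<gamma> = "param N i \<circ> c"
  let ?G = "\<lambda>y. g i (param N i y)"
  interpret pseudo_riemannian "chart_map N i ` chart_dom N i" ?G
    by (rule semi_riemannian_metricD(1)[OF N(2,3)])
  have nt: "at t within ?I \<noteq> bot" if "t \<in> ?I" for t
  proof -
    have "t islimpt {0..<e}" using that e by (simp add: islimpt_Ico)
    then show ?thesis by (simp add: trivial_limit_within)
  qed
  have const: "((\<lambda>s. ?G (c s) (v s) (v s)) has_vector_derivative 0) (at s within ?I)" if "s \<in> ?I" for s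
    by (rule const_speed_derivative[OF c(1,2,3)[OF that]])
  have "\<exists>k. \<forall>s\<in>?I. ?G (c s) (v s) (v s) = k"
    by (rule has_vector_derivative_zero_constant[OF convex_real_interval(7) const]) auto
  then obtain k where k: "\<And>s. s \<in> ?I \<Longrightarrow> ?G (c s) (v s) (v s) = k" by blast
  have null: "?G (c s) (v s) (v s) = 0" if "s \<in> ?I" for s
    using k[OF that] k[of 0] l e by simp
  have geo: "(chart_map N j \<circ> ?\<gamma>) differentiable (at s within ?I)"
    "velocity N ?I ?\<gamma> j s = transition N i j (?\<gamma> s) (v s)"
    "(velocity N ?I ?\<gamma> j has_vector_derivative
       - christoffel N g j (?\<gamma> s) (velocity N ?I ?\<gamma> j s) (velocity N ?I ?\<gamma> j s)) (at s within ?I)"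
    if "s \<in> ?I" "j \<in> idx N" "param N i (c s) \<in> chart_dom N j" for s j
    by (rule geodesic_in_all_charts[OF N that(2,1) nt[OF that(1)] c nt that(3)]; assumption)+
  have "continuous_on ?I c"
    unfolding continuous_on_eq_continuous_within using has_vector_derivative_continuous c(2) by blast
  then have "continuous_on ?I (\<lambda>s. param N i (c s))"
    by (rule continuous_on_compose2[OF homeomorphism_cont2[OF smooth_manifold_chart(3)[OF N(1,3)]]])
      (use c(1) in blast)
  then have "geodesic_on N g ?I ?\<gamma>"
    unfolding geodesic_on_def using geo(1,3) by (simp add: o_def)
  moreover have "lightlike g j (?\<gamma> s) (velocity N ?I ?\<gamma> j s)"
    if s: "s \<in> ?I" and j: "j \<in> idx N" "?\<gamma> s \<in> chart_dom N j" for s j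
  proof -
    have p: "?\<gamma> s \<in> chart_dom N i \<inter> chart_dom N j"
      using param_in_chart_dom[OF N(1,3) c(1)[OF s]] j(2) by simp
    have vel: "velocity N ?I ?\<gamma> j s = transition N i j (?\<gamma> s) (v s)"
      using geo(2)[OF s j(1)] j(2) by simp
    have "g i (?\<gamma> s) (v s) (v s) = g j (?\<gamma> s) (velocity N ?I ?\<gamma> j s) (velocity N ?I ?\<gamma> j s)"
      unfolding vel by (rule semi_riemannian_metricD(2)[OF N(2,3) j(1) p])
    then show ?thesis
      using null[OF s] transition_nonzero[OF N j(1) p v[OF s]] by (simp add: lightlike_def vel)
  qed
  ultimately show "lightlike_geodesic_on N g ?I ?\<gamma>"
    unfolding lightlike_geodesic_on_def by blast
  show "velocity N ?I ?\<gamma> j 0 = transition N i j (param N i (c 0)) (v 0)"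
    if "j \<in> idx N" "param N i (c 0) \<in> chart_dom N j" for j
    using geo(2)[OF _ that] e by simp
qed

lemma hessian_light_convex_of_geodesically_light_convex:
  assumes N: "smooth_manifold N" "semi_riemannian_metric N g"
    and def: "defining_function N H U\<^sub>0 \<Phi>" and conv: "geodesically_light_convex N g H U\<^sub>0 \<Phi>"
  shows "hessian_light_convex N g H U\<^sub>0 \<Phi>"
  unfolding hessian_light_convex_def
proof (intro ballI allI impI)
  fix z i w
  assume z: "z \<in> U\<^sub>0 \<inter> H" and i: "i \<in> idx N" and zi: "z \<in> chart_dom N i"
    and "lightlike g i z w \<and> tangent_to N H i z w"
  then have w: "w \<noteq> 0" "g i z w w = 0" and tan: "tangent_to N H i z w" by (auto simp: lightlike_def)
  obtain U where U: "open U" "z \<in> U" "U \<subseteq> U\<^sub>0"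
    and cv: "\<forall>b>0. \<forall>\<gamma>. lightlike_geodesic_on N g {0..<b} \<gamma> \<and> \<gamma> ` {0..<b} \<subseteq> U \<and> \<gamma> 0 = z \<and>
      (\<forall>i\<in>idx N. z \<in> chart_dom N i \<longrightarrow> tangent_to N H i z (velocity N {0..<b} \<gamma> i 0))
      \<longrightarrow> \<gamma> ` {0..<b} \<subseteq> closure {q \<in> U. \<Phi> q < 0}"
    using bspec[OF conv[unfolded geodesically_light_convex_def] z] by (elim exE conjE) (rule that)
  have convU: "\<gamma> ` {0..<b} \<subseteq> closure {q \<in> U. \<Phi> q < 0}"
    if "b > 0" "lightlike_geodesic_on N g {0..<b} \<gamma>" "\<gamma> ` {0..<b} \<subseteq> U" "\<gamma> 0 = z"
      "\<forall>i\<in>idx N. z \<in> chart_dom N i \<longrightarrow> tangent_to N H i z (velocity N {0..<b} \<gamma> i 0)" for b \<gamma>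
    by (rule cv[THEN spec, THEN mp, THEN spec, THEN mp, OF that(1)]) (intro conjI that)
  let ?G = "\<lambda>y. g i (param N i y)"
  let ?A = "chart_map N i ` (U \<inter> chart_dom N i)"
  have A: "open ?A" by (rule open_chart_image[OF N(1) i U(1)])
  have "pseudo_riemannian (chart_map N i ` chart_dom N i) ?G"
    by (rule semi_riemannian_metricD(1)[OF N(2) i])
  then interpret pseudo_riemannian ?A ?G by (rule pseudo_riemannian_subset) (use A in auto)
  have x0: "chart_map N i z \<in> ?A" using U zi by blast
  obtain e c v where e: "e > 0" and c: "c 0 = chart_map N i z" "v 0 = w"
    "\<And>s. s \<in> {0..e} \<Longrightarrow> c s \<in> ?A"
    "\<And>s. s \<in> {0..e} \<Longrightarrow> (c has_vector_derivative v s) (at s within {0..e})"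
    "\<And>s. s \<in> {0..e} \<Longrightarrow> (v has_vector_derivative - chr (c s) (v s) (v s)) (at s within {0..e})"
    using geodesic_exists[OF x0, of w] by blast
  have e0: "0 \<in> {0..e}" using e by simp
  have "continuous (at 0 within {0..e}) v"
    using has_vector_derivative_continuous c(5)[OF e0] by blast
  \<comment> \<open>\<open>w - w\<close> is the zero vector; the open set is the complement of the
    origin.\<close>
  from continuous_within_openD[OF this open_Compl[OF closed_singleton, of "w - w"]]
  obtain d where d: "d > 0" "\<And>s. s \<in> {0..e} \<Longrightarrow> dist s 0 < d \<Longrightarrow> v s \<noteq> 0"
    using w(1) c(2) by auto
  \<comment> \<open>\<open>lightlike\<close> excludes the zero vector, so the interval is cut down
    until the velocity does not vanish on it.\<close>
  define b where "b = min d e"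
  have b: "b > 0" using e d(1) by (simp add: b_def)
  let ?I = "{0..<b}"
  have I: "s \<in> {0..e}" "dist s 0 < d" if "s \<in> ?I" for s using that by (auto simp: b_def)
  have sub: "?I \<subseteq> {0..e}" using I by blast
  have vd: "(c has_vector_derivative v s) (at s within ?I)"
    "(v has_vector_derivative - chr (c s) (v s) (v s)) (at s within ?I)" if "s \<in> ?I" for s
    using has_vector_derivative_within_subset[OF c(4)[OF I(1)[OF that]] sub]
      has_vector_derivative_within_subset[OF c(5)[OF I(1)[OF that]] sub] by auto
  let ?\<gamma> = "param N i \<circ> c"
  have \<gamma>0: "param N i (c 0) = z" using c(1) N(1) i zi by simp
  have cdom: "c s \<in> chart_map N i ` chart_dom N i" if "s \<in> ?I" for s
    using c(3)[OF I(1)[OF that]] by blast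
  have vn: "v s \<noteq> 0" if "s \<in> ?I" for s using d(2)[OF I[OF that]] by simp
  have null: "g i (param N i (c 0)) (v 0) (v 0) = 0" unfolding \<gamma>0 c(2) by (rule w(2))
  have geo1: "lightlike_geodesic_on N g ?I ?\<gamma>"
    by (rule lightlike_geodesic_in_chart(1)[OF N i b cdom vd vn null]; assumption)
  have geo2: "velocity N ?I ?\<gamma> j 0 = transition N i j (param N i (c 0)) (v 0)"
    if "j \<in> idx N" "param N i (c 0) \<in> chart_dom N j" for j
    by (rule lightlike_geodesic_in_chart(2)[OF N i b cdom vd vn null that]; assumption)
  have \<gamma>U: "?\<gamma> s \<in> U" if "s \<in> ?I" for s
    using param_in_Int[OF N(1) i c(3)[OF I(1)[OF that]]] by simp
  have "?\<gamma> ` ?I \<subseteq> closure {q \<in> U. \<Phi> q < 0}"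
  proof (rule convU[OF b geo1])
    show "?\<gamma> ` ?I \<subseteq> U" using \<gamma>U by blast
    show "?\<gamma> 0 = z" using \<gamma>0 by simp
    show "\<forall>j\<in>idx N. z \<in> chart_dom N j \<longrightarrow> tangent_to N H j z (velocity N ?I ?\<gamma> j 0)"
    proof (intro ballI impI)
      fix j assume j: "j \<in> idx N" "z \<in> chart_dom N j"
      then have "velocity N ?I ?\<gamma> j 0 = transition N i j z w"
        using geo2[OF j(1)] \<gamma>0 c(2) by simp
      then show "tangent_to N H j z (velocity N ?I ?\<gamma> j 0)"
        using tangent_to_transition[OF N(1) i j(1) _ tan] zi j(2) by simp
    qed
  qed
  note side = this
  have U0: "open U\<^sub>0" and C2: "Ck_on 2 (chart_map N i ` (U\<^sub>0 \<inter> chart_dom N i)) (\<Phi> \<circ> param N i)"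
    using def i by (auto simp: defining_function_def Ck_function_def)
  let ?B = "chart_map N i ` (U\<^sub>0 \<inter> chart_dom N i)"
  have B: "open ?B" by (rule open_chart_image[OF N(1) i U0])
  have AB: "?A \<subseteq> ?B" using U(3) by blast
  define \<rho> where "\<rho> s = (\<Phi> \<circ> param N i) (c s)" for s
  \<comment> \<open>A point with \<open>\<Phi> > 0\<close> has a neighbourhood on which
    \<open>\<Phi>\<close> stays positive, so it cannot lie in the closure of the negative side.
    Continuity of \<open>\<Phi>\<close> is known in coordinates, which is why the neighbourhood
    \<open>V\<close> is built through the chart.\<close>
  have "\<rho> s \<le> 0" if s: "s \<in> ?I" for s
  proof (rule ccontr)
    assume pos: "\<not> \<rho> s \<le> 0"
    have cont: "continuous_on ?A (\<Phi> \<circ> param N i)"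
      by (rule continuous_on_subset[OF Ck_on_imp_continuous_on[OF C2] AB])
    have op: "open {y \<in> ?A. (\<Phi> \<circ> param N i) y > 0}"
      using continuous_openin_preimage_gen[OF cont, of "{0<..}"] openin_open_trans A
      by (auto simp: vimage_def Int_def)
    have "c s \<in> {y \<in> ?A. (\<Phi> \<circ> param N i) y > 0}"
      using c(3)[OF I(1)[OF s]] pos by (simp add: \<rho>_def)
    define V where "V = U \<inter> chart_dom N i \<inter> chart_map N i -` {y \<in> ?A. (\<Phi> \<circ> param N i) y > 0}"
    have "continuous_on (U \<inter> chart_dom N i) (chart_map N i)"
      by (rule continuous_on_subset[OF homeomorphism_cont1[OF smooth_manifold_chart(3)[OF N(1) i]]]) simp
    then have "open V"
      unfolding V_def
      by (rule continuous_open_preimage[OF _ open_Int[OF U(1) smooth_manifold_chart(1)[OF N(1) i]] op])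
    moreover have "?\<gamma> s \<in> V"
      using param_in_Int[OF N(1) i c(3)[OF I(1)[OF s]]] chart_map_param[OF N(1) i cdom[OF s]]
        \<open>c s \<in> {y \<in> ?A. (\<Phi> \<circ> param N i) y > 0}\<close> unfolding V_def by simp
    moreover have "?\<gamma> s \<in> closure {q \<in> U. \<Phi> q < 0}" using s
        side by blast
    ultimately have "V \<inter> {q \<in> U. \<Phi> q < 0} \<noteq> {}"
      using open_Int_closure_eq_empty by blast
    then obtain q where q: "q \<in> V" "\<Phi> q < 0" by blast
    then have "q \<in> chart_dom N i" "(\<Phi> \<circ> param N i) (chart_map N i q) > 0" by (simp_all add: V_def)
    then show False using q(2) N(1) i by simp
  qed
  let ?f = "\<Phi> \<circ> param N i"
  define r where "r s = frechet_derivative ?f (at (c s)) (v s)" for s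
  have inB: "c s \<in> ?B" if "s \<in> ?I" for s using c(3)[OF I(1)[OF that]] AB by blast
  have \<rho>': "(\<rho> has_vector_derivative r s) (at s within ?I)" if "s \<in> ?I" for s
    unfolding \<rho>_def[abs_def] r_def
    by (rule has_vector_derivative_compose_field[OF Ck_on_2_has_derivative(1)[OF C2 inB[OF that]] vd(1)[OF that]])
  have I0: "0 \<in> ?I" using b by simp
  have "(r has_vector_derivative (frechet_derivative (\<lambda>y. frechet_derivative ?f (at y) (v 0)) (at (c 0)) (v 0)
      + frechet_derivative ?f (at (c 0)) (- chr (c 0) (v 0) (v 0)))) (at 0 within ?I)"
    unfolding r_def[abs_def]
    by (rule second_derivative_along_curve[OF B C2 inB[OF I0] vd[OF I0]])
  moreover have "frechet_derivative (\<lambda>y. frechet_derivative ?f (at y) (v 0)) (at (c 0)) (v 0)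
      + frechet_derivative ?f (at (c 0)) (- chr (c 0) (v 0) (v 0)) = hessian N g \<Phi> i z w w"
    unfolding hessian_def differential_def christoffel_eq_chr[OF N i zi] c(1,2)
    using linear_neg[OF has_derivative_linear[OF Ck_on_2_has_derivative(1)[OF C2 inB[OF I0]]]] c(1) by simp
  ultimately have r': "(r has_vector_derivative hessian N g \<Phi> i z w w) (at 0 within ?I)" by simp
  have "r 0 = 0"
    using tangent_to_defining_function[OF N(1) i def _ tan] zi z unfolding r_def c(1,2) differential_def by blast
  moreover have "\<rho> 0 = 0"
  proof -
    have "z \<in> {z \<in> U\<^sub>0. \<Phi> z = 0}" using def z by (simp add: defining_function_def)
    then show ?thesis using \<gamma>0 by (simp add: \<rho>_def)
  qed
  ultimately show "hessian N g \<Phi> i z w w \<le> 0"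
    using second_order_maximum_at_endpoint[OF b \<rho>' r'] \<open>\<And>s. s \<in> ?I \<Longrightarrow> \<rho> s \<le> 0\<close> by blast
qed

section \<open>One-dimensional estimates along a geodesic\<close>

text \<open>
  If \<open>\<rho>\<close> became positive, it would have to climb from its minimum on \<open>[0, s1]\<close>, where \<open>r\<close> is nonpositive,
  to its maximum; on a short interval the inequality does not let \<open>r\<close> grow fast enough for that.
\<close>
lemma nonpositive_of_second_order_inequality:
  fixes \<rho> r q :: "real \<Rightarrow> real"
  assumes \<rho>: "\<And>s. s \<in> {0..<b} \<Longrightarrow> (\<rho> has_vector_derivative r s) (at s within {0..<b})"
    and r: "\<And>s. s \<in> {0..<b} \<Longrightarrow> (r has_vector_derivative q s) (at s within {0..<b})"
    and q: "\<And>s. s \<in> {0..<b} \<Longrightarrow> q s \<le> C * N * N * \<bar>\<rho> s\<bar> + C * N * \<bar>r s\<bar>"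
    and init: "\<rho> 0 = 0" "r 0 = 0"
    and C: "C \<ge> 0" "N \<ge> 0" "b * N \<le> \<delta>" "C * (\<delta> * \<delta> + \<delta>) < 1"
    and s1: "s1 \<in> {0..<b}"
  shows "\<rho> s1 \<le> 0"
proof (rule ccontr)
  assume "\<not> \<rho> s1 \<le> 0"
  then have pos: "\<rho> s1 > 0" by simp
  have sub: "{0..s1} \<subseteq> {0..<b}" using s1 by auto
  have c\<rho>: "continuous_on {0..s1} \<rho>" and cr: "continuous_on {0..s1} r"
    using has_vector_derivative_continuous[OF has_vector_derivative_within_subset[OF \<rho> sub]]
      has_vector_derivative_continuous[OF has_vector_derivative_within_subset[OF r sub]] sub
    unfolding continuous_on_eq_continuous_within by blast+
  obtain s2 where s2: "s2 \<in> {0..s1}" "\<And>s. s \<in> {0..s1} \<Longrightarrow> \<rho> s2 \<le> \<rho> s"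
    using continuous_attains_inf[OF compact_Icc _ c\<rho>] s1 by auto
  have le0: "\<rho> s2 \<le> 0" using s2(2)[of 0] init s1 by simp
  have lt: "s2 < s1" using s2(1) pos le0 by (cases "s2 = s1") auto
  have r2: "r s2 \<le> 0"
  proof (cases "s2 = 0")
    case True
    then show ?thesis using init by simp
  next
    case False
    then have in0: "s2 \<in> {0<..<s1}" using s2(1) lt by auto
    have "(\<rho> has_vector_derivative r s2) (at s2 within {0<..<s1})"
      by (rule has_vector_derivative_within_subset[OF \<rho>]) (use in0 s1 in auto)
    then have "DERIV \<rho> s2 :> r s2"
      using in0 by (simp add: has_real_derivative_iff_has_vector_derivative at_within_open[OF in0 open_greaterThanLessThan])
    moreover have "\<forall>y. \<bar>s2 - y\<bar> < min s2 (s1 - s2) \<longrightarrow> \<rho> s2 \<le> \<rho> y"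
      by (intro allI impI s2(2)) (simp, arith)
    ultimately have "r s2 = 0"
      using DERIV_local_min[of \<rho> "r s2" s2 "min s2 (s1 - s2)"] in0 by auto
    then show ?thesis by simp
  qed
  let ?J = "{s2..s1}"
  have J: "?J \<subseteq> {0..s1}" using s2(1) by auto
  obtain s4 where s4: "s4 \<in> ?J" "\<And>s. s \<in> ?J \<Longrightarrow> \<rho> s \<le> \<rho> s4"
    using continuous_attains_sup[OF compact_Icc _ continuous_on_subset[OF c\<rho> J]] lt by auto
  obtain s5 where s5: "s5 \<in> ?J" "\<And>s. s \<in> ?J \<Longrightarrow> r s \<le> r s5"
    using continuous_attains_sup[OF compact_Icc _ continuous_on_subset[OF cr J]] lt by auto
  \<comment> \<open>\<open>D\<close> bounds \<open>\<bar>\<rho>\<bar>\<close> on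
    \<open>[s2, s1]\<close>, since \<open>\<rho>\<close> is nonpositive at its minimum and positive
    at \<open>s4\<close>. Through \<open>D \<le> b P\<close> the whole inequality will be expressed
    by \<open>P\<close> alone.\<close>
  define D where "D = \<rho> s4 - \<rho> s2"
  define P where "P = r s5"
  have "\<rho> s4 > 0" using s4(2)[of s1] lt pos by simp
  then have D: "D > 0" using le0 by (simp add: D_def)
  have abs: "\<bar>\<rho> s\<bar> \<le> D" if "s \<in> ?J" for s
    using s4(2)[OF that] s2(2)[of s] that J le0 \<open>\<rho> s4 > 0\<close> by (auto simp: D_def)
  have mvt: "\<exists>x\<in>{a<..<c}. f c - f a = (c - a) * f' x"
    if "s2 \<le> a" "a < c" "c \<le> s1" "\<And>s. s \<in> {0..<b} \<Longrightarrow> (f has_vector_derivative f' s) (at s within {0..<b})"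
    for a c and f f' :: "real \<Rightarrow> real"
  proof -
    have "\<exists>x\<in>{a<..<c}. f c - f a = (\<lambda>t. t * f' x) (c - a)"
    proof (rule mvt_simple[OF that(2)])
      fix x assume x: "a \<le> x" "x \<le> c"
      then have "(f has_vector_derivative f' x) (at x within {a..c})"
        by (intro has_vector_derivative_within_subset[OF that(4)]) (use that s2(1) s1 in auto)
      then show "(f has_derivative (\<lambda>t. t * f' x)) (at x within {a..c})"
        by (simp add: has_vector_derivative_def)
    qed
    then show ?thesis by simp
  qed
  have b: "b \<ge> 0" using s1 by simp
  have "s2 < s4" using s4(1) D by (cases "s2 = s4") (auto simp: D_def)
  then obtain x where x: "x \<in> {s2<..<s4}" "\<rho> s4 - \<rho> s2 = (s4 - s2) * r x"
    using mvt[OF order_refl _ _ \<rho>, of s4] s4(1) by auto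
  have rx: "r x \<le> P" unfolding P_def by (rule s5(2)) (use x(1) s4(1) in auto)
  have "(s4 - s2) * r x > 0" using D x(2) by (simp add: D_def)
  then have "r x > 0" using \<open>s2 < s4\<close> by (simp add: zero_less_mult_iff)
  then have P: "P > 0" using rx by simp
  have "s4 - s2 \<le> b" using s4(1) s2(1) s1 by auto
  then have DP: "D \<le> b * P"
    unfolding D_def x(2) using rx \<open>r x > 0\<close> b by (intro mult_mono) auto
  \<comment> \<open>\<open>r\<close> may be very negative somewhere, so \<open>P\<close> need not
    bound \<open>\<bar>r\<bar>\<close> everywhere. After the last time \<open>s6\<close> before
    \<open>s5\<close> with \<open>r \<le> 0\<close>, however, \<open>r\<close> is positive, and the
    rise to \<open>P\<close> takes place on that stretch.\<close>
  let ?Z = "{s \<in> {s2..s5}. r s \<le> 0}"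
  have Z: "compact ?Z"
  proof -
    have "continuous_on {s2..s5} r" by (rule continuous_on_subset[OF cr]) (use J s5(1) in auto)
    then have "closed ?Z" by (intro continuous_on_closed_Collect_le continuous_intros) auto
    moreover have "bounded ?Z" by (rule bounded_subset[OF bounded_closed_interval[of s2 s5]]) auto
    ultimately show ?thesis by (simp add: compact_eq_bounded_closed)
  qed
  obtain s6 where s6: "s6 \<in> ?Z" "\<And>s. s \<in> ?Z \<Longrightarrow> s \<le> s6"
    using compact_attains_sup[OF Z] r2 s5(1) by auto
  have "s6 < s5" using s6(1) P by (cases "s6 = s5") (auto simp: P_def)
  then obtain y where y: "y \<in> {s6<..<s5}" "r s5 - r s6 = (s5 - s6) * q y"
    using mvt[OF _ _ _ r, of s6 s5] s6(1) s5(1) by auto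
  have yJ: "y \<in> ?J" using y(1) s6(1) s5(1) by auto
  have "r y > 0"
  proof (rule ccontr)
    assume "\<not> r y > 0"
    then have "y \<le> s6" by (intro s6(2)) (use y(1) s6(1) in auto)
    then show False using y(1) by simp
  qed
  then have ry: "\<bar>r y\<bar> \<le> P" using s5(2)[OF yJ] by (simp add: P_def)
  have "q y \<le> C * N * N * \<bar>\<rho> y\<bar> + C * N * \<bar>r y\<bar>" by (rule q) (use yJ J sub in blast)
  also have "\<dots> \<le> C * N * N * (b * P) + C * N * P"
    using abs[OF yJ] DP ry C(1,2) by (intro add_mono mult_left_mono) auto
  finally have qy: "q y \<le> C * N * N * (b * P) + C * N * P" .
  have "P \<le> (s5 - s6) * q y" using y(2) s6(1) by (simp add: P_def)
  also have "\<dots> \<le> (s5 - s6) * (C * N * N * (b * P) + C * N * P)"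
    using qy \<open>s6 < s5\<close> by (intro mult_left_mono) auto
  also have "\<dots> \<le> b * (C * N * N * (b * P) + C * N * P)"
    using s5(1) s6(1) s2(1) s1 b P C(1,2) by (intro mult_right_mono) auto
  \<comment> \<open>Time and speed occur only in the product \<open>b N\<close>, which does not
    change when the parameter is rescaled.\<close>
  also have "\<dots> = C * ((b * N) * (b * N) + b * N) * P" by (simp add: algebra_simps)
  also have "\<dots> \<le> C * (\<delta> * \<delta> + \<delta>) * P"
    using C b P order_trans[OF mult_nonneg_nonneg[OF b C(2)] C(3)]
    by (intro mult_right_mono mult_left_mono add_mono mult_mono) auto
  also have "\<dots> < 1 * P" using C(4) P by (intro mult_strict_right_mono) auto
  finally show False by simp
qed

text \<open>The acceleration is quadratic in the speed, so up to the time \<open>T\<close> divided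
  by the initial speed the velocity deviates by at most half of the initial speed. By then the curve
  would have moved at least \<open>T / 2\<close>; a curve confined to the smaller ball must end no
  later.\<close>

lemma short_time_in_small_ball:
  fixes c v a :: "real \<Rightarrow> 'a::euclidean_space"
  assumes c: "\<And>s. s \<in> {0..<b} \<Longrightarrow> (c has_vector_derivative v s) (at s within {0..<b})"
    and v: "\<And>s. s \<in> {0..<b} \<Longrightarrow> (v has_vector_derivative a s) (at s within {0..<b})"
    and a: "\<And>s. s \<in> {0..<b} \<Longrightarrow> norm (a s) \<le> K * norm (v s) * norm (v s)"
    and small: "\<And>s. s \<in> {0..<b} \<Longrightarrow> norm (c s - c 0) < T / 2"
    and K: "K \<ge> 0" "9 * K * T \<le> 1" "T > 0" and V: "v 0 \<noteq> 0" and b: "b > 0"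
  shows "b * norm (v 0) \<le> T" and "s \<in> {0..<b} \<Longrightarrow> norm (v s) \<le> 2 * norm (v 0)"
proof -
  define V where "V = norm (v 0)"
  have V0: "V > 0" using V by (simp add: V_def)
  have close: "norm (v s - v 0) \<le> V / 2" if s: "s \<in> {0..<b}" "s * V \<le> T" for s
  proof (rule ccontr)
    assume far: "\<not> norm (v s - v 0) \<le> V / 2"
    have sub: "{0..s} \<subseteq> {0..<b}" using s by auto
    have cv: "continuous_on {0..s} v"
      using has_vector_derivative_continuous[OF has_vector_derivative_within_subset[OF v sub]] sub
      unfolding continuous_on_eq_continuous_within by blast
    \<comment> \<open>The least element of this set is the first time at which the deviation reaches
      \<open>V / 2\<close>; before it the speed is below \<open>3/2 V\<close>.\<close>
    let ?Z = "{t \<in> {0..s}. V / 2 \<le> norm (v t - v 0)}"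
    have "closed ?Z"
      by (intro continuous_on_closed_Collect_le continuous_intros cv) auto
    moreover have "bounded ?Z" by (rule bounded_subset[OF bounded_closed_interval[of 0 s]]) auto
    ultimately have "compact ?Z" by (simp add: compact_eq_bounded_closed)
    moreover have "s \<in> ?Z" using far s by auto
    ultimately obtain t where t: "t \<in> ?Z" "\<And>t'. t' \<in> ?Z \<Longrightarrow> t \<le> t'"
      using compact_attains_inf[of ?Z] by blast
    have t0: "0 < t" using t(1) V0 by (cases "t = 0") auto
    have "\<exists>x\<in>{0<..<t}. norm (v t - v 0) \<le> norm ((\<lambda>h. h *\<^sub>R a x) (t - 0))"
    proof (rule mvt_general[OF t0])
      show "continuous_on {0..t} v" by (rule continuous_on_subset[OF cv]) (use t(1) in auto)
      fix x assume x: "0 < x" "x < t"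
      have "(v has_vector_derivative a x) (at x within {0<..<t})"
        by (rule has_vector_derivative_within_subset[OF v]) (use x t(1) s in auto)
      then show "(v has_derivative (\<lambda>h. h *\<^sub>R a x)) (at x)"
        using x by (simp add: has_vector_derivative_def at_within_open[of x "{0<..<t}"])
    qed
    then obtain x where x: "x \<in> {0<..<t}" "norm (v t - v 0) \<le> t * norm (a x)" using t0 by auto
    have "x \<notin> ?Z" using t(2)[of x] x(1) by auto
    then have "norm (v x - v 0) < V / 2" using x(1) t(1) by auto
    then have vx: "norm (v x) \<le> 3 / 2 * V"
      using norm_triangle_sub[of "v x" "v 0"] by (simp add: V_def)
    have "norm (a x) \<le> K * norm (v x) * norm (v x)" by (rule a) (use x(1) t(1) s in auto)
    also have "\<dots> \<le> K * (3 / 2 * V) * (3 / 2 * V)"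
      using vx K(1) V0 by (intro mult_mono) auto
    finally have "norm (v t - v 0) \<le> t * (K * (3 / 2 * V) * (3 / 2 * V))"
      using x(2) t0 by (meson less_imp_le mult_left_mono order_trans)
    also have "\<dots> = (9 / 4) * K * (t * V) * V" by simp
    also have "\<dots> \<le> (9 / 4) * K * T * V"
    proof -
      have "t * V \<le> s * V" using t(1) V0 by simp
      then have "t * V \<le> T" using s(2) by linarith
      then show ?thesis using K(1) V0 by (intro mult_right_mono mult_left_mono) auto
    qed
    \<comment> \<open>The squared factor \<open>3/2\<close> gave \<open>9/4\<close>, and
      \<open>9 K T \<le> 1\<close> reduces the deviation to \<open>V / 4\<close>, short of the
      required \<open>V / 2\<close>.\<close>
    also have "\<dots> \<le> 1 / 4 * V" using K(2) V0 by (intro mult_right_mono) auto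
    finally show False using t(1) V0 by auto
  qed
  show bV: "b * norm (v 0) \<le> T"
  proof (rule ccontr)
    assume "\<not> b * norm (v 0) \<le> T"
    then have far: "T < b * V" by (simp add: V_def)
    \<comment> \<open>The time in which uniform motion with the initial velocity covers the length
      \<open>T\<close>.\<close>
    define s where "s = T / V"
    have s: "0 < s" "s < b" "s * V = T" using far V0 K(3) by (auto simp: s_def field_simps)
    let ?g = "\<lambda>t. c t - t *\<^sub>R v 0"
    have "norm (?g s - ?g 0) \<le> (V / 2) * norm (s - 0)"
    proof (rule differentiable_bound[of "{0..s}"])
      fix x assume x: "x \<in> {0..s}"
      have "(c has_vector_derivative v x) (at x within {0..s})"
        by (rule has_vector_derivative_within_subset[OF c]) (use x s in auto)
      then have "(?g has_vector_derivative (v x - 1 *\<^sub>R v 0)) (at x within {0..s})"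
        by (intro has_vector_derivative_diff) (auto intro!: derivative_eq_intros simp: has_vector_derivative_def)
      then show "(?g has_derivative (\<lambda>h. h *\<^sub>R (v x - v 0))) (at x within {0..s})"
        by (simp add: has_vector_derivative_def)
      have "x * V \<le> T" using x V0 s(3) by (auto simp: s_def field_simps)
      then have "norm (v x - v 0) \<le> V / 2" by (intro close) (use x s in auto)
      then have "norm (h *\<^sub>R (v x - v 0)) \<le> V / 2 * norm h" for h :: real
        using mult_right_mono[of "norm (v x - v 0)" "V / 2" "\<bar>h\<bar>"] by (simp add: mult.commute)
      then show "onorm (\<lambda>h. h *\<^sub>R (v x - v 0)) \<le> V / 2"
        by (intro onorm_bound) (use V0 in auto)
    qed (use s in auto)
    then have "norm ((c s - c 0) - s *\<^sub>R v 0) \<le> T / 2"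
      using s by (simp add: algebra_simps)
    moreover have "norm (s *\<^sub>R v 0) = T" using s by (simp add: V_def)
    moreover have "norm (s *\<^sub>R v 0) \<le> norm (c s - c 0) + norm ((c s - c 0) - s *\<^sub>R v 0)"
      by (metis norm_minus_commute norm_triangle_sub)
    ultimately have "T / 2 \<le> norm (c s - c 0)" by linarith
    with small[of s] s show False by simp
  qed
  show "norm (v s) \<le> 2 * norm (v 0)" if s: "s \<in> {0..<b}"
  proof -
    have "s * V \<le> b * V" using s V0 by simp
    then have "s * V \<le> T" using bV by (simp add: V_def)
    from close[OF s this] have "norm (v s - v 0) \<le> V / 2" .
    then show ?thesis using norm_triangle_sub[of "v s" "v 0"] V0 unfolding V_def by linarith
  qed
qed

section \<open>Hypersurfaces as graphs\<close>

text \<open>An implicit function theorem in which \<open>\<psi>\<close> is the height above the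
  graph, measured along whole lines in direction \<open>n\<close>. Hence \<open>N\<close> is a
  cylinder and the shift equivariance is unrestricted, while the zero sets are compared only in a
  slab of half-width \<open>\<delta>\<close>. The last clause says that on the graph the
  differential of \<open>\<phi>\<close> is a multiple of that of \<open>\<psi>\<close>; it avoids
  the quotient of the two functions.\<close>

lemma implicit_graph:
  fixes \<phi> :: "'a::euclidean_space \<Rightarrow> real"
  assumes A: "open A" "z \<in> A" and C2: "Ck_on 2 A \<phi>" and \<phi>z: "\<phi> z = 0"
    and n: "norm n = 1" and pos: "frechet_derivative \<phi> (at z) n > 0"
  shows "\<exists>N \<delta> \<psi>. open N \<and> z \<in> N \<and> \<delta> > 0 \<and> Ck_on 2 N \<psi> \<and>
    (\<forall>x\<in>N. \<forall>s. x + s *\<^sub>R n \<in> N \<and> \<psi> (x + s *\<^sub>R n) = \<psi> x + s) \<and>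
    (\<forall>x\<in>N. \<bar>(x - z) \<bullet> n\<bar> < \<delta> \<longrightarrow> x \<in> A \<and> frechet_derivative \<phi> (at x) n > 0 \<and> (\<phi> x = 0 \<longleftrightarrow> \<psi> x = 0)) \<and>
    (\<forall>x\<in>N. \<bar>(x - \<psi> x *\<^sub>R n - z) \<bullet> n\<bar> < \<delta>) \<and>
    (\<forall>x\<in>N. \<forall>u. frechet_derivative \<phi> (at (x - \<psi> x *\<^sub>R n)) u =
      frechet_derivative \<psi> (at x) u * frechet_derivative \<phi> (at (x - \<psi> x *\<^sub>R n)) n)"
proof -
  let ?D = "\<lambda>x. frechet_derivative \<phi> (at x)"
  have nn: "n \<bullet> n = 1" using n by (simp add: dot_square_norm)
  have "open (A \<inter> (\<lambda>x. ?D x n) -` {0<..})"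
    by (rule continuous_open_preimage[OF Ck_on_imp_continuous_on[OF Ck_on_2_has_derivative(3)[OF C2 A(2)]] A(1) open_greaterThan])
  moreover have "z \<in> A \<inter> (\<lambda>x. ?D x n) -` {0<..}" using A pos by simp
  ultimately obtain \<rho> where \<rho>: "\<rho> > 0" "ball z \<rho> \<subseteq> A \<inter> (\<lambda>x. ?D x n) -` {0<..}"
    using open_contains_ball by blast
  have in_A: "x \<in> A" and Dpos: "?D x n > 0" if "x \<in> ball z \<rho>" for x using \<rho>(2) that by auto
  note d\<phi> = Ck_on_2_has_derivative(1)[OF C2 in_A]
  define \<delta> where "\<delta> = \<rho> / 2"
  have \<delta>: "\<delta> > 0" using \<rho> by (simp add: \<delta>_def)
  have box: "y + s *\<^sub>R n \<in> ball z \<rho>" if "norm (y - z) < \<delta>" "\<bar>s\<bar> \<le> \<delta>" for y s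
  proof -
    have "norm (y + s *\<^sub>R n - z) \<le> norm (y - z) + norm (s *\<^sub>R n)"
      using norm_triangle_ineq[of "y - z" "s *\<^sub>R n"] by (simp add: algebra_simps)
    then show ?thesis using that n by (simp add: dist_norm norm_minus_commute \<delta>_def)
  qed
  have line: "((\<lambda>s. \<phi> (y + s *\<^sub>R n)) has_real_derivative ?D (y + s *\<^sub>R n) n) (at s)"
    if "norm (y - z) < \<delta>" "\<bar>s\<bar> \<le> \<delta>" for y s
    unfolding has_real_derivative_iff_has_vector_derivative
    by (rule has_vector_derivative_compose_field[where c = "\<lambda>s. y + s *\<^sub>R n", OF d\<phi>[OF box[OF that]]])
      (auto intro!: derivative_eq_intros)
  have mono: "\<phi> (y + s *\<^sub>R n) < \<phi> (y + t *\<^sub>R n)" if "norm (y - z) < \<delta>" "- \<delta> \<le> s" "s < t" "t \<le> \<delta>" for y s t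
  proof (rule DERIV_pos_imp_increasing[OF that(3)])
    fix x assume "s \<le> x" "x \<le> t"
    then have "\<bar>x\<bar> \<le> \<delta>" using that by simp
    then show "\<exists>y'. ((\<lambda>s. \<phi> (y + s *\<^sub>R n)) has_real_derivative y') (at x) \<and> 0 < y'"
      using line[OF that(1)] Dpos[OF box[OF that(1)]] by blast
  qed
  have z0: "norm (z - z) < \<delta>" using \<delta> by simp
  have zneg: "\<phi> (z + (- \<delta>) *\<^sub>R n) < 0" using mono[OF z0, of "- \<delta>" 0] \<delta> \<phi>z by simp
  have zpos: "\<phi> (z + \<delta> *\<^sub>R n) > 0" using mono[OF z0, of 0 \<delta>] \<delta> \<phi>z by simp
  have cont_\<phi>: "continuous (at p) \<phi>" if "p \<in> ball z \<rho>" for p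
    by (rule has_derivative_continuous[OF d\<phi>[OF that]])
  have cont_shift: "continuous (at y) (\<lambda>y. \<phi> (y + s *\<^sub>R n))" if "norm (y - z) < \<delta>" "\<bar>s\<bar> \<le> \<delta>" for y s
    by (rule isCont_o2[where f = "\<lambda>y. y + s *\<^sub>R n", OF _ cont_\<phi>[OF box[OF that]]])
      (intro continuous_intros)
  obtain r1 where r1: "r1 > 0" "\<And>y. dist y z < r1 \<Longrightarrow> \<phi> (y + (- \<delta>) *\<^sub>R n) < 0"
    using continuous_within_openD[OF cont_shift[OF z0, of "- \<delta>"] open_lessThan[of 0]] zneg \<delta> by auto
  obtain r2 where r2: "r2 > 0" "\<And>y. dist y z < r2 \<Longrightarrow> \<phi> (y + \<delta> *\<^sub>R n) > 0"
    using continuous_within_openD[OF cont_shift[OF z0, of \<delta>] open_greaterThan[of 0]] zpos \<delta> by auto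
  define r where "r = min \<delta> (min r1 r2)"
  have r: "r > 0" using \<delta> r1 r2 by (simp add: r_def)
  \<comment> \<open>Orthogonal projection to the hyperplane through \<open>z\<close> normal to
    \<open>n\<close>; \<open>N\<close> will be the cylinder over a disc in it.\<close>
  define P where "P x = z + ((x - z) - ((x - z) \<bullet> n) *\<^sub>R n)" for x
  define N where "N = {x. norm (P x - z) < r}"
  have Pz: "P z = z" by (simp add: P_def)
  have P_shift: "P (x + s *\<^sub>R n) = P x" for x s
    by (simp add: P_def inner_add_left inner_diff_left nn algebra_simps)
  have P_dec: "x = P x + ((x - z) \<bullet> n) *\<^sub>R n" for x by (simp add: P_def)
  have Pn: "(P x - z) \<bullet> n = 0" for x by (simp add: P_def inner_diff_left nn)
  have contP: "continuous_on UNIV P" unfolding P_def by (intro continuous_intros)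
  have N: "open N" unfolding N_def by (intro open_Collect_less continuous_intros contP)
  have zN: "z \<in> N" using r by (simp add: N_def Pz)
  have N\<delta>: "norm (P x - z) < \<delta>" if "x \<in> N" for x using that by (simp add: N_def r_def)
  have ex: "\<exists>s. \<bar>s\<bar> < \<delta> \<and> \<phi> (P x + s *\<^sub>R n) = 0" if x: "x \<in> N" for x
  proof -
    have "dist (P x) z < r1" "dist (P x) z < r2" using x by (simp_all add: N_def r_def dist_norm)
    then have e: "\<phi> (P x + (- \<delta>) *\<^sub>R n) < 0" "\<phi> (P x + \<delta> *\<^sub>R n) > 0" using r1(2) r2(2) by blast+
    have "\<exists>s. - \<delta> \<le> s \<and> s \<le> \<delta> \<and> \<phi> (P x + s *\<^sub>R n) = 0"
    proof (rule IVT)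
      show "\<forall>s. - \<delta> \<le> s \<and> s \<le> \<delta> \<longrightarrow> isCont (\<lambda>s. \<phi> (P x + s *\<^sub>R n)) s"
        using DERIV_isCont[OF line[OF N\<delta>[OF x]]] by auto
    qed (use e \<delta> in auto)
    then obtain s where s: "- \<delta> \<le> s" "s \<le> \<delta>" "\<phi> (P x + s *\<^sub>R n) = 0" by blast
    then have "s \<noteq> \<delta>" "s \<noteq> - \<delta>" using e by auto
    then show ?thesis using s by (intro exI[of _ s]) auto
  qed
  \<comment> \<open>The choice depends on \<open>x\<close> only through \<open>P x\<close>, so
    \<open>h\<close> is constant along \<open>n\<close>; this is the source of the shift
    equivariance of \<open>\<psi>\<close>.\<close>
  define h where "h x = (SOME s. \<bar>s\<bar> < \<delta> \<and> \<phi> (P x + s *\<^sub>R n) = 0)" for x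
  have h: "\<bar>h x\<bar> < \<delta>" "\<phi> (P x + h x *\<^sub>R n) = 0" if "x \<in> N" for x
    using someI_ex[OF ex[OF that]] unfolding h_def by blast+
  have h_unique: "s = h x" if "x \<in> N" "\<bar>s\<bar> < \<delta>" "\<phi> (P x + s *\<^sub>R n) = 0" for s x
    using mono[OF N\<delta>[OF that(1)], of s "h x"] mono[OF N\<delta>[OF that(1)], of "h x" s] h[OF that(1)] that(2,3)
    by (cases s "h x" rule: linorder_cases) (auto simp: abs_less_iff)
  define \<psi> where "\<psi> x = (x - z) \<bullet> n - h x" for x
  define \<pi> where "\<pi> x = x - \<psi> x *\<^sub>R n" for x
  have \<pi>_eq: "\<pi> x = P x + h x *\<^sub>R n" for x
    using P_dec[of x] by (simp add: \<pi>_def \<psi>_def algebra_simps)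
  have \<pi>_in: "\<pi> x \<in> ball z \<rho>" if "x \<in> N" for x
    unfolding \<pi>_eq using h(1)[OF that] by (intro box N\<delta>[OF that]) simp
  have \<phi>\<pi>: "\<phi> (\<pi> x) = 0" if "x \<in> N" for x using h(2)[OF that] by (simp add: \<pi>_eq)
  have cont_h: "\<exists>d>0. \<forall>x. dist x x0 < d \<longrightarrow> x \<in> N \<and> \<bar>h x - h x0\<bar> < e" if x0: "x0 \<in> N" and e: "e > 0" for x0 e
  proof -
    \<comment> \<open>Small enough that the heights \<open>h x0 - e'\<close> and
      \<open>h x0 + e'\<close> remain admissible. There \<open>\<phi>\<close> has strict and
      opposite signs, which persist for nearby \<open>x\<close> and trap \<open>h x\<close> in
      between.\<close>
    define e' where "e' = min (e / 2) ((\<delta> - \<bar>h x0\<bar>) / 2)"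
    have e': "e' > 0" "e' < e" "\<bar>h x0 + e'\<bar> \<le> \<delta>" "\<bar>h x0 - e'\<bar> \<le> \<delta>"
      using e h(1)[OF x0] by (auto simp: e'_def min_def abs_if field_simps)
    have neg: "\<phi> (P x0 + (h x0 - e') *\<^sub>R n) < 0"
      using mono[OF N\<delta>[OF x0], of "h x0 - e'" "h x0"] h[OF x0] e' by auto
    have pos: "\<phi> (P x0 + (h x0 + e') *\<^sub>R n) > 0"
      using mono[OF N\<delta>[OF x0], of "h x0" "h x0 + e'"] h[OF x0] e' by auto
    have contP': "continuous (at x0) P" using contP by (simp add: continuous_on_eq_continuous_at)
    have c: "continuous (at x0) (\<lambda>x. \<phi> (P x + s *\<^sub>R n))" if "\<bar>s\<bar> \<le> \<delta>" for s
      by (rule isCont_o2[where f = P, OF contP' cont_shift[OF N\<delta>[OF x0] that]])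
    obtain d1 where d1: "d1 > 0" "\<And>x. dist x x0 < d1 \<Longrightarrow> \<phi> (P x + (h x0 - e') *\<^sub>R n) < 0"
      using continuous_within_openD[OF c[OF e'(4)] open_lessThan[of 0]] neg by auto
    obtain d2 where d2: "d2 > 0" "\<And>x. dist x x0 < d2 \<Longrightarrow> \<phi> (P x + (h x0 + e') *\<^sub>R n) > 0"
      using continuous_within_openD[OF c[OF e'(3)] open_greaterThan[of 0]] pos by auto
    obtain d3 where d3: "d3 > 0" "ball x0 d3 \<subseteq> N" using N x0 open_contains_ball by blast
    have "x \<in> N \<and> \<bar>h x - h x0\<bar> < e" if x: "dist x x0 < min d1 (min d2 d3)" for x
    proof
      show xN: "x \<in> N" using x d3(2) by (auto simp: dist_commute)
      have 1: "\<phi> (P x + (h x0 - e') *\<^sub>R n) < 0" and 2: "\<phi> (P x + (h x0 + e') *\<^sub>R n) > 0"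
        using d1(2) d2(2) x by auto
      have "h x > h x0 - e'"
      proof (rule ccontr)
        assume "\<not> h x > h x0 - e'"
        then have "h x < h x0 - e' \<or> h x = h x0 - e'" by auto
        then have "\<phi> (P x + h x *\<^sub>R n) \<le> \<phi> (P x + (h x0 - e') *\<^sub>R n)"
          using mono[OF N\<delta>[OF xN], of "h x" "h x0 - e'"] h(1)[OF xN] e'(4)
          unfolding abs_le_iff abs_less_iff by fastforce
        then show False using 1 h(2)[OF xN] by linarith
      qed
      moreover have "h x < h x0 + e'"
      proof (rule ccontr)
        assume "\<not> h x < h x0 + e'"
        then have "h x0 + e' < h x \<or> h x = h x0 + e'" by auto
        then have "\<phi> (P x + (h x0 + e') *\<^sub>R n) \<le> \<phi> (P x + h x *\<^sub>R n)"
          using mono[OF N\<delta>[OF xN], of "h x0 + e'" "h x"] h(1)[OF xN] e'(3)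
          unfolding abs_le_iff abs_less_iff by fastforce
        then show False using 2 h(2)[OF xN] by linarith
      qed
      ultimately show "\<bar>h x - h x0\<bar> < e" using e'(2) by linarith
    qed
    then show ?thesis using d1 d2 d3 by (intro exI[of _ "min d1 (min d2 d3)"]) auto
  qed
  have "continuous_on N h"
    unfolding continuous_on_iff
  proof (intro ballI allI impI)
    fix x0 and e :: real assume "x0 \<in> N" "0 < e"
    from cont_h[OF this] show "\<exists>d>0. \<forall>x\<in>N. dist x x0 < d \<longrightarrow> dist (h x) (h x0) < e"
      by (auto simp: dist_real_def)
  qed
  then have cont_\<psi>: "continuous_on N \<psi>" unfolding \<psi>_def[abs_def] by (intro continuous_intros)
  then have cont_\<pi>: "continuous_on N \<pi>" unfolding \<pi>_def[abs_def] by (intro continuous_intros)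
  have d\<psi>: "(\<psi> has_derivative (\<lambda>u. ?D (\<pi> x0) u * inverse (?D (\<pi> x0) n))) (at x0)" if x0: "x0 \<in> N" for x0
  proof -
    define p0 where "p0 = \<pi> x0"
    define l where "l = ?D p0 n"
    define L where "L u = ?D p0 u * inverse l" for u
    have l: "l > 0" unfolding l_def p0_def by (rule Dpos[OF \<pi>_in[OF x0]])
    have dp0: "(\<phi> has_derivative ?D p0) (at p0)" unfolding p0_def by (rule d\<phi>[OF \<pi>_in[OF x0]])
    have L: "bounded_linear L"
      unfolding L_def by (intro bounded_linear_mult_const has_derivative_bounded_linear[OF dp0])
    obtain B where B: "B > 0" "\<And>u. norm (L u) \<le> norm u * B"
      using bounded_linear.pos_bounded[OF L] by blast
    have lin: "?D p0 (u - s *\<^sub>R n) = ?D p0 u - s * l" for u s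
      using has_derivative_linear[OF dp0] by (simp add: linear_diff linear_scale l_def)
    have "\<exists>d>0. \<forall>x. norm (x - x0) < d \<longrightarrow> norm (\<psi> x - \<psi> x0 - L (x - x0)) \<le> e * norm (x - x0)" if e: "e > 0" for e
    proof -
      \<comment> \<open>The bound 1/2 lets the increment \<open>\<Delta>\<close> of
        \<open>\<psi>\<close> be absorbed, giving
        \<open>\<bar>\<Delta>\<bar> \<le> (2 B + 1) * norm w\<close>; the other bound then makes the
        error at most \<open>e * norm w\<close>.\<close>
      define \<theta> where "\<theta> = min (1/2) (e / (2 * B + 2))"
      have \<theta>: "\<theta> > 0" "\<theta> \<le> 1/2" "\<theta> * (2 * B + 2) \<le> e"
      proof -
        show "\<theta> > 0" using e B by (simp add: \<theta>_def)
        show "\<theta> \<le> 1/2" unfolding \<theta>_def by (rule min.cobounded1)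
        have "\<theta> * (2 * B + 2) \<le> e / (2 * B + 2) * (2 * B + 2)"
          using B by (intro mult_right_mono) (simp_all add: \<theta>_def)
        then show "\<theta> * (2 * B + 2) \<le> e" using B by simp
      qed
      obtain d1 where d1: "d1 > 0" "\<And>p. norm (p - p0) < d1 \<Longrightarrow> norm (\<phi> p - \<phi> p0 - ?D p0 (p - p0)) \<le> (\<theta> * l) * norm (p - p0)"
        using dp0 mult_pos_pos[OF \<theta>(1) l] unfolding has_derivative_at_alt by blast
      have "continuous (at x0 within N) \<pi>" using cont_\<pi> x0 by (simp add: continuous_on_eq_continuous_within)
      from continuous_within_openD[OF this open_ball[of p0 d1]]
      obtain d2 where d2: "d2 > 0" "\<And>x. x \<in> N \<Longrightarrow> dist x x0 < d2 \<Longrightarrow> \<pi> x \<in> ball p0 d1"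
        using d1(1) by (auto simp: p0_def)
      obtain d3 where d3: "d3 > 0" "ball x0 d3 \<subseteq> N" using N x0 open_contains_ball by blast
      have "norm (\<psi> x - \<psi> x0 - L (x - x0)) \<le> e * norm (x - x0)" if x: "norm (x - x0) < min d2 d3" for x
      proof -
        have xN: "x \<in> N" using x d3(2) by (auto simp: dist_norm norm_minus_commute)
        define w where "w = x - x0"
        define \<Delta> where "\<Delta> = \<psi> x - \<psi> x0"
        have v: "\<pi> x - p0 = w - \<Delta> *\<^sub>R n" by (simp add: \<pi>_def p0_def w_def \<Delta>_def algebra_simps)
        have "norm (\<pi> x - p0) < d1" using d2(2)[OF xN] x by (simp add: dist_norm norm_minus_commute)
        \<comment> \<open>Both points are zeros of \<open>\<phi>\<close>, so the linear part of
          \<open>\<phi>\<close> between them is itself an error term. Up to the factor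
          \<open>l\<close> it is the quantity \<open>L w - \<Delta>\<close> to be estimated.\<close>
        from d1(2)[OF this] have "norm (?D p0 (\<pi> x - p0)) \<le> (\<theta> * l) * norm (\<pi> x - p0)"
          using \<phi>\<pi>[OF xN] \<phi>\<pi>[OF x0] by (simp add: p0_def)
        moreover have "?D p0 (\<pi> x - p0) = l * (L w - \<Delta>)"
          unfolding v lin L_def using l by (simp add: field_simps)
        ultimately have "l * \<bar>L w - \<Delta>\<bar> \<le> l * (\<theta> * norm (w - \<Delta> *\<^sub>R n))"
          using l by (simp add: v abs_mult mult_ac)
        then have 1: "\<bar>L w - \<Delta>\<bar> \<le> \<theta> * norm (w - \<Delta> *\<^sub>R n)" using l by simp
        have 2: "norm (w - \<Delta> *\<^sub>R n) \<le> norm w + \<bar>\<Delta>\<bar>" using norm_triangle_ineq4[of w "\<Delta> *\<^sub>R n"] n by simp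
        have "\<theta> * norm (w - \<Delta> *\<^sub>R n) \<le> 1/2 * (norm w + \<bar>\<Delta>\<bar>)" using \<theta> 2 by (intro mult_mono) auto
        then have "\<bar>\<Delta>\<bar> \<le> norm w * B + 1/2 * (norm w + \<bar>\<Delta>\<bar>)"
          using 1 B(2)[of w] unfolding real_norm_def by linarith
        moreover have "d \<le> 2 * a + b" if "d \<le> a + 1/2 * (b + d)" for a b d :: real
          using that by (simp add: field_simps)
        ultimately have "\<bar>\<Delta>\<bar> \<le> 2 * (norm w * B) + norm w" by blast
        then have 3: "\<bar>\<Delta>\<bar> \<le> (2 * B + 1) * norm w" by (simp add: algebra_simps)
        have "\<bar>L w - \<Delta>\<bar> \<le> \<theta> * ((2 * B + 2) * norm w)"
          using 2 3 \<theta>(1) by (intro order_trans[OF 1] mult_left_mono) (auto simp: algebra_simps)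
        also have "\<dots> = (\<theta> * (2 * B + 2)) * norm w" by simp
        also have "\<dots> \<le> e * norm w" by (rule mult_right_mono[OF \<theta>(3)]) simp
        finally show ?thesis by (simp add: w_def \<Delta>_def abs_minus_commute)
      qed
      then show ?thesis using d2(1) d3(1) by (intro exI[of _ "min d2 d3"]) auto
    qed
    then have "(\<psi> has_derivative L) (at x0)" unfolding has_derivative_at_alt using L by blast
    then show ?thesis unfolding L_def l_def p0_def .
  qed
  have C1D: "Ck_on 1 (ball z \<rho>) (\<lambda>p. ?D p u)" for u
    by (rule Ck_on_subset[OF Ck_on_2_has_derivative(3)[OF C2 A(2)]]) (use in_A in blast)
  have \<pi>N: "\<pi> ` N \<subseteq> ball z \<rho>" using \<pi>_in by blast
  \<comment> \<open>Regularity is gained in steps: continuity of \<open>\<pi>\<close> makes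
    \<open>\<psi>\<close> of class C^1, hence \<open>\<pi>\<close> too, and then the formula for the
    derivative makes \<open>\<psi>\<close> of class C^2.\<close>
  have "Ck_on (Suc 0) N \<psi>"
  proof (rule Ck_on_SucI[OF N d\<psi>])
    have "continuous_on N (\<lambda>x. ?D (\<pi> x) u)" for u
      by (rule continuous_on_compose2[OF Ck_on_imp_continuous_on[OF C1D] cont_\<pi> \<pi>N])
    then show "Ck_on 0 N (\<lambda>x. ?D (\<pi> x) u * inverse (?D (\<pi> x) n))" for u
      using Dpos[OF \<pi>_in] by (auto intro!: continuous_intros simp: less_imp_neq[symmetric])
  qed
  then have "Ck_on 1 N \<psi>" by simp
  then have "Ck_on 1 N \<pi>"
    unfolding \<pi>_def[abs_def] by (intro Ck_on_diff Ck_on_scaleR Ck_on_id Ck_on_const N)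
  then have C1: "Ck_on 1 N (\<lambda>x. ?D (\<pi> x) u)" for u
    by (rule Ck_on_compose[OF N open_ball _ C1D \<pi>N])
  have "Ck_on (Suc 1) N \<psi>"
  proof (rule Ck_on_SucI[OF N d\<psi>])
    show "Ck_on 1 N (\<lambda>x. ?D (\<pi> x) u * inverse (?D (\<pi> x) n))" for u
      by (intro Ck_on_mult Ck_on_inverse C1 N) (use Dpos[OF \<pi>_in] in fastforce)
  qed
  then have f0: "Ck_on 2 N \<psi>" by (simp only: Suc_1)
  have "x + s *\<^sub>R n \<in> N \<and> \<psi> (x + s *\<^sub>R n) = \<psi> x + s" if "x \<in> N" for x s
    using that P_shift by (simp add: N_def \<psi>_def h_def inner_add_left inner_diff_left nn algebra_simps)
  then have f1: "\<forall>x\<in>N. \<forall>s. x + s *\<^sub>R n \<in> N \<and> \<psi> (x + s *\<^sub>R n) = \<psi> x + s" by blast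
  have "x \<in> A \<and> ?D x n > 0 \<and> (\<phi> x = 0 \<longleftrightarrow> \<psi> x = 0)" if x: "x \<in> N" "\<bar>(x - z) \<bullet> n\<bar> < \<delta>" for x
  proof -
    have e: "P x + ((x - z) \<bullet> n) *\<^sub>R n = x" by (rule P_dec[symmetric])
    have "x \<in> ball z \<rho>"
      using box[OF N\<delta>[OF x(1)], of "(x - z) \<bullet> n", unfolded e] x(2) by linarith
    moreover have "\<phi> x = 0 \<longleftrightarrow> \<psi> x = 0"
    proof
      assume "\<phi> x = 0"
      then show "\<psi> x = 0" using h_unique[OF x, unfolded e] by (simp add: \<psi>_def)
    next
      assume "\<psi> x = 0"
      then have "h x = (x - z) \<bullet> n" by (simp add: \<psi>_def)
      then show "\<phi> x = 0" using h(2)[OF x(1)] e by simp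
    qed
    ultimately show ?thesis using in_A Dpos by blast
  qed
  then have f2: "\<forall>x\<in>N. \<bar>(x - z) \<bullet> n\<bar> < \<delta> \<longrightarrow> x \<in> A \<and> ?D x n > 0 \<and> (\<phi> x = 0 \<longleftrightarrow> \<psi> x = 0)" by blast
  have "\<bar>(x - \<psi> x *\<^sub>R n - z) \<bullet> n\<bar> < \<delta>" if "x \<in> N" for x
    using h(1)[OF that] by (simp add: \<psi>_def inner_diff_left nn)
  then have f3: "\<forall>x\<in>N. \<bar>(x - \<psi> x *\<^sub>R n - z) \<bullet> n\<bar> < \<delta>" by blast
  have "?D (x - \<psi> x *\<^sub>R n) u = frechet_derivative \<psi> (at x) u * ?D (x - \<psi> x *\<^sub>R n) n" if x: "x \<in> N" for x u
    using Dpos[OF \<pi>_in[OF x]] fun_cong[OF frechet_derivative_at[OF d\<psi>[OF x]], of u, symmetric]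
    by (simp add: \<pi>_def)
  then have f4: "\<forall>x\<in>N. \<forall>u. ?D (x - \<psi> x *\<^sub>R n) u = frechet_derivative \<psi> (at x) u * ?D (x - \<psi> x *\<^sub>R n) n"
    by blast
  show ?thesis
    by (intro exI[of _ N] exI[of _ \<delta>] exI[of _ \<psi>] conjI N zN \<delta> f0 f1 f2 f3 f4)
qed

section \<open>The Hessian near a light-convex hypersurface\<close>

text \<open>Here \<open>a\<close> stands for \<open>g(u, u)\<close>, and \<open>\<sigma>\<close> is
  the multiple of the time direction that makes \<open>u\<close> null. The root that is small with
  \<open>a\<close> is written in rationalised form \<open>e a / (S - e b)\<close>; the sign
  \<open>e\<close> is opposite to that of \<open>b\<close>, so nothing cancels in the
  denominator.\<close>

lemma null_correction:
  fixes a b d m :: real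
  assumes "d > 0" "m > 0" "m * m \<le> b * b + a * d"
  shows "\<exists>\<sigma>. a + 2 * b * \<sigma> - d * \<sigma> * \<sigma> = 0 \<and> \<bar>\<sigma>\<bar> \<le> \<bar>a\<bar> / m"
proof -
  define S where "S = sqrt (b * b + a * d)"
  have disc: "b * b + a * d \<ge> 0" using assms by (smt (verit) mult_nonneg_nonneg)
  have SS: "S * S = b * b + a * d" using disc by (simp add: S_def)
  have Sm: "m \<le> S" unfolding S_def using assms(2,3) by (intro real_le_rsqrt) (simp add: power2_eq_square)
  have key: "a + 2 * b * (e * a / (S - e * b)) - d * (e * a / (S - e * b)) * (e * a / (S - e * b)) = 0"
    if e: "e * e = 1" "S - e * b > 0" for e
  proof -
    define k where "k = S - e * b"
    define x where "x = e * a / k"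
    have k: "k > 0" using e(2) by (simp add: k_def)
    have xk: "x * k = e * a" using k by (simp add: x_def)
    have "(a + 2 * b * x - d * x * x) * (k * k) = a * (k * k) + 2 * b * (x * k) * k - d * (x * k) * (x * k)"
      by (simp add: algebra_simps)
    also have "\<dots> = a * (S * S + (e * e) * (b * b) - 2 * (e * e) * (b * b) - d * (e * e) * a)"
      unfolding xk by (simp add: k_def algebra_simps)
    also have "\<dots> = 0" unfolding e(1) SS by (simp add: algebra_simps)
    finally show ?thesis using k by (simp add: x_def k_def)
  qed
  have bound: "\<bar>e * a / (S - e * b)\<bar> \<le> \<bar>a\<bar> / m" if e: "\<bar>e\<bar> = 1" "e * b \<le> 0" for e
  proof -
    have "m \<le> S - e * b" using Sm e(2) by linarith
    then show ?thesis using assms(2) e(1) by (simp add: abs_mult frac_le)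
  qed
  define e :: real where "e = (if b \<ge> 0 then -1 else 1)"
  have e: "e * e = 1" "\<bar>e\<bar> = 1" "e * b \<le> 0" by (auto simp: e_def)
  have "S - e * b > 0" using Sm assms(2) e(3) by linarith
  then show ?thesis using key[OF e(1)] bound[OF e(2,3)] by blast
qed

lemma shift_invariant_derivative:
  assumes N: "open N" "x \<in> N" and sh: "\<And>y. y \<in> N \<Longrightarrow> f (y + w) = f y + k"
    and d: "(f has_derivative f') (at (x + w))"
  shows "(f has_derivative f') (at x)"
proof -
  have "((\<lambda>y. y + w) has_derivative (\<lambda>h. h)) (at x)" by (auto intro!: derivative_eq_intros)
  from has_derivative_compose[OF this d] have "((\<lambda>y. f (y + w)) has_derivative f') (at x)" .
  then have "((\<lambda>y. f (y + w) - k) has_derivative f') (at x)"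
    using has_derivative_diff[OF _ has_derivative_const] by fastforce
  then show ?thesis
    by (rule has_derivative_transform_within_open[OF _ N]) (simp add: sh)
qed

text \<open>All five equations come from differentiating
  \<open>\<psi> (x + s n) = \<psi> x + s\<close>, in \<open>x\<close>, in \<open>s\<close>, or in
  both.\<close>

lemma shift_equivariant_derivatives:
  fixes \<psi> :: "'a::euclidean_space \<Rightarrow> real"
  assumes N: "open N" "x \<in> N" and C2: "Ck_on 2 N \<psi>"
    and sh: "\<And>x s. x \<in> N \<Longrightarrow> x + s *\<^sub>R n \<in> N \<and> \<psi> (x + s *\<^sub>R n) = \<psi> x + s"
  shows "frechet_derivative \<psi> (at (x + s *\<^sub>R n)) = frechet_derivative \<psi> (at x)"
    and "frechet_derivative (\<lambda>y. frechet_derivative \<psi> (at y) w) (at (x + s *\<^sub>R n)) =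
      frechet_derivative (\<lambda>y. frechet_derivative \<psi> (at y) w) (at x)"
    and "frechet_derivative \<psi> (at x) n = 1"
    and "frechet_derivative (\<lambda>y. frechet_derivative \<psi> (at y) w) (at x) n = 0"
    and "frechet_derivative (\<lambda>y. frechet_derivative \<psi> (at y) n) (at x) w = 0"
proof -
  let ?D = "\<lambda>x. frechet_derivative \<psi> (at x)"
  note d1 = Ck_on_2_has_derivative(1)[OF C2] and d2 = Ck_on_2_has_derivative(2)[OF C2]
  have D1: "?D (y + s *\<^sub>R n) = ?D y" if "y \<in> N" for y s
    using shift_invariant_derivative[OF N(1) that, of \<psi> "s *\<^sub>R n" s, OF _ d1] sh that
    by (intro frechet_derivative_at) blast
  have D1n: "?D y n = 1" if y: "y \<in> N" for y
  proof -
    have "((\<lambda>s. \<psi> (y + s *\<^sub>R n)) has_vector_derivative ?D y n) (at 0)"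
      by (rule has_vector_derivative_compose_field[where c = "\<lambda>s. y + s *\<^sub>R n"])
        (use d1[OF y] in \<open>auto intro!: derivative_eq_intros\<close>)
    moreover have "(\<lambda>s. \<psi> (y + s *\<^sub>R n)) = (\<lambda>s. \<psi> y + s)" using sh[OF y] by simp
    moreover have "((\<lambda>s. \<psi> y + s) has_vector_derivative 1) (at 0)"
      by (auto intro!: derivative_eq_intros)
    ultimately show ?thesis using vector_derivative_unique_at by metis
  qed
  show "?D (x + s *\<^sub>R n) = ?D x" by (rule D1[OF N(2)])
  show "?D x n = 1" by (rule D1n[OF N(2)])
  show "frechet_derivative (\<lambda>y. ?D y w) (at (x + s *\<^sub>R n)) = frechet_derivative (\<lambda>y. ?D y w) (at x)"
    using shift_invariant_derivative[OF N, of "\<lambda>y. ?D y w" "s *\<^sub>R n" 0, OF _ d2] sh[OF N(2)] D1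
    by (intro frechet_derivative_at) simp
  have "((\<lambda>s. ?D (x + s *\<^sub>R n) w) has_vector_derivative frechet_derivative (\<lambda>y. ?D y w) (at x) n) (at 0)"
    by (rule has_vector_derivative_compose_field[where c = "\<lambda>s. x + s *\<^sub>R n" and f = "\<lambda>y. ?D y w"])
      (use d2[OF N(2)] in \<open>auto intro!: derivative_eq_intros\<close>)
  moreover have "(\<lambda>s. ?D (x + s *\<^sub>R n) w) = (\<lambda>s. ?D x w)" using D1[OF N(2)] by simp
  ultimately show "frechet_derivative (\<lambda>y. ?D y w) (at x) n = 0"
    using vector_derivative_unique_at has_vector_derivative_const by metis
  have "((\<lambda>y. 1) has_derivative frechet_derivative (\<lambda>y. ?D y n) (at x)) (at x)"
    by (rule has_derivative_transform_within_open[OF d2[OF N(2), of n] N]) (simp add: D1n)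
  from has_derivative_unique[OF this has_derivative_const]
  show "frechet_derivative (\<lambda>y. ?D y n) (at x) w = 0" by simp
qed

text \<open>
  Here \<open>q' = q - \<psi>(q) n\<close> lies on the hypersurface. If \<open>v\<close> is nearly tangent, it is replaced by a tangent null vector
  at \<open>q'\<close> obtained by removing its \<open>n\<close>-component and correcting its time component; otherwise
  \<open>\<bar>L v\<bar>\<close> is comparable to \<open>\<bar>v\<bar>\<close> and the bound is trivial. The second derivative \<open>B\<close> of \<open>\<psi>\<close> is the same
  at \<open>q\<close> and at \<open>q'\<close> and annihilates \<open>n\<close>, so its mere continuity suffices.
\<close>
lemma hessian_estimate_pointwise:
  fixes g g' :: "'e::euclidean_space \<times> real \<Rightarrow> 'e \<times> real \<Rightarrow> real"
    and \<Gamma> \<Gamma>' :: "'e \<times> real \<Rightarrow> 'e \<times> real \<Rightarrow> 'e \<times> real"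
    and L :: "'e \<Rightarrow> real" and B :: "'e \<Rightarrow> 'e \<Rightarrow> real"
  assumes g: "bilinear g" "\<And>v w. g v w = g w v" and g': "bilinear g'" "\<And>v w. g' v w = g' w v"
    and \<Gamma>: "bilinear \<Gamma>" and L: "linear L" and B: "bilinear B"
    and gK: "\<And>v w. \<bar>g v w\<bar> \<le> K * norm v * norm w" "\<And>v w. \<bar>g v w - g' v w\<bar> \<le> K * p * norm v * norm w"
    and c0: "c0 > 0" "\<And>y. c0 * norm y * norm y \<le> g (y, 0) (y, 0)" "c0 \<le> - g (0, 1) (0, 1)"
    and c0': "\<And>y. c0 * norm y * norm y \<le> g' (y, 0) (y, 0)" "c0 \<le> - g' (0, 1) (0, 1)"
    and \<Gamma>K: "\<And>v w. norm (\<Gamma> v w) \<le> K * norm v * norm w" "\<And>v w. norm (\<Gamma> v w - \<Gamma>' v w) \<le> K * p * norm v * norm w"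
    and LM: "\<And>u. \<bar>L u\<bar> \<le> M * norm u" "L n = 1" "norm n = 1"
    and BM: "\<And>u. \<bar>B u u\<bar> \<le> M * norm u * norm u" "\<And>w. B n w = 0" "\<And>w. B w n = 0"
    and conv: "\<And>w. w \<noteq> 0 \<Longrightarrow> g' w w = 0 \<Longrightarrow> L (fst w) = 0 \<Longrightarrow> B (fst w) (fst w) \<le> L (fst (\<Gamma>' w w))"
    and p: "0 \<le> p" "p \<le> R" and K: "K \<ge> 0" and M: "M \<ge> 0" and null: "g v v = 0"
  defines "\<kappa> \<equiv> 1 / (2 + 3 * K / c0)"
  defines "S \<equiv> 8 * K / (c0 * \<kappa>)"
  defines "W \<equiv> 2 + S * (R + 1)"
  defines "C \<equiv> M * (1 + K) * (2 / \<kappa>) + M * K * (W * W + (1 + S) * (W + 1))"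
  shows "B (fst v) (fst v) - L (fst (\<Gamma> v v)) \<le> C * p * norm v * norm v + C * \<bar>L (fst v)\<bar> * norm v"
proof -
  define y \<tau> a V where "y = fst v" "\<tau> = snd v" "a = L (fst v)" "V = norm v"
  let ?T = "(0, 1) :: 'e \<times> real"
  have v: "v = (y, 0) + \<tau> *\<^sub>R ?T" by (simp add: y_\<tau>_a_V_def prod_eq_iff)
  have Vv: "norm v = V" by (simp add: y_\<tau>_a_V_def)
  have V0: "V \<ge> 0" by (simp add: y_\<tau>_a_V_def)
  have denpos: "2 + 3 * K / c0 \<ge> 2" using K c0(1) by simp
  have \<kappa>: "\<kappa> > 0" "\<kappa> \<le> 1" using denpos by (auto simp: \<kappa>_def field_simps)
  have S: "S \<ge> 0" using K c0(1) \<kappa> by (simp add: S_def)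
  have W: "W \<ge> 2" using S p by (simp add: W_def)
  have C1: "M * (1 + K) * (2 / \<kappa>) \<ge> 0" using M K \<kappa> by simp
  have C2: "M * K * (W * W + (1 + S) * (W + 1)) \<ge> 0" using M K W S by simp
  have C: "C \<ge> 0" using C1 C2 by (simp add: C_def)
  have nT: "norm ?T = 1" and ny: "norm (u, 0::real) = norm u" for u :: 'e by (simp_all add: norm_Pair)
  have ex: "h (u + s *\<^sub>R T) (u + s *\<^sub>R T) = h u u + 2 * h u T * s - (- h T T) * s * s"
    if "bilinear h" "\<And>v w. h v w = h w v" for h :: "'e \<times> real \<Rightarrow> 'e \<times> real \<Rightarrow> real" and u s T
    using that(2)[of T u]
    by (simp add: bilinear_ladd[OF that(1)] bilinear_radd[OF that(1)] bilinear_lmul[OF that(1)]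
        bilinear_rmul[OF that(1)] algebra_simps)
  have yV: "norm y \<le> V" unfolding y_\<tau>_a_V_def using norm_fst_le[of "fst v" "snd v"] by simp
  \<comment> \<open>A null vector cannot be almost purely temporal: the null equation is a quadratic
    inequality for \<open>\<tau>\<close>, which bounds \<open>\<bar>\<tau>\<bar>\<close> by
    \<open>1 + 3 K / c0\<close> times the norm of \<open>y\<close>. This is the origin of
    \<open>\<kappa>\<close>.\<close>
  have \<kappa>V: "\<kappa> * V \<le> norm y"
  proof -
    have "0 = g (y, 0) (y, 0) + 2 * g (y, 0) ?T * \<tau> - (- g ?T ?T) * \<tau> * \<tau>"
      using ex[OF g, of "(y, 0)" \<tau> ?T] null unfolding v by simp
    then have "(- g ?T ?T) * (\<tau> * \<tau>) = g (y, 0) (y, 0) + 2 * g (y, 0) ?T * \<tau>" by (simp add: algebra_simps)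
    moreover have "c0 * (\<tau> * \<tau>) \<le> (- g ?T ?T) * (\<tau> * \<tau>)" using c0(3) by (intro mult_right_mono) auto
    moreover have "g (y, 0) (y, 0) \<le> K * norm y * norm y" using gK(1)[of "(y, 0)" "(y, 0)"] by (simp add: ny)
    moreover have "2 * g (y, 0) ?T * \<tau> \<le> 2 * (K * norm y) * \<bar>\<tau>\<bar>"
    proof -
      have "g (y, 0) ?T * \<tau> \<le> \<bar>g (y, 0) ?T\<bar> * \<bar>\<tau>\<bar>" by (metis abs_ge_self abs_mult)
      also have "\<dots> \<le> (K * norm y) * \<bar>\<tau>\<bar>"
        using gK(1)[of "(y, 0)" ?T] by (intro mult_right_mono) (simp_all add: ny nT)
      finally show ?thesis by simp
    qed
    ultimately have q: "c0 * (\<tau> * \<tau>) \<le> K * norm y * norm y + 2 * (K * norm y) * \<bar>\<tau>\<bar>" by linarith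
    have "\<bar>\<tau>\<bar> \<le> (1 + 3 * K / c0) * norm y"
    proof (cases "\<bar>\<tau>\<bar> \<le> norm y")
      case True
      have "1 * norm y \<le> (1 + 3 * K / c0) * norm y" using K c0(1) by (intro mult_right_mono) auto
      with True show ?thesis by simp
    next
      case False
      then have t: "norm y \<le> \<bar>\<tau>\<bar>" "\<bar>\<tau>\<bar> > 0" using norm_ge_zero[of y] by linarith+
      have "K * norm y * norm y \<le> K * norm y * \<bar>\<tau>\<bar>" using t(1) K by (intro mult_left_mono) auto
      then have "c0 * (\<tau> * \<tau>) \<le> 3 * K * norm y * \<bar>\<tau>\<bar>" using q by linarith
      then have "(c0 * \<bar>\<tau>\<bar>) * \<bar>\<tau>\<bar> \<le> (3 * K * norm y) * \<bar>\<tau>\<bar>" by (simp add: mult.assoc)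
      then have "c0 * \<bar>\<tau>\<bar> \<le> 3 * K * norm y" using t(2) by simp
      then have "\<bar>\<tau>\<bar> \<le> 3 * K / c0 * norm y" using c0(1) by (simp add: field_simps)
      also have "\<dots> \<le> (1 + 3 * K / c0) * norm y" by (intro mult_right_mono) auto
      finally show ?thesis .
    qed
    moreover have "V \<le> norm y + \<bar>\<tau>\<bar>"
      unfolding y_\<tau>_a_V_def using norm_Pair_le[of "fst v" "snd v"] by simp
    ultimately have "V \<le> (2 + 3 * K / c0) * norm y" by (simp add: algebra_simps)
    then show ?thesis using denpos by (simp add: \<kappa>_def field_simps)
  qed
  \<comment> \<open>The threshold is half the lower bound for the spatial part. Below it, removing
    the \<open>n\<close>-component leaves a spatial part of at least
    \<open>\<kappa> V / 2\<close>.\<close>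
  show ?thesis
  proof (cases "\<kappa> * V / 2 \<le> \<bar>a\<bar>")
    case True
    have "B y y \<le> M * V * V"
    proof -
      have "M * norm y * norm y \<le> M * V * V" using yV M V0 by (intro mult_mono) auto
      then show ?thesis using BM(1)[of y] by linarith
    qed
    moreover have "- L (fst (\<Gamma> v v)) \<le> M * (K * V * V)"
    proof -
      have "norm (fst (\<Gamma> v v)) \<le> norm (\<Gamma> v v)" using norm_fst_le[of "fst (\<Gamma> v v)" "snd (\<Gamma> v v)"] by simp
      also have "\<dots> \<le> K * V * V" using \<Gamma>K(1)[of v v] by (simp add: y_\<tau>_a_V_def)
      finally have "M * norm (fst (\<Gamma> v v)) \<le> M * (K * V * V)" using M by (rule mult_left_mono)
      then show ?thesis using LM(1)[of "fst (\<Gamma> v v)"] by linarith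
    qed
    ultimately have "B y y - L (fst (\<Gamma> v v)) \<le> M * (1 + K) * V * V" by (simp add: algebra_simps)
    also have "\<dots> \<le> M * (1 + K) * (2 / \<kappa> * \<bar>a\<bar>) * V"
    proof -
      have "V \<le> 2 / \<kappa> * \<bar>a\<bar>" using True \<kappa> by (simp add: field_simps)
      then show ?thesis using M K V0 by (intro mult_right_mono mult_left_mono) auto
    qed
    also have "\<dots> = M * (1 + K) * (2 / \<kappa>) * (\<bar>a\<bar> * V)" by simp
    also have "\<dots> \<le> C * (\<bar>a\<bar> * V)" using C2 V0 by (intro mult_right_mono) (auto simp: C_def)
    also have "\<dots> \<le> C * p * V * V + C * \<bar>a\<bar> * V" using C p V0 by simp
    finally show ?thesis by (simp add: y_\<tau>_a_V_def)
  next
    case False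
    then have a: "\<bar>a\<bar> < \<kappa> * V / 2" by simp
    have Vpos: "V > 0" using a V0 by (cases "V = 0") auto
    have "\<kappa> * V \<le> 1 * V" by (rule mult_right_mono[OF \<kappa>(2) V0])
    then have aV: "\<bar>a\<bar> \<le> V" using a V0 by linarith
    \<comment> \<open>The common size of the corrections: \<open>p V\<close> for moving the base
      point and \<open>\<bar>a\<bar>\<close> for removing the transversal component.\<close>
    define E where "E = p * V + \<bar>a\<bar>"
    have E: "E \<ge> 0" using p V0 by (simp add: E_def)
    have aE: "\<bar>a\<bar> \<le> E" using p V0 by (simp add: E_def)
    define u where "u = v - a *\<^sub>R (n, 0)"
    define \<eta> where "\<eta> = y - a *\<^sub>R n"
    have fu: "fst u = \<eta>" by (simp add: u_def \<eta>_def y_\<tau>_a_V_def)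
    have nn: "norm (a *\<^sub>R (n, 0::real)) = \<bar>a\<bar>" using LM(3) by (simp add: norm_Pair abs_mult)
    have \<eta>: "\<kappa> * V / 2 \<le> norm \<eta>"
    proof -
      have "norm y \<le> norm \<eta> + norm (a *\<^sub>R n)" using norm_triangle_ineq[of \<eta> "a *\<^sub>R n"] by (simp add: \<eta>_def)
      then show ?thesis using \<kappa>V a LM(3) by simp
    qed
    have \<eta>pos: "norm \<eta> > 0" using \<eta> mult_pos_pos[OF \<kappa>(1) Vpos] by linarith
    have uV: "norm u \<le> 2 * V"
      using norm_triangle_ineq4[of v "a *\<^sub>R (n, 0)"] aV unfolding nn u_def Vv by linarith
    have uv: "norm (u - v) = \<bar>a\<bar>" using nn unfolding u_def by (simp only: norm_minus_cancel diff_diff_eq2 minus_diff_eq add_diff_cancel_left' norm_minus_commute[of "v - _"])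
    \<comment> \<open>Since \<open>g v v = 0\<close>, only the change of the metric and the change
      of the vector contribute.\<close>
    have g'u: "\<bar>g' u u\<bar> \<le> 4 * K * V * E"
    proof -
      have "g' u u = - (g u u - g' u u) + (g (u - v) u + g v (u - v))"
        by (simp add: bilinear_lsub[OF g(1)] bilinear_rsub[OF g(1)] null)
      also have "\<bar>\<dots>\<bar> \<le> \<bar>g u u - g' u u\<bar> + (\<bar>g (u - v) u\<bar> + \<bar>g v (u - v)\<bar>)" by linarith
      also have "\<dots> \<le> K * p * (2 * V) * (2 * V) + (K * \<bar>a\<bar> * (2 * V) + K * V * \<bar>a\<bar>)"
      proof (intro add_mono)
        show "\<bar>g u u - g' u u\<bar> \<le> K * p * (2 * V) * (2 * V)"
          using uV K p V0 by (intro order_trans[OF gK(2)] mult_mono) auto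
        show "\<bar>g (u - v) u\<bar> \<le> K * \<bar>a\<bar> * (2 * V)"
          using uV K V0 uv by (intro order_trans[OF gK(1)] mult_mono) auto
        show "\<bar>g v (u - v)\<bar> \<le> K * V * \<bar>a\<bar>"
          using gK(1)[of v "u - v"] uv by (simp add: y_\<tau>_a_V_def)
      qed
      also have "\<dots> \<le> 4 * K * V * E"
        using K V0 mult_nonneg_nonneg[OF mult_nonneg_nonneg[OF K V0] abs_ge_zero[of a]]
        by (simp add: E_def algebra_simps)
      finally show ?thesis .
    qed
    define d where "d = - g' ?T ?T"
    have d: "d \<ge> c0" "d > 0" using c0'(2) c0(1) by (auto simp: d_def)
    have u_dec: "u = (\<eta>, 0) + \<tau> *\<^sub>R ?T" by (simp add: u_def \<eta>_def y_\<tau>_a_V_def prod_eq_iff)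
    \<comment> \<open>The discriminant does not change when multiples of the time direction are
      added to \<open>u\<close>, so it can be computed at \<open>(\<eta>, 0)\<close>, where
      positivity on space bounds it from below.\<close>
    have disc: "(c0 * norm \<eta>) * (c0 * norm \<eta>) \<le> g' u ?T * g' u ?T + g' u u * d"
    proof -
      have 1: "g' u u = g' (\<eta>, 0) (\<eta>, 0) + 2 * g' (\<eta>, 0) ?T * \<tau> - d * \<tau> * \<tau>"
        unfolding u_dec d_def by (rule ex[OF g'])
      have 2: "g' u ?T = g' (\<eta>, 0) ?T - \<tau> * d"
        unfolding u_dec d_def bilinear_ladd[OF g'(1)] bilinear_lmul[OF g'(1)] by simp
      have "g' u ?T * g' u ?T + g' u u * d = g' (\<eta>, 0) ?T * g' (\<eta>, 0) ?T + g' (\<eta>, 0) (\<eta>, 0) * d"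
        unfolding 1 2 by (simp add: algebra_simps)
      moreover have "(c0 * norm \<eta> * norm \<eta>) * c0 \<le> g' (\<eta>, 0) (\<eta>, 0) * d"
      proof (rule mult_mono[OF c0'(1) d(1)])
        have "0 \<le> c0 * norm \<eta> * norm \<eta>" using c0(1) by simp
        then show "0 \<le> g' (\<eta>, 0) (\<eta>, 0)" using c0'(1)[of \<eta>] by linarith
      qed (use c0(1) in simp)
      ultimately show ?thesis
        by (simp add: mult_ac add_increasing)
    qed
    obtain \<sigma> where \<sigma>: "g' u u + 2 * g' u ?T * \<sigma> - d * \<sigma> * \<sigma> = 0" "\<bar>\<sigma>\<bar> \<le> \<bar>g' u u\<bar> / (c0 * norm \<eta>)"
      using null_correction[OF d(2) mult_pos_pos[OF c0(1) \<eta>pos] disc] by blast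
    have \<sigma>S: "\<bar>\<sigma>\<bar> \<le> S * E"
    proof -
      have "\<bar>\<sigma>\<bar> \<le> (4 * K * V * E) / (c0 * (\<kappa> * V / 2))"
        using g'u \<eta> c0(1) \<kappa>(1) Vpos K E by (intro order_trans[OF \<sigma>(2)] frac_le mult_left_mono) auto
      also have "\<dots> = S * E" using Vpos c0(1) \<kappa>(1) by (simp add: S_def field_simps)
      finally show ?thesis .
    qed
    \<comment> \<open>Correcting only the time component keeps the spatial part
      \<open>\<eta>\<close>, and with it tangency.\<close>
    define w where "w = u + \<sigma> *\<^sub>R ?T"
    have fw: "fst w = \<eta>" by (simp add: w_def fu)
    have w0: "w \<noteq> 0" using fw \<eta>pos by auto
    have "g' w w = 0" using ex[OF g', of u \<sigma> ?T] \<sigma>(1) unfolding w_def d_def by linarith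
    moreover have "L (fst w) = 0"
      unfolding fw \<eta>_def using LM(2) by (simp add: linear_diff[OF L] linear_scale[OF L] y_\<tau>_a_V_def)
    ultimately have cv: "B \<eta> \<eta> \<le> L (fst (\<Gamma>' w w))" using conv[OF w0] fw by simp
    have By: "B y y = B \<eta> \<eta>"
      unfolding \<eta>_def by (simp add: bilinear_lsub[OF B] bilinear_rsub[OF B] bilinear_lmul[OF B] bilinear_rmul[OF B] BM(2,3))
    have "E \<le> (R + 1) * V" using p aV V0 mult_right_mono[OF p(2) V0] by (simp add: E_def algebra_simps)
    then have \<sigma>V: "\<bar>\<sigma>\<bar> \<le> S * (R + 1) * V"
      using order_trans[OF \<sigma>S mult_left_mono[OF _ S]] by (simp add: mult.assoc)
    have wV: "norm w \<le> W * V"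
    proof -
      have "norm w \<le> norm u + norm (\<sigma> *\<^sub>R ?T)" unfolding w_def by (rule norm_triangle_ineq)
      also have "\<dots> \<le> 2 * V + S * (R + 1) * V" using uV \<sigma>V nT by simp
      finally show ?thesis by (simp add: W_def algebra_simps)
    qed
    have wv: "norm (w - v) \<le> (1 + S) * E"
    proof -
      have "norm (w - v) \<le> norm (u - v) + norm (\<sigma> *\<^sub>R ?T)"
        using norm_triangle_ineq[of "u - v" "\<sigma> *\<^sub>R ?T"] by (simp add: w_def algebra_simps)
      also have "\<dots> \<le> E + S * E" using uv \<sigma>S nT aE by simp
      finally show ?thesis by (simp add: algebra_simps)
    qed
    have diff: "norm (\<Gamma>' w w - \<Gamma> v v) \<le> K * (W * W + (1 + S) * (W + 1)) * (V * E)"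
    proof -
      have "\<Gamma>' w w - \<Gamma> v v = - (\<Gamma> w w - \<Gamma>' w w) + (\<Gamma> (w - v) w + \<Gamma> v (w - v))"
        by (simp add: bilinear_lsub[OF \<Gamma>] bilinear_rsub[OF \<Gamma>])
      also have "norm \<dots> \<le> norm (\<Gamma> w w - \<Gamma>' w w) + (norm (\<Gamma> (w - v) w) + norm (\<Gamma> v (w - v)))"
        by (intro order_trans[OF norm_triangle_ineq] add_mono norm_triangle_ineq) (simp_all add: norm_minus_commute)
      also have "\<dots> \<le> K * p * (W * V) * (W * V) + (K * ((1 + S) * E) * (W * V) + K * V * ((1 + S) * E))"
      proof (intro add_mono)
        show "norm (\<Gamma> w w - \<Gamma>' w w) \<le> K * p * (W * V) * (W * V)"
          using wV K p V0 W by (intro order_trans[OF \<Gamma>K(2)] mult_mono) auto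
        show "norm (\<Gamma> (w - v) w) \<le> K * ((1 + S) * E) * (W * V)"
          using wV wv K V0 W S E by (intro order_trans[OF \<Gamma>K(1)] mult_mono) auto
        show "norm (\<Gamma> v (w - v)) \<le> K * V * ((1 + S) * E)"
          using wv K V0 by (intro order_trans[OF \<Gamma>K(1)] mult_mono) (auto simp: y_\<tau>_a_V_def)
      qed
      also have "K * p * (W * V) * (W * V) \<le> K * (W * W) * (V * E)"
      proof -
        have "K * p * (W * V) * (W * V) = K * (W * W) * (V * (p * V))" by simp
        also have "\<dots> \<le> K * (W * W) * (V * E)"
          using K V0 W by (intro mult_left_mono) (auto simp: E_def)
        finally show ?thesis .
      qed
      finally show ?thesis by (simp add: algebra_simps)
    qed
    have "B y y - L (fst (\<Gamma> v v)) \<le> L (fst (\<Gamma>' w w - \<Gamma> v v))"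
      using cv By by (simp add: linear_diff[OF L])
    also have "\<dots> \<le> M * norm (fst (\<Gamma>' w w - \<Gamma> v v))" using LM(1) abs_le_D1 by blast
    also have "\<dots> \<le> M * norm (\<Gamma>' w w - \<Gamma> v v)"
      by (intro mult_left_mono M) (metis norm_fst_le prod.collapse)
    also have "\<dots> \<le> M * (K * (W * W + (1 + S) * (W + 1)) * (V * E))" by (rule mult_left_mono[OF diff M])
    also have "\<dots> = (M * K * (W * W + (1 + S) * (W + 1))) * (V * E)" by simp
    also have "\<dots> \<le> C * (V * E)" using C1 V0 E by (intro mult_right_mono) (auto simp: C_def)
    also have "\<dots> = C * p * V * V + C * \<bar>a\<bar> * V" by (simp add: E_def algebra_simps)
    finally show ?thesis by (simp add: y_\<tau>_a_V_def)
  qed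
qed

section \<open>Uniform constants for tensor fields on compact sets\<close>

lemma linear_field_bounded:
  fixes F :: "'a::topological_space \<Rightarrow> 'b::euclidean_space \<Rightarrow> real"
  assumes "compact X" and lin: "\<And>x. x \<in> X \<Longrightarrow> linear (F x)"
    and cont: "\<And>b. continuous_on X (\<lambda>x. F x b)"
  shows "\<exists>M\<ge>0. \<forall>x\<in>X. \<forall>u. \<bar>F x u\<bar> \<le> M * norm u"
proof -
  have "continuous_on X (\<lambda>x. \<Sum>b\<in>Basis. \<bar>F x b\<bar>)" by (intro continuous_intros cont)
  from compact_bounded_above[OF assms(1) this]
  obtain L where L: "\<And>x. x \<in> X \<Longrightarrow> (\<Sum>b\<in>Basis. \<bar>F x b\<bar>) \<le> L" by blast
  have "\<bar>F x u\<bar> \<le> max L 0 * norm u" if x: "x \<in> X" for x u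
  proof -
    have "\<bar>F x u\<bar> = \<bar>\<Sum>b\<in>Basis. (u \<bullet> b) * F x b\<bar>" using linear_eq_sum_Basis[OF lin[OF x], of u] by simp
    also have "\<dots> \<le> (\<Sum>b\<in>Basis. \<bar>(u \<bullet> b) * F x b\<bar>)" by (rule sum_abs)
    also have "\<dots> \<le> (\<Sum>b\<in>Basis. norm u * \<bar>F x b\<bar>)"
      unfolding abs_mult by (intro sum_mono mult_right_mono) (auto simp: Basis_le_norm)
    also have "\<dots> = norm u * (\<Sum>b\<in>Basis. \<bar>F x b\<bar>)" by (simp add: sum_distrib_left)
    also have "\<dots> \<le> norm u * max L 0" using L[OF x] by (intro mult_left_mono) auto
    finally show ?thesis by (simp add: mult.commute)
  qed
  then show ?thesis by (intro exI[of _ "max L 0"]) auto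
qed

lemma bilinear_field_bounded:
  fixes B :: "'a::topological_space \<Rightarrow> 'b::euclidean_space \<Rightarrow> 'b \<Rightarrow> real"
  assumes "compact X" and bil: "\<And>x. x \<in> X \<Longrightarrow> bilinear (B x)"
    and cont: "\<And>a b. continuous_on X (\<lambda>x. B x a b)"
  shows "\<exists>M\<ge>0. \<forall>x\<in>X. \<forall>u w. \<bar>B x u w\<bar> \<le> M * norm u * norm w"
proof -
  have "continuous_on X (\<lambda>x. \<Sum>a\<in>Basis. \<Sum>b\<in>Basis. \<bar>B x a b\<bar>)" by (intro continuous_intros cont)
  from compact_bounded_above[OF assms(1) this]
  obtain L where L: "\<And>x. x \<in> X \<Longrightarrow> (\<Sum>a\<in>Basis. \<Sum>b\<in>Basis. \<bar>B x a b\<bar>) \<le> L" by blast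
  have "\<bar>B x u w\<bar> \<le> max L 0 * norm u * norm w" if x: "x \<in> X" for x u w
  proof -
    have "norm (B x u w) = norm (\<Sum>a\<in>Basis. \<Sum>b\<in>Basis. ((u \<bullet> a) * (w \<bullet> b)) *\<^sub>R B x a b)"
      using bilinear_eq_sum_Basis[OF bil[OF x], of u w] by simp
    also have "\<dots> \<le> (\<Sum>a\<in>Basis. \<Sum>b\<in>Basis. (norm u * norm w) * \<bar>B x a b\<bar>)"
    proof (intro sum_norm_le)
      fix a b :: 'b assume ab: "a \<in> Basis" "b \<in> Basis"
      have "\<bar>(u \<bullet> a) * (w \<bullet> b)\<bar> \<le> norm u * norm w"
        unfolding abs_mult by (intro mult_mono Basis_le_norm ab) auto
      from mult_right_mono[OF this abs_ge_zero[of "B x a b"]]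
      show "norm (((u \<bullet> a) * (w \<bullet> b)) *\<^sub>R B x a b) \<le> (norm u * norm w) * \<bar>B x a b\<bar>"
        by (simp add: abs_mult)
    qed
    also have "\<dots> = (norm u * norm w) * (\<Sum>a\<in>Basis. \<Sum>b\<in>Basis. \<bar>B x a b\<bar>)"
      by (simp add: sum_distrib_left)
    also have "\<dots> \<le> (norm u * norm w) * max L 0" using L[OF x] by (intro mult_left_mono) auto
    finally show ?thesis by (simp add: mult_ac)
  qed
  then show ?thesis by (intro exI[of _ "max L 0"]) auto
qed

text \<open>A minimum over the compact set times the unit sphere, extended to all vectors by
  homogeneity.\<close>

lemma positive_field_bounded_below:
  fixes B :: "'a::topological_space \<Rightarrow> 'b::euclidean_space \<Rightarrow> 'b \<Rightarrow> real"
  assumes X: "compact X" "X \<noteq> {}" and bil: "\<And>x. x \<in> X \<Longrightarrow> bilinear (B x)"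
    and cont: "\<And>a b. continuous_on X (\<lambda>x. B x a b)"
    and pos: "\<And>x y. x \<in> X \<Longrightarrow> y \<noteq> 0 \<Longrightarrow> B x y y > 0"
  shows "\<exists>c>0. \<forall>x\<in>X. \<forall>y. c * norm y * norm y \<le> B x y y"
proof -
  let ?f = "\<lambda>p. \<Sum>a\<in>Basis. \<Sum>b\<in>Basis. ((snd p \<bullet> a) * (snd p \<bullet> b)) * B (fst p) a b"
  let ?K = "X \<times> sphere (0::'b) 1"
  have eq: "?f (x, y) = B x y y" if "x \<in> X" for x y
    using bilinear_eq_sum_Basis[OF bil[OF that], of y y] by simp
  have "continuous_on ?K (\<lambda>p. B (fst p) a b)" for a b
    by (rule continuous_on_compose2[OF cont continuous_on_fst[OF continuous_on_id]]) auto
  then have f: "continuous_on ?K ?f" by (intro continuous_intros)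
  have K: "compact ?K" by (intro compact_Times X compact_sphere)
  obtain b :: 'b where "norm b = 1" using vector_choose_size[of 1] by auto
  then have "?K \<noteq> {}" using X(2) by auto
  from continuous_attains_inf[OF K this f]
  obtain p where p: "p \<in> ?K" "\<And>q. q \<in> ?K \<Longrightarrow> ?f p \<le> ?f q" by blast
  obtain x0 y0 where xy: "p = (x0, y0)" "x0 \<in> X" "norm y0 = 1" using p(1) by (cases p) auto
  have "B x0 y0 y0 > 0" by (rule pos[OF xy(2)]) (use xy(3) in auto)
  then have fp: "?f p > 0" unfolding xy(1) eq[OF xy(2)] .
  have "?f p * norm y * norm y \<le> B x y y" if x: "x \<in> X" for x y
  proof (cases "y = 0")
    case True
    then show ?thesis using bilinear_lzero[OF bil[OF x]] by simp
  next
    case False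
    let ?y = "(1 / norm y) *\<^sub>R y"
    have "?f p \<le> ?f (x, ?y)" by (rule p(2)) (use x False in simp)
    also have "\<dots> = B x ?y ?y" by (rule eq[OF x])
    also have "\<dots> = B x y y / (norm y * norm y)"
      unfolding bilinear_lmul[OF bil[OF x]] bilinear_rmul[OF bil[OF x]] by simp
    finally show ?thesis using False by (simp add: field_simps)
  qed
  with fp show ?thesis by blast
qed

text \<open>The pointwise estimate with constants uniform over a compact ball. Since
  \<open>n\<close> is a unit vector, \<open>\<bar>\<psi> (fst q)\<bar>\<close> is the distance
  between \<open>q\<close> and its projection \<open>q'\<close>, so the Lipschitz bounds for metric
  and Christoffel map supply the factor \<open>p\<close>.\<close>

lemma hessian_estimate:
  fixes A :: "('e::euclidean_space \<times> real) set" and \<psi> :: "'e \<Rightarrow> real"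
  assumes "pseudo_riemannian A G"
    and space: "\<And>q y. q \<in> A \<Longrightarrow> y \<noteq> 0 \<Longrightarrow> G q (y, 0) (y, 0) > 0"
    and time: "\<And>q. q \<in> A \<Longrightarrow> G q (0, 1) (0, 1) < 0"
    and N: "open N" "fst ` A \<subseteq> N" and C2: "Ck_on 2 N \<psi>" and n: "norm n = 1"
    and sh: "\<And>x s. x \<in> N \<Longrightarrow> x + s *\<^sub>R n \<in> N \<and> \<psi> (x + s *\<^sub>R n) = \<psi> x + s"
    and conv: "\<And>q v. q \<in> A \<Longrightarrow> \<psi> (fst q) = 0 \<Longrightarrow> v \<noteq> 0 \<Longrightarrow> G q v v = 0 \<Longrightarrow>
      frechet_derivative \<psi> (at (fst q)) (fst v) = 0 \<Longrightarrow>
      frechet_derivative (\<lambda>y. frechet_derivative \<psi> (at y) (fst v)) (at (fst q)) (fst v)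
        \<le> frechet_derivative \<psi> (at (fst q)) (fst (pseudo_riemannian.chr G q v v))"
    and z: "z \<in> A" "\<psi> (fst z) = 0"
  shows "\<exists>r>0. \<exists>C\<ge>0. cball z r \<subseteq> A \<and> (\<forall>q\<in>cball z r. \<forall>v. G q v v = 0 \<longrightarrow>
      frechet_derivative (\<lambda>y. frechet_derivative \<psi> (at y) (fst v)) (at (fst q)) (fst v)
        - frechet_derivative \<psi> (at (fst q)) (fst (pseudo_riemannian.chr G q v v))
      \<le> C * \<bar>\<psi> (fst q)\<bar> * norm v * norm v + C * \<bar>frechet_derivative \<psi> (at (fst q)) (fst v)\<bar> * norm v)"
proof -
  interpret pseudo_riemannian A G by fact
  let ?L = "\<lambda>x. frechet_derivative \<psi> (at x)"
  define B where "B x u w = frechet_derivative (\<lambda>y. frechet_derivative \<psi> (at y) w) (at x) u" for x u w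
  obtain R where R: "R > 0" "cball z R \<subseteq> A" using open_A z(1) open_contains_cball by blast
  let ?X = "cball z R"
  have X_A: "q \<in> A" if "q \<in> ?X" for q using that R(2) by blast
  have X_N: "fst q \<in> N" if "q \<in> ?X" for q using X_A[OF that] N(2) by blast
  have z_X: "z \<in> ?X" using R(1) by simp
  obtain K1 where K1: "K1 \<ge> 0" "\<And>x v w. x \<in> ?X \<Longrightarrow> norm (G x v w) \<le> K1 * norm v * norm w"
    "\<And>x y v w. x \<in> ?X \<Longrightarrow> y \<in> ?X \<Longrightarrow> norm (G x v w - G y v w) \<le> K1 * norm (x - y) * norm v * norm w"
    using G_lipschitz[OF R(2) less_imp_le[OF R(1)]] by blast
  obtain K2 where K2: "K2 \<ge> 0" "\<And>x v w. x \<in> ?X \<Longrightarrow> norm (chr x v w) \<le> K2 * norm v * norm w"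
    "\<And>x y v w. x \<in> ?X \<Longrightarrow> y \<in> ?X \<Longrightarrow> norm (chr x v w - chr y v w) \<le> K2 * norm (x - y) * norm v * norm w"
    using chr_lipschitz[OF R(2) less_imp_le[OF R(1)]] by blast
  define K where "K = K1 + K2"
  have K: "K \<ge> 0" "K1 \<le> K" "K2 \<le> K" using K1(1) K2(1) by (auto simp: K_def)
  have GK: "\<bar>G x v w\<bar> \<le> K * norm v * norm w" "norm (chr x v w) \<le> K * norm v * norm w" if "x \<in> ?X" for x v w
  proof -
    have "K1 * norm v * norm w \<le> K * norm v * norm w" "K2 * norm v * norm w \<le> K * norm v * norm w"
      using K by (auto intro!: mult_right_mono)
    then show "\<bar>G x v w\<bar> \<le> K * norm v * norm w" "norm (chr x v w) \<le> K * norm v * norm w"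
      using K1(2)[OF that, of v w] K2(2)[OF that, of v w] by auto
  qed
  have GL: "\<bar>G x v w - G y v w\<bar> \<le> K * norm (x - y) * norm v * norm w"
    "norm (chr x v w - chr y v w) \<le> K * norm (x - y) * norm v * norm w" if "x \<in> ?X" "y \<in> ?X" for x y v w
  proof -
    have "K1 * norm (x - y) * norm v * norm w \<le> K * norm (x - y) * norm v * norm w"
      "K2 * norm (x - y) * norm v * norm w \<le> K * norm (x - y) * norm v * norm w"
      using K by (auto intro!: mult_right_mono)
    then show "\<bar>G x v w - G y v w\<bar> \<le> K * norm (x - y) * norm v * norm w"
      "norm (chr x v w - chr y v w) \<le> K * norm (x - y) * norm v * norm w"
      using K1(3)[OF that, of v w] K2(3)[OF that, of v w] by auto
  qed
  have contG: "continuous_on ?X (\<lambda>q. G q v w)" for v w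
    by (rule continuous_on_subset[OF Ck_on_imp_continuous_on[OF C2_G] R(2)])
  have "bilinear (\<lambda>y y'. G q (y, 0) (y', 0))" if "q \<in> ?X" for q
  proof -
    have P: "linear (\<lambda>y::'e. (y, 0::real))" by (intro linearI) simp_all
    have "linear (\<lambda>w. G q v w)" "linear (\<lambda>v. G q v w)" for v w
      using bilinear_G[OF X_A[OF that]] unfolding bilinear_def by blast+
    from linear_compose[OF P this(1)] linear_compose[OF P this(2)] show ?thesis
      unfolding bilinear_def by (simp add: o_def)
  qed
  then obtain c1 where c1: "c1 > 0" "\<And>q y. q \<in> ?X \<Longrightarrow> c1 * norm y * norm y \<le> G q (y, 0) (y, 0)"
    using positive_field_bounded_below[OF compact_cball, of z R "\<lambda>q y y'. G q (y, 0) (y', 0)"] z_X contG space X_A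
    by blast
  obtain qm where qm: "qm \<in> ?X" "\<And>q. q \<in> ?X \<Longrightarrow> - G qm (0, 1) (0, 1) \<le> - G q (0, 1) (0, 1)"
    using continuous_attains_inf[OF compact_cball _ continuous_on_minus[OF contG]] z_X by blast
  define c0 where "c0 = min c1 (- G qm (0, 1) (0, 1))"
  have c0: "c0 > 0" using c1(1) time[OF X_A[OF qm(1)]] by (simp add: c0_def)
  have c0s: "c0 * norm y * norm y \<le> G q (y, 0) (y, 0)" if "q \<in> ?X" for q y
  proof -
    have "c0 * norm y * norm y \<le> c1 * norm y * norm y" by (intro mult_right_mono) (auto simp: c0_def)
    with c1(2)[OF that, of y] show ?thesis by linarith
  qed
  have c0t: "c0 \<le> - G q (0, 1) (0, 1)" if "q \<in> ?X" for q using qm(2)[OF that] by (simp add: c0_def)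
  have XN: "compact (fst ` ?X)" "fst ` ?X \<subseteq> N"
    by (rule compact_continuous_image[OF continuous_on_fst[OF continuous_on_id] compact_cball])
      (use X_N in blast)
  note d1 = Ck_on_2_has_derivative(1)[OF C2] and d2 = Ck_on_2_has_derivative(2)[OF C2]
  have linL: "linear (?L x)" if "x \<in> N" for x using has_derivative_linear[OF d1[OF that]] .
  have bilB: "bilinear (B x)" if "x \<in> N" for x
    using bilinear_second_derivative[OF N(1) that C2] by (simp add: B_def[abs_def])
  have contL: "continuous_on N (\<lambda>x. ?L x u)" for u
    using Ck_on_imp_continuous_on[OF Ck_on_2_has_derivative(3)[OF C2 X_N[OF z_X]]] .
  have contB: "continuous_on N (\<lambda>x. B x u w)" for u w
    using C2 by (simp add: B_def numeral_2_eq_2)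
  obtain M1 where M1: "M1 \<ge> 0" "\<And>x u. x \<in> fst ` ?X \<Longrightarrow> \<bar>?L x u\<bar> \<le> M1 * norm u"
    using linear_field_bounded[OF XN(1), of ?L] linL XN(2) continuous_on_subset[OF contL XN(2)] by blast
  obtain M2 where M2: "M2 \<ge> 0" "\<And>x u w. x \<in> fst ` ?X \<Longrightarrow> \<bar>B x u w\<bar> \<le> M2 * norm u * norm w"
    using bilinear_field_bounded[OF XN(1), of B] bilB XN(2) continuous_on_subset[OF contB XN(2)] by blast
  define M where "M = M1 + M2"
  have M: "M \<ge> 0" using M1(1) M2(1) by (simp add: M_def)
  have LM: "\<bar>?L (fst q) u\<bar> \<le> M * norm u" if "q \<in> ?X" for q u
    using M1(2)[of "fst q" u] M2(1) that by (simp add: M_def distrib_right add_increasing2)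
  have BM: "\<bar>B (fst q) u u\<bar> \<le> M * norm u * norm u" if "q \<in> ?X" for q u
    using M2(2)[of "fst q" u u] M1(1) that by (simp add: M_def algebra_simps add_increasing)
  have "continuous (at z) (\<lambda>q. \<psi> (fst q))"
    by (rule isCont_o2[where f = fst]) (use has_derivative_continuous[OF d1[OF X_N[OF z_X]]] in \<open>auto intro: continuous_intros\<close>)
  moreover have "\<psi> (fst z) \<in> ball 0 (R / 2)" using z(2) R(1) by simp
  ultimately obtain r' where r': "r' > 0" "\<And>q. dist q z < r' \<Longrightarrow> \<psi> (fst q) \<in> ball 0 (R / 2)"
    using continuous_within_openD[OF _ open_ball[of 0 "R / 2"], of z UNIV "\<lambda>q. \<psi> (fst q)"] by blast
  \<comment> \<open>Half of the radius is reserved for the passage from \<open>q\<close> to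
    \<open>q'\<close>, which must stay in the ball on which the constants are valid.\<close>
  define r where "r = min (R / 2) (r' / 2)"
  have r: "r > 0" using R(1) r'(1) by (simp add: r_def)
  define \<kappa> where "\<kappa> = 1 / (2 + 3 * K / c0)"
  define S where "S = 8 * K / (c0 * \<kappa>)"
  define W where "W = 2 + S * (R + 1)"
  define C where "C = M * (1 + K) * (2 / \<kappa>) + M * K * (W * W + (1 + S) * (W + 1))"
  have est: "B (fst q) (fst v) (fst v) - ?L (fst q) (fst (chr q v v))
      \<le> C * \<bar>\<psi> (fst q)\<bar> * norm v * norm v + C * \<bar>?L (fst q) (fst v)\<bar> * norm v"
    if q: "q \<in> cball z r" and null: "G q v v = 0" for q v
  proof -
    have qX: "q \<in> ?X" using q R(1) by (simp add: r_def)
    have xN: "fst q \<in> N" by (rule X_N[OF qX])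
    have "dist q z < r'" using q r'(1) by (simp add: r_def dist_commute)
    from r'(2)[OF this] have p: "\<bar>\<psi> (fst q)\<bar> < R / 2" by simp
    define q' where "q' = q - \<psi> (fst q) *\<^sub>R (n, 0)"
    have nq: "norm (q - q') = \<bar>\<psi> (fst q)\<bar>" using n by (simp add: q'_def norm_Pair abs_mult)
    have q'X: "q' \<in> ?X"
    proof -
      have "dist z q' \<le> dist z q + dist q q'" by (rule dist_triangle)
      also have "\<dots> \<le> R / 2 + R / 2" using q p nq by (intro add_mono) (simp_all add: r_def dist_norm)
      finally show ?thesis by simp
    qed
    have fq': "fst q' = fst q + (- \<psi> (fst q)) *\<^sub>R n" by (simp add: q'_def)
    have se: "?L (fst q + s *\<^sub>R n) = ?L (fst q)" "?L (fst q) n = 1"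
      "B (fst q + s *\<^sub>R n) u w = B (fst q) u w" "B (fst q) n w = 0" "B (fst q) w n = 0" for s u w
      unfolding B_def using shift_equivariant_derivatives[OF N(1) xN C2 sh] by auto
    have L': "?L (fst q') = ?L (fst q)" unfolding fq' by (rule se(1))
    have B': "B (fst q') u w = B (fst q) u w" for u w unfolding fq' by (rule se(3))
    have \<psi>q': "\<psi> (fst q') = 0" unfolding fq' using sh[OF xN, of "- \<psi> (fst q)"] by simp
    show ?thesis
      unfolding C_def W_def S_def \<kappa>_def
    proof (rule hessian_estimate_pointwise[where g = "G q" and g' = "G q'" and \<Gamma> = "chr q" and \<Gamma>' = "chr q'" and n = n
          and L = "?L (fst q)" and B = "B (fst q)" and v = v and p = "\<bar>\<psi> (fst q)\<bar>"])
      show "bilinear (G q)" "bilinear (G q')" "bilinear (chr q)"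
        using bilinear_G bilinear_chr X_A[OF qX] X_A[OF q'X] by blast+
      show "G q v w = G q w v" "G q' v w = G q' w v" for v w
        using sym_G X_A[OF qX] X_A[OF q'X] by blast+
      show "linear (?L (fst q))" by (rule linL[OF xN])
      show "bilinear (B (fst q))" by (rule bilB[OF xN])
      show "\<bar>G q v w\<bar> \<le> K * norm v * norm w" "norm (chr q v w) \<le> K * norm v * norm w" for v w
        by (rule GK[OF qX])+
      show "\<bar>G q v w - G q' v w\<bar> \<le> K * \<bar>\<psi> (fst q)\<bar> * norm v * norm w"
        "norm (chr q v w - chr q' v w) \<le> K * \<bar>\<psi> (fst q)\<bar> * norm v * norm w" for v w
        using GL[OF qX q'X, of v w] unfolding nq by auto
      show "c0 > 0" by (rule c0)
      show "c0 * norm y * norm y \<le> G q (y, 0) (y, 0)" "c0 * norm y * norm y \<le> G q' (y, 0) (y, 0)" for y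
        by (rule c0s[OF qX], rule c0s[OF q'X])
      show "c0 \<le> - G q (0, 1) (0, 1)" "c0 \<le> - G q' (0, 1) (0, 1)" by (rule c0t[OF qX], rule c0t[OF q'X])
      show "\<bar>?L (fst q) u\<bar> \<le> M * norm u" "\<bar>B (fst q) u u\<bar> \<le> M * norm u * norm u" for u
        by (rule LM[OF qX], rule BM[OF qX])
      show "?L (fst q) n = 1" by (rule se(2))
      show "norm n = 1" by (rule n)
      show "B (fst q) n w = 0" "B (fst q) w n = 0" for w by (rule se(4), rule se(5))
      show "0 \<le> \<bar>\<psi> (fst q)\<bar>" by simp
      show "\<bar>\<psi> (fst q)\<bar> \<le> R" using p R(1) by linarith
      show "K \<ge> 0" "M \<ge> 0" "G q v v = 0" by (rule K(1), rule M, rule null)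
      fix w :: "'e \<times> real" assume w: "w \<noteq> 0" "G q' w w = 0" "?L (fst q) (fst w) = 0"
      show "B (fst q) (fst w) (fst w) \<le> ?L (fst q) (fst (chr q' w w))"
        using conv[OF X_A[OF q'X] \<psi>q' w(1,2)] w(3) unfolding L' B_def[symmetric] B' by simp
    qed
  qed
  have C: "C \<ge> 0"
    using K(1) M c0 R(1) by (auto simp: C_def W_def S_def \<kappa>_def intro!: add_nonneg_nonneg mult_nonneg_nonneg divide_nonneg_nonneg)
  have "cball z r \<subseteq> A" using R by (intro order_trans[OF _ R(2)] subset_cball) (simp add: r_def)
  then show ?thesis using r C est unfolding B_def by blast
qed

text \<open>A connected subset of the union cannot meet both pieces, so each piece is
  maximal.\<close>

lemma components_Un_disjoint_open:
  assumes "open A" "open B" "connected A" "connected B" "A \<noteq> {}" "B \<noteq> {}" "A \<inter> B = {}"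
  shows "components (A \<union> B) = {A, B}"
proof -
  have max: "connected_component_set (A \<union> B) x = A"
    if x: "x \<in> A" and A: "open A" "open B" "connected A" "A \<inter> B = {}" for x and A B :: "'a set"
  proof (rule subset_antisym)
    show "A \<subseteq> connected_component_set (A \<union> B) x"
      by (rule connected_component_maximal[OF x A(3)]) simp
    show "connected_component_set (A \<union> B) x \<subseteq> A"
    proof (rule ccontr)
      let ?C = "connected_component_set (A \<union> B) x"
      assume "\<not> ?C \<subseteq> A"
      moreover have sub: "?C \<subseteq> A \<union> B" by (rule connected_component_subset)
      ultimately have "B \<inter> ?C \<noteq> {}" by blast
      moreover have "x \<in> A \<inter> ?C" using x by (simp add: connected_component_refl)
      moreover have "connected ?C" by (rule connected_connected_component)
      ultimately show False
        using connectedD[OF _ A(1,2), of ?C] sub A(4) by blast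
    qed
  qed
  have "components (A \<union> B) = connected_component_set (A \<union> B) ` A \<union> connected_component_set (A \<union> B) ` B"
    by (simp add: components_def image_Un)
  also have "connected_component_set (A \<union> B) ` A = {A}"
    using max[OF _ assms(1-3,7)] assms(5) by force
  also have "connected_component_set (A \<union> B) ` B = {B}"
    using max[OF _ assms(2,1,4)] assms(6,7) unfolding Un_commute[of A B] by (force simp: Int_commute)
  finally show ?thesis by auto
qed

section \<open>Neighbourhoods of a graph\<close>

text \<open>The sides of a graph inside a ball need not be connected, but \<open>\<psi>\<close>
  straightens them: in terms of the displacement orthogonal to \<open>n\<close> and the value of
  \<open>\<psi>\<close>, each side becomes a disc times an interval, and time adds one more
  interval.\<close>

lemma flattened_neighbourhood:
  fixes \<psi> :: "'e::euclidean_space \<Rightarrow> real" and t :: real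
  assumes N: "open N" and cont: "continuous_on N \<psi>" and n: "norm n = 1"
    and sh: "\<And>x s. x \<in> N \<Longrightarrow> x + s *\<^sub>R n \<in> N \<and> \<psi> (x + s *\<^sub>R n) = \<psi> x + s"
    and X: "X \<in> N" "\<psi> X = 0" and r: "r > 0"
  shows "\<exists>U. open U \<and> (X, t) \<in> U \<and> U \<subseteq> ball (X, t) r \<and> U \<subseteq> N \<times> UNIV \<and>
    connected {q \<in> U. \<psi> (fst q) < 0} \<and> connected {q \<in> U. 0 < \<psi> (fst q)} \<and>
    (\<exists>q\<in>U. \<psi> (fst q) < 0) \<and> (\<exists>q\<in>U. 0 < \<psi> (fst q))"
proof -
  have nn: "n \<bullet> n = 1" using n by (simp add: dot_square_norm)
  have "continuous (at X within N) \<psi>" using cont X(1) by (simp add: continuous_on_eq_continuous_within)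
  moreover have "\<psi> X \<in> ball 0 (r / 8)" using X(2) r by simp
  ultimately obtain e1 where e1: "e1 > 0" "\<And>x. x \<in> N \<Longrightarrow> dist x X < e1 \<Longrightarrow> \<psi> x \<in> ball 0 (r / 8)"
    using continuous_within_openD[OF _ open_ball[of 0 "r / 8"], of X N \<psi>] by blast
  obtain e2 where e2: "e2 > 0" "ball X e2 \<subseteq> N" using N X(1) open_contains_ball by blast
  \<comment> \<open>\<open>e\<close> limits the disc, the values of \<open>\<psi>\<close> and the
    time; \<open>r / 8\<close> bounds \<open>\<psi>\<close> over the disc. The displacements add up
    to at most \<open>3 e + r / 8\<close>, hence to \<open>r / 2\<close>.\<close>
  define e where "e = min (r / 8) (min e1 e2)"
  have e: "e > 0" "e \<le> r / 8" using r e1(1) e2(1) by (auto simp: e_def)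
  have near: "X + y \<in> N" "\<bar>\<psi> (X + y)\<bar> < r / 8" if "norm y < e" for y
  proof -
    have d: "dist (X + y) X < e" using that by (simp add: dist_norm)
    then show "X + y \<in> N" using e2(2) by (auto simp: e_def dist_commute)
    from e1(2)[OF this] d show "\<bar>\<psi> (X + y)\<bar> < r / 8" by (simp add: e_def)
  qed
  define Q where "Q x = (x - X) - ((x - X) \<bullet> n) *\<^sub>R n" for x
  have Qn: "Q x \<bullet> n = 0" for x by (simp add: Q_def inner_diff_left nn)
  have Qdec: "x = (X + Q x) + ((x - X) \<bullet> n) *\<^sub>R n" for x by (simp add: Q_def)
  define V where "V = N \<inter> \<psi> -` {- e<..<e} \<inter> {x. norm (Q x) < e}"
  have V: "open V"
    unfolding V_def Q_def
    by (intro open_Int continuous_open_preimage[OF cont N open_greaterThanLessThan] open_Collect_less continuous_intros)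
  define Y where "Y = {y. n \<bullet> y = 0} \<inter> ball 0 e"
  \<comment> \<open>The inverse of \<open>x \<mapsto> (Q x, \<psi> x)\<close>: from
    \<open>X + y\<close> one moves along \<open>n\<close> until \<open>\<psi>\<close> has the
    prescribed value.\<close>
  define m where "m p = X + fst p + (snd p - \<psi> (X + fst p)) *\<^sub>R n" for p
  have height: "\<psi> x - \<psi> (X + Q x) = (x - X) \<bullet> n" if "x \<in> V" for x
  proof -
    have "X + Q x \<in> N" using that by (intro near(1)) (simp add: V_def)
    then have "\<psi> ((X + Q x) + ((x - X) \<bullet> n) *\<^sub>R n) = \<psi> (X + Q x) + (x - X) \<bullet> n" using sh by blast
    then show ?thesis unfolding Qdec[of x, symmetric] by simp
  qed
  have image: "{x \<in> V. \<psi> x \<in> I} = m ` (Y \<times> I)" if I: "I \<subseteq> {- e<..<e}" for I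
  proof (intro subset_antisym subsetI)
    fix x assume x: "x \<in> {x \<in> V. \<psi> x \<in> I}"
    then have "m (Q x, \<psi> x) = x" using height[of x] Qdec[of x] by (simp add: m_def)
    moreover have "(Q x, \<psi> x) \<in> Y \<times> I" using x Qn[of x] by (simp add: Y_def V_def inner_commute)
    ultimately show "x \<in> m ` (Y \<times> I)" by (metis image_eqI)
  next
    fix x assume "x \<in> m ` (Y \<times> I)"
    then obtain y s where y: "n \<bullet> y = 0" "norm y < e" and s: "s \<in> I" and x: "x = X + y + (s - \<psi> (X + y)) *\<^sub>R n"
      by (auto simp: Y_def m_def)
    have "x \<in> N" "\<psi> x = s" using sh[OF near(1)[OF y(2)], of "s - \<psi> (X + y)"] by (auto simp: x)
    moreover have "Q x = y" using y(1) by (simp add: x Q_def inner_add_left nn inner_commute[of y n])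
    ultimately show "x \<in> {x \<in> V. \<psi> x \<in> I}" using s I y(2) by (auto simp: V_def)
  qed
  have "continuous_on (Y \<times> UNIV) (\<lambda>p. \<psi> (X + fst p))"
    by (rule continuous_on_compose2[OF cont]) (use near(1) in \<open>auto intro!: continuous_intros simp: Y_def\<close>)
  then have cm: "continuous_on (Y \<times> UNIV) m" unfolding m_def by (intro continuous_intros)
  have Y: "convex Y" unfolding Y_def by (intro convex_Int convex_hyperplane convex_ball)
  define U where "U = V \<times> ball t e"
  have conn: "connected {q \<in> U. \<psi> (fst q) \<in> I}" if I: "I \<subseteq> {- e<..<e}" "convex I" for I
  proof -
    have "{q \<in> U. \<psi> (fst q) \<in> I} = {x \<in> V. \<psi> x \<in> I} \<times> ball t e" by (auto simp: U_def)
    moreover have "connected (m ` (Y \<times> I))"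
      by (intro connected_continuous_image continuous_on_subset[OF cm] convex_connected convex_Times Y I) auto
    ultimately show ?thesis
      unfolding image[OF I(1)] by (simp only: connected_Times connected_ball)
  qed
  have Uin: "\<psi> (fst q) \<in> {- e<..<e}" if "q \<in> U" for q using that by (auto simp: U_def V_def)
  have "{q \<in> U. \<psi> (fst q) < 0} = {q \<in> U. \<psi> (fst q) \<in> {- e<..<0}}" using Uin by fastforce
  then have 1: "connected {q \<in> U. \<psi> (fst q) < 0}" using conn[OF greaterThanLessThan_subseteq_greaterThanLessThan[THEN iffD2], of "- e" 0] e(1) by simp
  have "{q \<in> U. 0 < \<psi> (fst q)} = {q \<in> U. \<psi> (fst q) \<in> {0<..<e}}" using Uin by fastforce
  then have 2: "connected {q \<in> U. 0 < \<psi> (fst q)}" using conn[OF greaterThanLessThan_subseteq_greaterThanLessThan[THEN iffD2], of 0 e] e(1) by simp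
  have pt: "(X + s *\<^sub>R n, t) \<in> U \<and> \<psi> (X + s *\<^sub>R n) = s" if "\<bar>s\<bar> < e" for s
    using sh[OF X(1), of s] that e(1) X(2) by (auto simp: U_def V_def Q_def nn)
  have sub: "U \<subseteq> ball (X, t) r"
  proof
    fix q assume q: "q \<in> U"
    then have x: "fst q \<in> V" "norm (Q (fst q)) < e" "\<bar>\<psi> (fst q)\<bar> < e" "dist t (snd q) < e"
      by (auto simp: U_def V_def)
    have "\<bar>(fst q - X) \<bullet> n\<bar> < e + r / 8" using height[OF x(1)] near(2)[OF x(2)] x(3) by linarith
    moreover have "norm (fst q - X) \<le> norm (Q (fst q)) + norm (((fst q - X) \<bullet> n) *\<^sub>R n)"
      using norm_triangle_ineq[of "Q (fst q)" "((fst q - X) \<bullet> n) *\<^sub>R n"] by (simp add: Q_def)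
    ultimately have "norm (fst q - X) < e + (e + r / 8)" using x(2) n by simp
    moreover have "norm (q - (X, t)) \<le> norm (fst q - X) + norm (snd q - t)"
      using norm_Pair_le[of "fst q - X" "snd q - t"] by (metis fst_conv minus_prod_def snd_conv)
    ultimately have "norm (q - (X, t)) < r" using x(4) e(2) r by (simp add: dist_norm norm_minus_commute)
    then show "q \<in> ball (X, t) r" by (simp add: dist_norm norm_minus_commute)
  qed
  have "open U" unfolding U_def by (intro open_Times V open_ball)
  moreover have "(X, t) \<in> U" using pt[of 0] e(1) by simp
  moreover have "U \<subseteq> N \<times> UNIV" by (auto simp: U_def V_def)
  moreover have "\<exists>q\<in>U. \<psi> (fst q) < 0" using pt[of "- e / 2"] e(1) by (intro bexI[of _ "(X + (- e / 2) *\<^sub>R n, t)"]) auto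
  moreover have "\<exists>q\<in>U. 0 < \<psi> (fst q)" using pt[of "e / 2"] e(1) by (intro bexI[of _ "(X + (e / 2) *\<^sub>R n, t)"]) auto
  ultimately show ?thesis using 1 2 sub by blast
qed

text \<open>Writing \<open>\<phi>\<close> as a multiple of \<open>\<psi>\<close> and differentiating
  twice would ask too much of the multiple. Instead the proportionality of the first derivatives on
  the hypersurface is differentiated once, along the projection of the line \<open>x + s u\<close>
  to it. As \<open>u\<close> is tangent, the projected curve has velocity \<open>u\<close>, and the
  term with the derivative of the factor drops out.\<close>

lemma second_derivative_proportional:
  fixes \<phi> \<psi> :: "'e::euclidean_space \<Rightarrow> real"
  assumes N: "open N" "x \<in> N" and \<psi>: "Ck_on 2 N \<psi>" "\<psi> x = 0" and A: "open A" "Ck_on 2 A \<phi>" "x \<in> A"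
    and fac: "\<And>y u. y \<in> N \<Longrightarrow> frechet_derivative \<phi> (at (y - \<psi> y *\<^sub>R n)) u =
      frechet_derivative \<psi> (at y) u * frechet_derivative \<phi> (at (y - \<psi> y *\<^sub>R n)) n"
    and u: "frechet_derivative \<psi> (at x) u = 0"
  shows "frechet_derivative (\<lambda>y. frechet_derivative \<phi> (at y) u) (at x) u =
    frechet_derivative (\<lambda>y. frechet_derivative \<psi> (at y) u) (at x) u * frechet_derivative \<phi> (at x) n"
proof -
  define l where "l s = x + s *\<^sub>R u" for s
  define c where "c s = l s - \<psi> (l s) *\<^sub>R n" for s
  have l: "(l has_vector_derivative u) (at 0)"
    unfolding l_def[abs_def] by (auto intro!: derivative_eq_intros)
  have l0: "l 0 = x" and c0: "c 0 = x" using \<psi>(2) by (simp_all add: l_def c_def)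
  have "((\<lambda>s. \<psi> (l s)) has_vector_derivative 0) (at 0)"
    using has_vector_derivative_compose_field[of \<psi> _ l 0, OF _ l] Ck_on_2_has_derivative(1)[OF \<psi>(1) N(2)] u l0
    by metis
  then have "(c has_vector_derivative (u - 0 *\<^sub>R n)) (at 0)"
    unfolding c_def[abs_def]
    by (intro has_vector_derivative_diff l bounded_linear.has_vector_derivative[OF bounded_linear_scaleR_left])
  then have c: "(c has_vector_derivative u) (at 0)" by simp
  have cA: "c 0 \<in> A" and lN: "l 0 \<in> N" using c0 l0 A(3) N(2) by simp_all
  have a: "((\<lambda>s. frechet_derivative \<phi> (at (c s)) w) has_vector_derivative
      frechet_derivative (\<lambda>y. frechet_derivative \<phi> (at y) w) (at x) u) (at 0)" for w
    using second_derivative_along_curve[OF A(1,2) cA c has_vector_derivative_const[of w]]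
      has_derivative_linear[OF Ck_on_2_has_derivative(1)[OF A(2,3)]] c0 by (simp add: linear_0)
  have b: "((\<lambda>s. frechet_derivative \<psi> (at (l s)) u) has_vector_derivative
      frechet_derivative (\<lambda>y. frechet_derivative \<psi> (at y) u) (at x) u) (at 0)"
    using second_derivative_along_curve[OF N(1) \<psi>(1) lN l has_vector_derivative_const[of u]]
      has_derivative_linear[OF Ck_on_2_has_derivative(1)[OF \<psi>(1) N(2)]] l0 by (simp add: linear_0)
  have "continuous (at 0) l" using has_vector_derivative_continuous[OF l] .
  from continuous_within_openD[OF this N(1) lN]
  obtain e where e: "e > 0" "\<And>s. dist s 0 < e \<Longrightarrow> l s \<in> N" by blast
  have "((\<lambda>s. frechet_derivative \<psi> (at (l s)) u * frechet_derivative \<phi> (at (c s)) n) has_vector_derivative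
      (frechet_derivative \<psi> (at (l 0)) u * frechet_derivative (\<lambda>y. frechet_derivative \<phi> (at y) n) (at x) u +
       frechet_derivative (\<lambda>y. frechet_derivative \<psi> (at y) u) (at x) u * frechet_derivative \<phi> (at (c 0)) n)) (at 0)"
    by (rule has_vector_derivative_mult[OF b a])
  then have "((\<lambda>s. frechet_derivative \<psi> (at (l s)) u * frechet_derivative \<phi> (at (c s)) n) has_vector_derivative
      frechet_derivative (\<lambda>y. frechet_derivative \<psi> (at y) u) (at x) u * frechet_derivative \<phi> (at x) n) (at 0)"
    using u by (simp add: l0 c0)
  then have "((\<lambda>s. frechet_derivative \<phi> (at (c s)) u) has_vector_derivative
      frechet_derivative (\<lambda>y. frechet_derivative \<psi> (at y) u) (at x) u * frechet_derivative \<phi> (at x) n) (at 0)"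
    unfolding has_vector_derivative_def
  proof (rule has_derivative_transform_within[OF _ e(1)])
    fix s :: real assume "dist s 0 < e"
    from fac[OF e(2)[OF this], of u]
    show "frechet_derivative \<psi> (at (l s)) u * frechet_derivative \<phi> (at (c s)) n = frechet_derivative \<phi> (at (c s)) u"
      by (simp add: c_def)
  qed simp
  from vector_derivative_unique_at[OF a this] show ?thesis .
qed

lemma differential_transition:
  assumes N: "smooth_manifold N" "i \<in> idx N" "j \<in> idx N" and U: "open U" "Ck_function 2 N U \<Phi>"
    and z: "z \<in> U" "z \<in> chart_dom N i" "z \<in> chart_dom N j"
  shows "differential N \<Phi> i z v = differential N \<Phi> j z (transition N i j z v)"
proof -
  let ?W = "chart_map N i ` ((chart_dom N j) \<inter> chart_dom N i)"
  have W: "open ?W" by (rule open_chart_image[OF N(1,2) smooth_manifold_chart(1)[OF N(1,3)]])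
  have zW: "chart_map N i z \<in> ?W" using z by blast
  have "Ck_on 2 ?W (chart_map N j \<circ> param N i)"
    using Ck_on_transition[OF N, of 2] by (simp only: Int_commute)
  from Ck_on_2_has_derivative(1)[OF this zW]
  have \<tau>: "((chart_map N j \<circ> param N i) has_derivative transition N i j z) (at (chart_map N i z))"
    by (simp add: transition_def)
  have "Ck_on 2 (chart_map N j ` (U \<inter> chart_dom N j)) (\<Phi> \<circ> param N j)"
    using U(2) N(3) unfolding Ck_function_def by blast
  from Ck_on_2_has_derivative(1)[OF this, of "chart_map N j z"] z
  have "((\<Phi> \<circ> param N j) has_derivative differential N \<Phi> j z) (at (chart_map N j z))"
    by (simp add: differential_def)
  moreover have "(chart_map N j \<circ> param N i) (chart_map N i z) = chart_map N j z" using N z by simp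
  ultimately have "((\<Phi> \<circ> param N j) has_derivative differential N \<Phi> j z) (at ((chart_map N j \<circ> param N i) (chart_map N i z)))"
    by simp
  from has_derivative_compose[OF \<tau> this]
  have "((\<lambda>y. (\<Phi> \<circ> param N j) ((chart_map N j \<circ> param N i) y)) has_derivative
      (\<lambda>v. differential N \<Phi> j z (transition N i j z v))) (at (chart_map N i z))" .
  then have "((\<Phi> \<circ> param N i) has_derivative (\<lambda>v. differential N \<Phi> j z (transition N i j z v))) (at (chart_map N i z))"
    by (rule has_derivative_transform_within_open[OF _ W zW]) (use N in auto)
  from fun_cong[OF frechet_derivative_at[OF this], of v] show ?thesis by (simp add: differential_def)
qed

text \<open>Confinement to the ball of radius \<open>T / 2\<close> bounds the lifetime,
  \<open>b W \<le> 2 T\<close> with \<open>W\<close> twice the initial speed. This is the smallness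
  required by the second-order inequality, used with \<open>\<delta> = 2 T\<close>.\<close>

lemma geodesic_stays_on_side:
  fixes A :: "('e::euclidean_space \<times> real) set" and \<psi> :: "'e \<Rightarrow> real"
  assumes PR: "pseudo_riemannian A G" and N: "open N" "Ck_on 2 N \<psi>"
    and est: "\<And>q v. q \<in> cball z r \<Longrightarrow> G q v v = 0 \<Longrightarrow>
      frechet_derivative (\<lambda>y. frechet_derivative \<psi> (at y) (fst v)) (at (fst q)) (fst v)
        - frechet_derivative \<psi> (at (fst q)) (fst (pseudo_riemannian.chr G q v v))
      \<le> C * \<bar>\<psi> (fst q)\<bar> * norm v * norm v + C * \<bar>frechet_derivative \<psi> (at (fst q)) (fst v)\<bar> * norm v"
    and K: "\<And>q v. q \<in> cball z r \<Longrightarrow> norm (pseudo_riemannian.chr G q v v) \<le> K * norm v * norm v"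
    and const: "C \<ge> 0" "K \<ge> 0" "9 * K * T \<le> 1" "T > 0" "C * ((2 * T) * (2 * T) + 2 * T) < 1"
    and c: "\<And>s. s \<in> {0..<b} \<Longrightarrow> c s \<in> cball z r" "\<And>s. s \<in> {0..<b} \<Longrightarrow> norm (c s - z) < T / 2"
      "\<And>s. s \<in> {0..<b} \<Longrightarrow> fst (c s) \<in> N"
      "\<And>s. s \<in> {0..<b} \<Longrightarrow> (c has_vector_derivative v s) (at s within {0..<b})"
      "\<And>s. s \<in> {0..<b} \<Longrightarrow> (v has_vector_derivative - pseudo_riemannian.chr G (c s) (v s) (v s)) (at s within {0..<b})"
      "\<And>s. s \<in> {0..<b} \<Longrightarrow> G (c s) (v s) (v s) = 0"
    and init: "c 0 = z" "\<psi> (fst z) = 0" "frechet_derivative \<psi> (at (fst z)) (fst (v 0)) = 0" "v 0 \<noteq> 0"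
    and s: "s \<in> {0..<b}"
  shows "\<psi> (fst (c s)) \<le> 0"
proof -
  interpret pseudo_riemannian A G by fact
  let ?L = "\<lambda>x. frechet_derivative \<psi> (at x)"
  let ?a = "\<lambda>s. - chr (c s) (v s) (v s)"
  have b: "b > 0" using s by simp
  have a: "norm (?a s) \<le> K * norm (v s) * norm (v s)" if "s \<in> {0..<b}" for s
    using K[OF c(1)[OF that]] by simp
  have small: "norm (c s - c 0) < T / 2" if "s \<in> {0..<b}" for s
    using c(2)[OF that] by (simp add: init(1))
  define W where "W = 2 * norm (v 0)"
  have bW: "b * W \<le> 2 * T"
    using short_time_in_small_ball(1)[OF c(4,5) a small const(2-4) init(4) b] by (simp add: W_def)
  have vW: "norm (v s) \<le> W" if "s \<in> {0..<b}" for s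
    using short_time_in_small_ball(2)[OF c(4,5) a small const(2-4) init(4) b that] by (simp add: W_def)
  define \<rho> where "\<rho> s = \<psi> (fst (c s))" for s
  define R where "R s = ?L (fst (c s)) (fst (v s))" for s
  define q where "q s = frechet_derivative (\<lambda>y. ?L y (fst (v s))) (at (fst (c s))) (fst (v s)) + ?L (fst (c s)) (fst (?a s))" for s
  have fc: "((\<lambda>s. fst (c s)) has_vector_derivative fst (v s)) (at s within {0..<b})"
    "((\<lambda>s. fst (v s)) has_vector_derivative fst (?a s)) (at s within {0..<b})" if "s \<in> {0..<b}" for s
    using bounded_linear.has_vector_derivative[OF bounded_linear_fst c(4)[OF that]]
      bounded_linear.has_vector_derivative[OF bounded_linear_fst c(5)[OF that]] by auto
  have "\<rho> s \<le> 0"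
  proof (rule nonpositive_of_second_order_inequality[where r = R and q = q and C = C and N = W and \<delta> = "2 * T", OF _ _ _ _ _ const(1) _ bW const(5) s])
    fix s assume s: "s \<in> {0..<b}"
    show "(\<rho> has_vector_derivative R s) (at s within {0..<b})"
      unfolding \<rho>_def[abs_def] R_def
      by (rule has_vector_derivative_compose_field[where c = "\<lambda>s. fst (c s)", OF Ck_on_2_has_derivative(1)[OF N(2) c(3)[OF s]] fc(1)[OF s]])
    show "(R has_vector_derivative q s) (at s within {0..<b})"
      unfolding R_def[abs_def] q_def
      by (rule second_derivative_along_curve[where c = "\<lambda>s. fst (c s)", OF N c(3)[OF s] fc[OF s]])
    have "q s = frechet_derivative (\<lambda>y. ?L y (fst (v s))) (at (fst (c s))) (fst (v s)) - ?L (fst (c s)) (fst (chr (c s) (v s) (v s)))"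
      using linear_neg[OF has_derivative_linear[OF Ck_on_2_has_derivative(1)[OF N(2) c(3)[OF s]]]] by (simp add: q_def)
    also have "\<dots> \<le> C * \<bar>\<rho> s\<bar> * norm (v s) * norm (v s) + C * \<bar>R s\<bar> * norm (v s)"
      unfolding \<rho>_def R_def by (rule est[OF c(1)[OF s] c(6)[OF s]])
    also have "\<dots> \<le> C * \<bar>\<rho> s\<bar> * W * W + C * \<bar>R s\<bar> * W"
      using vW[OF s] const(1) by (intro add_mono mult_mono) (auto simp: W_def)
    finally show "q s \<le> C * W * W * \<bar>\<rho> s\<bar> + C * W * \<bar>R s\<bar>" by (simp add: mult_ac)
  next
    show "\<rho> 0 = 0" "R 0 = 0" using init by (simp_all add: \<rho>_def R_def)
    show "W \<ge> 0" by (simp add: W_def)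
  qed
  then show ?thesis by (simp add: \<rho>_def)
qed

section \<open>Infinitesimal convexity implies local convexity\<close>

text \<open>A function read in a chart of the product is known to be independent of time only near a
  point, so agreement is asked on a box; being open, it determines the derivatives.\<close>

lemma derivatives_compose_fst:
  fixes F :: "'e::euclidean_space \<Rightarrow> real" and f :: "'e \<times> real \<Rightarrow> real"
  assumes B: "open B" "open J" and C2: "Ck_on 2 B F" and f: "\<And>p. p \<in> B \<times> J \<Longrightarrow> f p = F (fst p)"
    and q: "q \<in> B \<times> J"
  shows "frechet_derivative f (at q) v = frechet_derivative F (at (fst q)) (fst v)"
    and "frechet_derivative (\<lambda>y. frechet_derivative f (at y) w) (at q) v =
      frechet_derivative (\<lambda>y. frechet_derivative F (at y) (fst w)) (at (fst q)) (fst v)"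
proof -
  have BJ: "open (B \<times> J)" using B by (rule open_Times)
  have lift: "frechet_derivative h (at q) = (\<lambda>v. H' (fst v))"
    if H: "(H has_derivative H') (at (fst q))" and h: "\<And>p. p \<in> B \<times> J \<Longrightarrow> h p = H (fst p)" and q: "q \<in> B \<times> J"
    for h :: "'e \<times> real \<Rightarrow> real" and H H' q
  proof -
    have "((\<lambda>p. H (fst p)) has_derivative (\<lambda>v. H' (fst v))) (at q)"
      by (rule has_derivative_compose[OF has_derivative_fst[OF has_derivative_ident] H])
    then have "(h has_derivative (\<lambda>v. H' (fst v))) (at q)"
      by (rule has_derivative_transform_within_open[OF _ BJ q]) (simp add: h)
    then show ?thesis by (rule frechet_derivative_at[symmetric])
  qed
  have D: "frechet_derivative f (at p) = (\<lambda>v. frechet_derivative F (at (fst p)) (fst v))" if p: "p \<in> B \<times> J" for p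
    by (rule lift[OF Ck_on_2_has_derivative(1)[OF C2] f p]) (use p in auto)
  show "frechet_derivative f (at q) v = frechet_derivative F (at (fst q)) (fst v)" using D[OF q] by simp
  have "frechet_derivative (\<lambda>y. frechet_derivative f (at y) w) (at q) =
      (\<lambda>v. frechet_derivative (\<lambda>y. frechet_derivative F (at y) (fst w)) (at (fst q)) (fst v))"
    by (rule lift[OF Ck_on_2_has_derivative(2)[OF C2] _ q]) (use q D in auto)
  then show "frechet_derivative (\<lambda>y. frechet_derivative f (at y) w) (at q) v =
      frechet_derivative (\<lambda>y. frechet_derivative F (at y) (fst w)) (at (fst q)) (fst v)" by simp
qed

lemma stationary_metric_signs:
  assumes ss: "standard_stationary M g\<^sub>0 \<omega>\<^sub>0 \<beta>" and i: "i \<in> idx M" and p: "fst p \<in> chart_dom M i"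
  shows "y \<noteq> 0 \<Longrightarrow> stationary_metric g\<^sub>0 \<omega>\<^sub>0 \<beta> i p (y, 0) (y, 0) > 0"
    and "stationary_metric g\<^sub>0 \<omega>\<^sub>0 \<beta> i p (0, 1) (0, 1) < 0"
proof -
  have R: "riemannian_metric M g\<^sub>0" and O: "smooth_one_form M \<omega>\<^sub>0" and \<beta>: "0 < \<beta> (fst p)"
    using ss unfolding standard_stationary_def by blast+
  have g: "bilinear (g\<^sub>0 i (fst p))" "\<And>v. v \<noteq> 0 \<Longrightarrow> 0 < g\<^sub>0 i (fst p) v v" and \<omega>: "linear (\<omega>\<^sub>0 i (fst p))"
    using R[unfolded riemannian_metric_def, THEN conjunct1] O[unfolded smooth_one_form_def, THEN conjunct1] i p
    by blast+
  show "stationary_metric g\<^sub>0 \<omega>\<^sub>0 \<beta> i p (y, 0) (y, 0) > 0" if "y \<noteq> 0"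
    using g(2)[OF that] by (simp add: stationary_metric_def)
  show "stationary_metric g\<^sub>0 \<omega>\<^sub>0 \<beta> i p (0, 1) (0, 1) < 0"
    using \<beta> bilinear_lzero[OF g(1)] linear_0[OF \<omega>] by (simp add: stationary_metric_def)
qed

text \<open>All constants are fixed at \<open>z\<close> before any geodesic is given: the Hessian
  estimate yields \<open>r\<close> and \<open>C\<close>, the Christoffel bound yields
  \<open>K\<close>, these determine \<open>T\<close>, and \<open>U\<close> comes from a straightened
  neighbourhood inside the ball of radius \<open>min r (T / 2)\<close>.\<close>

lemma geodesically_light_convex_of_graph:
  fixes M :: "('i, 'a::{t2_space,second_countable_topology}, 'e::euclidean_space) atlas"
    and \<psi> :: "'e \<Rightarrow> real" and A :: "('e \<times> real) set"
  defines "G \<equiv> \<lambda>g\<^sub>0 \<omega>\<^sub>0 \<beta> i y. stationary_metric g\<^sub>0 \<omega>\<^sub>0 \<beta> i (param (product_line M) i y)"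
  assumes ss: "standard_stationary M g\<^sub>0 \<omega>\<^sub>0 \<beta>" and i: "i \<in> idx M"
    and A: "open A" "A \<subseteq> chart_map (product_line M) i ` chart_dom (product_line M) i"
    and N: "open N" "fst ` A \<subseteq> N" and C2: "Ck_on 2 N \<psi>" and n: "norm n = 1"
    and sh: "\<And>x s. x \<in> N \<Longrightarrow> x + s *\<^sub>R n \<in> N \<and> \<psi> (x + s *\<^sub>R n) = \<psi> x + s"
    and U0: "U\<^sub>0 = chart_dom (product_line M) i \<inter> chart_map (product_line M) i -` A"
    and def: "defining_function (product_line M) H U\<^sub>0 (\<lambda>(x, t). \<psi> (chart_map M i x))"
    and conv: "\<And>q v. q \<in> A \<Longrightarrow> \<psi> (fst q) = 0 \<Longrightarrow> v \<noteq> 0 \<Longrightarrow> G g\<^sub>0 \<omega>\<^sub>0 \<beta> i q v v = 0 \<Longrightarrow>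
      frechet_derivative \<psi> (at (fst q)) (fst v) = 0 \<Longrightarrow>
      frechet_derivative (\<lambda>y. frechet_derivative \<psi> (at y) (fst v)) (at (fst q)) (fst v)
        \<le> frechet_derivative \<psi> (at (fst q)) (fst (pseudo_riemannian.chr (G g\<^sub>0 \<omega>\<^sub>0 \<beta> i) q v v))"
  shows "geodesically_light_convex (product_line M) (stationary_metric g\<^sub>0 \<omega>\<^sub>0 \<beta>) H U\<^sub>0
    (\<lambda>(x, t). \<psi> (chart_map M i x))"
  unfolding geodesically_light_convex_def
proof
  let ?N = "product_line M" and ?g = "stationary_metric g\<^sub>0 \<omega>\<^sub>0 \<beta>"
  let ?\<Phi> = "\<lambda>(x, t::real). \<psi> (chart_map M i x)"
  let ?G = "G g\<^sub>0 \<omega>\<^sub>0 \<beta> i"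
  let ?c = "chart_map ?N i" and ?p = "param ?N i"
  have M: "smooth_manifold M" using ss by (simp add: standard_stationary_def)
  have NS: "smooth_manifold ?N" by (rule smooth_manifold_product_line[OF M])
  have NG: "semi_riemannian_metric ?N ?g" by (rule semi_riemannian_stationary_metric[OF ss])
  have iN: "i \<in> idx ?N" using i by simp
  note ch = smooth_manifold_chart[OF NS iN]
  have \<Phi>: "?\<Phi> p = \<psi> (fst (?c p))" for p by (simp add: case_prod_beta)
  have cp: "?c (?p q) = q" "?p q \<in> chart_dom ?N i" if "q \<in> A" for q
    using chart_map_param[OF NS iN] param_in_chart_dom[OF NS iN] that A(2) by blast+
  have pc: "?p (?c p) = p" if "p \<in> chart_dom ?N i" for p using param_chart_map[OF NS iN that] .
  have PR: "pseudo_riemannian A ?G"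
    unfolding G_def by (rule pseudo_riemannian_subset[OF semi_riemannian_metricD(1)[OF NG iN] A(2,1)])
  have signs: "y \<noteq> 0 \<Longrightarrow> ?G q (y, 0) (y, 0) > 0" "?G q (0, 1) (0, 1) < 0" if "q \<in> A" for q y
    using stationary_metric_signs[OF ss i, of "?p q"] cp(2)[OF that] by (auto simp: G_def mem_Times_iff)
  have cont\<psi>: "continuous_on N \<psi>" by (rule Ck_on_imp_continuous_on[OF C2])
  have cont_c: "continuous_on (chart_dom ?N i) ?c" by (rule homeomorphism_cont1[OF ch(3)])
  have cont_p: "continuous_on A ?p" by (rule continuous_on_subset[OF homeomorphism_cont2[OF ch(3)] A(2)])
  fix z assume z: "z \<in> U\<^sub>0 \<inter> H"
  define q0 where "q0 = ?c z"
  have zd: "z \<in> chart_dom ?N i" and q0: "q0 \<in> A" using z by (auto simp: U0 q0_def)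
  have "z \<in> {z \<in> U\<^sub>0. ?\<Phi> z = 0}" using def z unfolding defining_function_def by blast
  then have \<psi>0: "\<psi> (fst q0) = 0" unfolding \<Phi> q0_def by simp
  have x0: "fst q0 \<in> N" using q0 N(2) by blast
  obtain r C where r: "r > 0" "cball q0 r \<subseteq> A" and C: "C \<ge> 0"
    and est: "\<And>q v. q \<in> cball q0 r \<Longrightarrow> ?G q v v = 0 \<Longrightarrow>
      frechet_derivative (\<lambda>y. frechet_derivative \<psi> (at y) (fst v)) (at (fst q)) (fst v)
        - frechet_derivative \<psi> (at (fst q)) (fst (pseudo_riemannian.chr ?G q v v))
      \<le> C * \<bar>\<psi> (fst q)\<bar> * norm v * norm v + C * \<bar>frechet_derivative \<psi> (at (fst q)) (fst v)\<bar> * norm v"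
    using hessian_estimate[OF PR signs N C2 n sh conv q0 \<psi>0] by blast
  obtain K where K: "K \<ge> 0" "\<And>q v w. q \<in> cball q0 r \<Longrightarrow> norm (pseudo_riemannian.chr ?G q v w) \<le> K * norm v * norm w"
    using pseudo_riemannian.chr_lipschitz[OF PR r(2) less_imp_le[OF r(1)]] by blast
  \<comment> \<open>The first bound controls the velocity. The second gives
    \<open>2 T \<le> 1\<close>, so that \<open>C (4 T^2 + 2 T)\<close> is at most
    \<open>4 C T\<close>, which it also keeps below 1.\<close>
  define T where "T = min (1 / (9 * (K + 1))) (1 / (8 * (C + 1)))"
  have T: "T > 0" using K(1) C by (simp add: T_def)
  have KT: "9 * K * T \<le> 1"
  proof -
    have "9 * K * T \<le> 9 * K * (1 / (9 * (K + 1)))" using K(1) by (intro mult_left_mono) (auto simp: T_def)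
    also have "\<dots> \<le> 1" using K(1) by (simp add: field_simps)
    finally show ?thesis .
  qed
  have CT: "C * ((2 * T) * (2 * T) + 2 * T) < 1"
  proof -
    have T8: "T \<le> 1 / (8 * (C + 1))" by (simp add: T_def)
    have "1 / (8 * (C + 1)) \<le> 1 / 8" using C by (simp add: field_simps)
    then have T1: "2 * T \<le> 1" using T8 by linarith
    have "(2 * T) * (2 * T) \<le> 1 * (2 * T)" using T1 T by (intro mult_right_mono) auto
    then have "C * ((2 * T) * (2 * T) + 2 * T) \<le> C * (4 * T)" using C by (intro mult_left_mono) auto
    also have "\<dots> \<le> C * (4 * (1 / (8 * (C + 1))))" using C T8 by (intro mult_left_mono) auto
    also have "\<dots> < 1" using C by (simp add: field_simps)
    finally show ?thesis .
  qed
  have "min r (T / 2) > 0" using r(1) T by simp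
  from flattened_neighbourhood[OF N(1) cont\<psi> n sh x0 \<psi>0 this, of "snd q0"]
  obtain Uc where Uc: "open Uc" "q0 \<in> Uc" "Uc \<subseteq> ball q0 (min r (T / 2))" "Uc \<subseteq> N \<times> UNIV"
    and conn: "connected {q \<in> Uc. \<psi> (fst q) < 0}" "connected {q \<in> Uc. 0 < \<psi> (fst q)}"
    and ex: "\<exists>q\<in>Uc. \<psi> (fst q) < 0" "\<exists>q\<in>Uc. 0 < \<psi> (fst q)"
    by auto
  have Uc_ball: "q \<in> cball q0 r" "norm (q - q0) < T / 2" if "q \<in> Uc" for q
    using Uc(3) that by (auto simp: dist_norm norm_minus_commute)
  have UcA: "Uc \<subseteq> A" using Uc_ball(1) r(2) by blast
  define U where "U = chart_dom ?N i \<inter> ?c -` Uc"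
  have U: "open U" unfolding U_def by (rule continuous_open_preimage[OF cont_c ch(1) Uc(1)])
  have zU: "z \<in> U" using zd Uc(2) by (simp add: U_def q0_def)
  have UU0: "U \<subseteq> U\<^sub>0" using UcA by (auto simp: U_def U0)
  \<comment> \<open>Stated for an arbitrary set \<open>I\<close> of values, so that openness and
    connectedness are proved once for both sides.\<close>
  have part: "{p \<in> U. ?\<Phi> p \<in> I} = ?p ` {q \<in> Uc. \<psi> (fst q) \<in> I}" for I
  proof (intro subset_antisym subsetI)
    fix p assume "p \<in> {p \<in> U. ?\<Phi> p \<in> I}"
    then have p: "p \<in> chart_dom ?N i" "?c p \<in> {q \<in> Uc. \<psi> (fst q) \<in> I}" unfolding U_def \<Phi> by simp_all
    show "p \<in> ?p ` {q \<in> Uc. \<psi> (fst q) \<in> I}" by (rule image_eqI[where x = "?c p"]) (rule pc[OF p(1), symmetric], rule p(2))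
  next
    fix p assume "p \<in> ?p ` {q \<in> Uc. \<psi> (fst q) \<in> I}"
    then obtain q where q: "q \<in> Uc" "\<psi> (fst q) \<in> I" "p = ?p q" by blast
    then have "q \<in> A" using UcA by blast
    note cpq = cp[OF this]
    have "p \<in> U" unfolding U_def q(3) using cpq q(1) by (simp only: Int_iff vimage_eq simp_thms)
    moreover have "?\<Phi> p = \<psi> (fst q)" unfolding \<Phi> q(3) cpq(1) ..
    ultimately show "p \<in> {p \<in> U. ?\<Phi> p \<in> I}" using q(2) by (simp only: mem_Collect_eq simp_thms)
  qed
  have part_open: "open {p \<in> U. ?\<Phi> p \<in> I}" if "open I" for I
  proof -
    have "continuous_on U (\<lambda>p. fst (?c p))"
      by (intro continuous_on_fst continuous_on_subset[OF cont_c]) (simp add: U_def)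
    then have "continuous_on U (\<lambda>p. \<psi> (fst (?c p)))"
      by (rule continuous_on_compose2[OF cont\<psi>]) (use Uc(4) in \<open>auto simp: U_def\<close>)
    then have "open (U \<inter> (\<lambda>p. \<psi> (fst (?c p))) -` I)" by (rule continuous_open_preimage[OF _ U that])
    moreover have "U \<inter> (\<lambda>p. \<psi> (fst (?c p))) -` I = {p \<in> U. ?\<Phi> p \<in> I}" unfolding \<Phi> by auto
    ultimately show ?thesis by simp
  qed
  have part_conn: "connected {p \<in> U. ?\<Phi> p \<in> I}" if "connected {q \<in> Uc. \<psi> (fst q) \<in> I}" for I
  proof -
    have "{q \<in> Uc. \<psi> (fst q) \<in> I} \<subseteq> A" using UcA by blast
    then have "connected (?p ` {q \<in> Uc. \<psi> (fst q) \<in> I})"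
      by (intro connected_continuous_image that continuous_on_subset[OF cont_p])
    then show ?thesis by (simp only: part)
  qed
  let ?neg = "{q \<in> U. ?\<Phi> q < 0}" and ?pos = "{q \<in> U. 0 < ?\<Phi> q}"
  have negI: "?neg = {p \<in> U. ?\<Phi> p \<in> {..<0}}" and posI: "?pos = {p \<in> U. ?\<Phi> p \<in> {0<..}}"
    by (simp_all only: lessThan_iff greaterThan_iff)
  have neg: "open ?neg" "connected ?neg" "?neg \<noteq> {}"
    unfolding negI
  proof -
    show "open {p \<in> U. ?\<Phi> p \<in> {..<0}}" by (rule part_open[OF open_lessThan])
    show "connected {p \<in> U. ?\<Phi> p \<in> {..<0}}" by (rule part_conn) (simp only: lessThan_iff conn(1))
    show "{p \<in> U. ?\<Phi> p \<in> {..<0}} \<noteq> {}" using ex(1) by (subst part) blast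
  qed
  have pos: "open ?pos" "connected ?pos" "?pos \<noteq> {}"
    unfolding posI
  proof -
    show "open {p \<in> U. ?\<Phi> p \<in> {0<..}}" by (rule part_open[OF open_greaterThan])
    show "connected {p \<in> U. ?\<Phi> p \<in> {0<..}}" by (rule part_conn) (simp only: greaterThan_iff conn(2))
    show "{p \<in> U. ?\<Phi> p \<in> {0<..}} \<noteq> {}" using ex(2) by (subst part) blast
  qed
  have "U - H = ?neg \<union> ?pos"
  proof -
    have "p \<in> H \<longleftrightarrow> ?\<Phi> p = 0" if "p \<in> U" for p
      using def UU0 that unfolding defining_function_def by blast
    moreover have "U - H = {q \<in> U. f q < 0} \<union> {q \<in> U. 0 < f q}" if "\<And>p. p \<in> U \<Longrightarrow> p \<in> H \<longleftrightarrow> f p = 0"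
      for f :: "'a \<times> real \<Rightarrow> real" using that by auto
    ultimately show ?thesis by blast
  qed
  moreover have "{q \<in> U. f q < 0} \<inter> {q \<in> U. 0 < f q} = {}" for f :: "'a \<times> real \<Rightarrow> real" by auto
  ultimately have comp: "components (U - H) = {?neg, ?pos}"
    using components_Un_disjoint_open[OF neg(1) pos(1) neg(2) pos(2) neg(3) pos(3)] by simp
  have side: "\<gamma> ` {0..<b} \<subseteq> closure ?neg"
    if b: "b > 0" and geo: "lightlike_geodesic_on ?N ?g {0..<b} \<gamma>" and \<gamma>U: "\<gamma> ` {0..<b} \<subseteq> U" and \<gamma>0: "\<gamma> 0 = z"
      and tan: "\<forall>j\<in>idx ?N. z \<in> chart_dom ?N j \<longrightarrow> tangent_to ?N H j z (velocity ?N {0..<b} \<gamma> j 0)"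
    for b :: real and \<gamma>
  proof
    let ?I = "{0..<b}"
    define c where "c = ?c \<circ> \<gamma>"
    define v where "v = velocity ?N ?I \<gamma> i"
    have \<gamma>d: "\<gamma> s \<in> chart_dom ?N i" and cU: "c s \<in> Uc" if "s \<in> ?I" for s
    proof -
      have "\<gamma> s \<in> U" using \<gamma>U that by blast
      then show "\<gamma> s \<in> chart_dom ?N i" "c s \<in> Uc" by (simp_all only: U_def c_def o_apply Int_iff vimage_eq)
    qed
    have cA: "c s \<in> A" if "s \<in> ?I" for s using cU[OF that] UcA by blast
    have pcs: "?p (c s) = \<gamma> s" if "s \<in> ?I" for s using pc[OF \<gamma>d[OF that]] by (simp add: c_def)
    note geo1 = geo[unfolded lightlike_geodesic_on_def, THEN conjunct1]
    note geo2 = geo[unfolded lightlike_geodesic_on_def, THEN conjunct2]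
    have g1: "(?c \<circ> \<gamma>) differentiable (at s within ?I) \<and>
      (v has_vector_derivative - christoffel ?N ?g i (\<gamma> s) (v s) (v s)) (at s within ?I)" if "s \<in> ?I" for s
      unfolding v_def
      by (rule geo1[unfolded geodesic_on_def, THEN conjunct2, THEN bspec, THEN bspec, THEN mp, OF that iN \<gamma>d[OF that]])
    have g2: "lightlike ?g i (\<gamma> s) (v s)" if "s \<in> ?I" for s
      unfolding v_def by (rule geo2[THEN bspec, THEN bspec, THEN mp, OF that iN \<gamma>d[OF that]])
    have c': "(c has_vector_derivative v s) (at s within ?I)" if "s \<in> ?I" for s
      using g1[OF that] by (simp only: c_def v_def velocity_def vector_derivative_works)
    have v': "(v has_vector_derivative - pseudo_riemannian.chr ?G (c s) (v s) (v s)) (at s within ?I)" if "s \<in> ?I" for s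
      using g1[OF that] christoffel_eq_chr[OF NS NG iN \<gamma>d[OF that]] by (simp only: c_def G_def o_apply)
    have null: "?G (c s) (v s) (v s) = 0" "v s \<noteq> 0" if "s \<in> ?I" for s
      using g2[OF that] by (simp_all only: lightlike_def G_def pcs[OF that] simp_thms)
    have I0: "0 \<in> ?I" using b by simp
    have c0: "c 0 = q0" by (simp add: c_def \<gamma>0 q0_def)
    have "tangent_to ?N H i z (v 0)" using tan iN zd unfolding v_def by blast
    from tangent_to_defining_function[OF NS iN def _ this] z zd
    have "differential ?N ?\<Phi> i z (v 0) = 0" by blast
    moreover have "differential ?N ?\<Phi> i z (v 0) = frechet_derivative \<psi> (at (fst q0)) (fst (v 0))"
    proof -
      \<comment> \<open>On a box around the point, the function read in the chart is a composition
        with \<open>fst\<close>, and its differential reduces to that of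
        \<open>\<psi>\<close>.\<close>
      obtain B J where BJ: "open B" "open J" "q0 \<in> B \<times> J" "B \<times> J \<subseteq> A"
        using A(1) q0 by (rule open_prod_elim)
      have "B \<subseteq> N"
      proof
        fix x assume "x \<in> B"
        then have "(x, snd q0) \<in> A" using BJ(3,4) by (auto simp: mem_Times_iff)
        then show "x \<in> N" using N(2) by force
      qed
      show ?thesis
        unfolding differential_def q0_def[symmetric]
      proof (rule derivatives_compose_fst(1)[OF BJ(1,2) Ck_on_subset[OF C2 \<open>B \<subseteq> N\<close>] _ BJ(3)])
        fix p assume "p \<in> B \<times> J"
        then have "p \<in> A" using BJ(4) by blast
        from cp(1)[OF this] show "(?\<Phi> \<circ> ?p) p = \<psi> (fst p)" unfolding o_apply \<Phi> by (rule arg_cong)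
      qed
    qed
    ultimately have init: "frechet_derivative \<psi> (at (fst q0)) (fst (v 0)) = 0" by simp
    fix p assume "p \<in> \<gamma> ` ?I"
    then obtain s where s: "s \<in> ?I" and p: "p = \<gamma> s" by blast
    have le: "\<psi> (fst (c s)) \<le> 0"
    proof (rule geodesic_stays_on_side[OF PR N(1) C2 est K(2) C K(1) KT T CT _ _ _ c' v' null(1) c0 \<psi>0 init null(2)[OF I0] s])
      show "c s \<in> cball q0 r" "norm (c s - q0) < T / 2" if "s \<in> ?I" for s
        using Uc_ball[OF cU[OF that]] by auto
      show "fst (c s) \<in> N" if "s \<in> ?I" for s using Uc(4) cU[OF that] by (auto simp: mem_Times_iff)
    qed
    have ps: "p \<in> U" using \<gamma>U s p by blast
    show "p \<in> closure ?neg"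
    proof (cases "\<psi> (fst (c s)) = 0")
      case False
      then have "\<psi> (fst (?c p)) < 0" using le unfolding p c_def o_apply by linarith
      then have "?\<Phi> p < 0" unfolding \<Phi> .
      with ps have "p \<in> ?neg" by (simp only: mem_Collect_eq simp_thms)
      then show ?thesis by (rule subsetD[OF closure_subset])
    next
      case True
      \<comment> \<open>A point with \<open>\<psi> = 0\<close> belongs to the closure because an
        arbitrarily small move along \<open>- n\<close> makes \<open>\<psi>\<close>
        negative.\<close>
      show ?thesis
      proof (rule ccontr)
        assume out: "p \<notin> closure ?neg"
        define f where "f \<sigma> = c s - \<sigma> *\<^sub>R (n, 0)" for \<sigma> :: real
        have cf: "continuous (at 0) f" unfolding f_def by (intro continuous_intros)
        have f0: "f 0 = c s" unfolding f_def by (simp only: scaleR_zero_left diff_zero)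
        obtain e1 where e1: "e1 > 0" "\<And>\<sigma>. dist \<sigma> 0 < e1 \<Longrightarrow> f \<sigma> \<in> Uc"
          using continuous_within_openD[OF cf Uc(1) cU[OF s, folded f0]] by blast
        have "continuous (at (f 0)) ?p"
          using cont_p cA[OF s] unfolding f0 continuous_on_eq_continuous_at[OF A(1)] by blast
        then have "continuous (at 0) (\<lambda>\<sigma>. ?p (f \<sigma>))" by (rule isCont_o2[OF cf])
        moreover have "?p (f 0) \<in> - closure ?neg" unfolding f0 pcs[OF s] using out p by (simp only: Compl_iff simp_thms)
        ultimately obtain e2 where e2: "e2 > 0" "\<And>\<sigma>. dist \<sigma> 0 < e2 \<Longrightarrow> ?p (f \<sigma>) \<in> - closure ?neg"
          using continuous_within_openD[of 0 UNIV "\<lambda>\<sigma>. ?p (f \<sigma>)" "- closure ?neg"] open_Compl[OF closed_closure] by blast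
        define \<sigma> where "\<sigma> = min e1 e2 / 2"
        have \<sigma>: "\<sigma> > 0" "dist \<sigma> 0 < e1" "dist \<sigma> 0 < e2" using e1(1) e2(1) by (auto simp: \<sigma>_def)
        have fU: "f \<sigma> \<in> Uc" by (rule e1(2)[OF \<sigma>(2)])
        have "fst (c s) \<in> N" using Uc(4) cU[OF s] by (auto simp: mem_Times_iff)
        from sh[OF this, of "- \<sigma>"] have "\<psi> (fst (f \<sigma>)) < 0" using True \<sigma>(1) by (simp add: f_def)
        then have "?p (f \<sigma>) \<in> {p \<in> U. ?\<Phi> p \<in> {..<0}}" using fU
          by (subst part) (rule imageI, simp only: mem_Collect_eq lessThan_iff simp_thms)
        then have "?p (f \<sigma>) \<in> ?neg" unfolding negI .
        then have "?p (f \<sigma>) \<in> closure ?neg" by (rule subsetD[OF closure_subset])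
        with ComplD[OF e2(2)[OF \<sigma>(3)]] show False by (rule notE)
      qed
    qed
  qed
  show "\<exists>U. open U \<and> z \<in> U \<and> U \<subseteq> U\<^sub>0 \<and> components (U - H) = {{q \<in> U. ?\<Phi> q < 0}, {q \<in> U. 0 < ?\<Phi> q}} \<and>
    (\<forall>b>0. \<forall>\<gamma>. lightlike_geodesic_on ?N ?g {0..<b} \<gamma> \<and> \<gamma> ` {0..<b} \<subseteq> U \<and> \<gamma> 0 = z \<and>
      (\<forall>i\<in>idx ?N. z \<in> chart_dom ?N i \<longrightarrow> tangent_to ?N H i z (velocity ?N {0..<b} \<gamma> i 0)) \<longrightarrow>
      \<gamma> ` {0..<b} \<subseteq> closure {q \<in> U. ?\<Phi> q < 0})"
    by (intro exI[of _ U] conjI U zU UU0 comp allI impI) (elim conjE, rule side)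
qed

lemma tangent_to_curve_in_chart:
  fixes c :: "real \<Rightarrow> 'f::euclidean_space"
  assumes N: "smooth_manifold N" "i \<in> idx N" and e: "e > 0"
    and c: "\<And>s. dist s 0 < e \<Longrightarrow> c s \<in> chart_map N i ` chart_dom N i"
      "\<And>s. dist s 0 < e \<Longrightarrow> param N i (c s) \<in> H" "(c has_vector_derivative v) (at 0)"
  shows "tangent_to N H i (param N i (c 0)) v"
proof -
  \<comment> \<open>As for changes of chart, the curve is frozen at its value at 0 outside the
    interval on which it is controlled.\<close>
  define d where "d s = param N i (if dist s 0 < e then c s else c 0)" for s :: real
  have 0: "dist (0::real) 0 < e" using e by simp
  have d: "d s \<in> H \<inter> chart_dom N i" for s
    using c(1,2)[of s] c(1,2)[OF 0] param_in_chart_dom[OF N] by (simp add: d_def)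
  have "((chart_map N i \<circ> d) has_vector_derivative v) (at 0)"
    using c(3) unfolding has_vector_derivative_def
  proof (rule has_derivative_transform_within[OF _ e])
    fix s :: real assume "dist s 0 < e"
    then show "c s = (chart_map N i \<circ> d) s" using chart_map_param[OF N c(1)] by (simp add: d_def)
  qed simp
  moreover have "d 0 = param N i (c 0)" using e by (simp add: d_def)
  ultimately show ?thesis unfolding tangent_to_def using d by blast
qed

text \<open>The differential does not vanish because its value on \<open>(n, 0)\<close> is 1 in
  chart \<open>i\<close>; any other chart sees the same value on the transformed vector.\<close>

lemma defining_function_of_graph:
  fixes M :: "('i, 'a::{t2_space,second_countable_topology}, 'e::euclidean_space) atlas" and \<psi> :: "'e \<Rightarrow> real"
  assumes M: "smooth_manifold M" and i: "i \<in> idx M"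
    and Y: "open Y" "open J" "Y \<subseteq> chart_map M i ` chart_dom M i" and C2: "Ck_on 2 Y \<psi>"
    and n: "\<And>x. x \<in> Y \<Longrightarrow> frechet_derivative \<psi> (at x) n = 1"
    and U0: "U\<^sub>0 = chart_dom (product_line M) i \<inter> chart_map (product_line M) i -` (Y \<times> J)"
    and zero: "\<And>p. p \<in> U\<^sub>0 \<Longrightarrow> \<psi> (chart_map M i (fst p)) = 0 \<longleftrightarrow> p \<in> H"
  shows "defining_function (product_line M) H U\<^sub>0 (\<lambda>(x, t). \<psi> (chart_map M i x))"
proof -
  let ?N = "product_line M"
  let ?\<Phi> = "\<lambda>(x, t::real). \<psi> (chart_map M i x)"
  let ?c = "chart_map ?N i" and ?p = "param ?N i"
  have NS: "smooth_manifold ?N" by (rule smooth_manifold_product_line[OF M])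
  have iN: "i \<in> idx ?N" using i by simp
  note ch = smooth_manifold_chart[OF NS iN]
  have \<Phi>: "?\<Phi> p = \<psi> (fst (?c p))" for p by (simp add: case_prod_beta)
  have A: "open (Y \<times> J)" by (rule open_Times[OF Y(1,2)])
  have open_U0: "open U\<^sub>0"
    unfolding U0 by (rule continuous_open_preimage[OF homeomorphism_cont1[OF ch(3)] ch(1) A])
  have Ck: "Ck_function 2 ?N U\<^sub>0 ?\<Phi>"
    unfolding Ck_function_def
  proof
    fix j assume j: "j \<in> idx ?N"
    let ?W = "chart_map ?N j ` (U\<^sub>0 \<inter> chart_dom ?N j)"
    have W: "open ?W" by (rule open_chart_image[OF NS j open_U0])
    have sub: "?W \<subseteq> chart_map ?N j ` (chart_dom ?N j \<inter> chart_dom ?N i)" unfolding U0 by blast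
    have 1: "Ck_on 2 ?W (?c \<circ> param ?N j)" by (rule Ck_on_subset[OF Ck_on_transition[OF NS j iN] sub])
    have 2: "Ck_on 2 (Y \<times> J) (\<lambda>q. \<psi> (fst q))"
      by (rule Ck_on_compose[OF A Y(1) Ck_on_bounded_linear[OF bounded_linear_fst A] C2]) auto
    have "(?c \<circ> param ?N j) ` ?W \<subseteq> Y \<times> J"
    proof
      fix q assume "q \<in> (?c \<circ> param ?N j) ` ?W"
      then obtain p where p: "p \<in> U\<^sub>0" "p \<in> chart_dom ?N j" "q = ?c (param ?N j (chart_map ?N j p))"
        unfolding o_def by blast
      then show "q \<in> Y \<times> J" unfolding p(3) param_chart_map[OF NS j p(2)] using p(1) unfolding U0 by blast
    qed
    from Ck_on_compose[OF W A 1 2 this]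
    have "Ck_on 2 ?W (\<lambda>y. \<psi> (fst ((?c \<circ> param ?N j) y)))" .
    moreover have "(\<lambda>y. \<psi> (fst ((?c \<circ> param ?N j) y))) = ?\<Phi> \<circ> param ?N j"
      unfolding fun_eq_iff o_apply \<Phi> by (intro allI refl)
    ultimately show "Ck_on 2 ?W (?\<Phi> \<circ> param ?N j)" by (simp only:)
  qed
  have "\<exists>v. differential ?N ?\<Phi> j z v \<noteq> 0" if z: "z \<in> U\<^sub>0 \<inter> H" and j: "j \<in> idx ?N" "z \<in> chart_dom ?N j" for z j
  proof -
    have zi: "z \<in> chart_dom ?N i" and q: "?c z \<in> Y \<times> J" using z unfolding U0 by blast+
    have "differential ?N ?\<Phi> i z (n, 0) = frechet_derivative \<psi> (at (fst (?c z))) (fst (n, 0::real))"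
      unfolding differential_def
    proof (rule derivatives_compose_fst(1)[OF Y(1,2) C2 _ q])
      fix p assume "p \<in> Y \<times> J"
      then have "p \<in> ?c ` chart_dom ?N i"
        using Y(3) unfolding product_line_simps(2) image_chart_product_line by blast
      from chart_map_param[OF NS iN this] show "(?\<Phi> \<circ> ?p) p = \<psi> (fst p)" unfolding o_apply \<Phi> by (rule arg_cong)
    qed
    also have "\<dots> = 1" using n[of "fst (?c z)"] q by (simp only: fst_conv mem_Times_iff)
    finally have "differential ?N ?\<Phi> j z (transition ?N i j z (n, 0)) = 1"
      using differential_transition[OF NS iN j(1) open_U0 Ck, of z "(n, 0)"] z zi j(2) by simp
    then show ?thesis using zero_neq_one by metis
  qed
  moreover have "{z \<in> U\<^sub>0. ?\<Phi> z = 0} = U\<^sub>0 \<inter> H"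
  proof (intro set_eqI)
    fix p
    have "?\<Phi> p = \<psi> (chart_map M i (fst p))" by (simp add: case_prod_beta)
    then show "p \<in> {z \<in> U\<^sub>0. ?\<Phi> z = 0} \<longleftrightarrow> p \<in> U\<^sub>0 \<inter> H" using zero[of p] by (simp only: mem_Collect_eq Int_iff) blast
  qed
  ultimately show ?thesis unfolding defining_function_def using open_U0 Ck by blast
qed

text \<open>The given function is exchanged for the height over the graph in one chart. The
  direction \<open>n\<close> is oriented by the differential of the given function, so that the
  Hessian inequality passes over with a positive factor instead of being reversed.\<close>

lemma local_light_convexity_at_point:
  fixes M :: "('i, 'a::{t2_space,second_countable_topology}, 'e::euclidean_space) atlas"
  assumes ss: "standard_stationary M g\<^sub>0 \<omega>\<^sub>0 \<beta>"
    and def: "defining_function (product_line M) (H\<^sub>S \<times> UNIV) U\<^sub>0 (\<lambda>(x, t). \<phi> x)"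
    and conv: "hessian_light_convex (product_line M) (stationary_metric g\<^sub>0 \<omega>\<^sub>0 \<beta>) (H\<^sub>S \<times> UNIV) U\<^sub>0 (\<lambda>(x, t). \<phi> x)"
    and z0: "z0 \<in> U\<^sub>0 \<inter> (H\<^sub>S \<times> UNIV)"
  shows "\<exists>U \<phi>'. z0 \<in> U \<and> defining_function (product_line M) (H\<^sub>S \<times> UNIV) U (\<lambda>(x, t). \<phi>' x) \<and>
    geodesically_light_convex (product_line M) (stationary_metric g\<^sub>0 \<omega>\<^sub>0 \<beta>) (H\<^sub>S \<times> UNIV) U (\<lambda>(x, t). \<phi>' x)"
proof -
  let ?N = "product_line M" and ?g = "stationary_metric g\<^sub>0 \<omega>\<^sub>0 \<beta>" and ?H = "H\<^sub>S \<times> (UNIV :: real set)"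
  let ?\<Phi> = "\<lambda>(x, t::real). \<phi> x"
  have M: "smooth_manifold M" using ss by (simp add: standard_stationary_def)
  have NS: "smooth_manifold ?N" by (rule smooth_manifold_product_line[OF M])
  have NG: "semi_riemannian_metric ?N ?g" by (rule semi_riemannian_stationary_metric[OF ss])
  have "(\<Union>i\<in>idx M. chart_dom M i) = UNIV" using M by (simp only: smooth_manifold_def)
  then obtain i where i: "i \<in> idx M" and x0i: "fst z0 \<in> chart_dom M i" by blast
  have iN: "i \<in> idx ?N" using i by simp
  have zi: "z0 \<in> chart_dom ?N i" using x0i by (simp add: mem_Times_iff)
  let ?c = "chart_map ?N i" and ?p = "param ?N i"
  let ?O = "?c ` (U\<^sub>0 \<inter> chart_dom ?N i)"
  have U0: "open U\<^sub>0" and Ck: "Ck_function 2 ?N U\<^sub>0 ?\<Phi>" and zero: "{z \<in> U\<^sub>0. ?\<Phi> z = 0} = U\<^sub>0 \<inter> ?H"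
    and nz: "\<And>z i. z \<in> U\<^sub>0 \<inter> ?H \<Longrightarrow> i \<in> idx ?N \<Longrightarrow> z \<in> chart_dom ?N i \<Longrightarrow> \<exists>v. differential ?N ?\<Phi> i z v \<noteq> 0"
    using def unfolding defining_function_def by blast+
  have C2f: "Ck_on 2 ?O (?\<Phi> \<circ> ?p)" using Ck iN unfolding Ck_function_def by blast
  have O: "open ?O" by (rule open_chart_image[OF NS iN U0])
  have q0O: "?c z0 \<in> ?O" using z0 zi by blast
  \<comment> \<open>The defining function ignores time, so on a box it is determined by a single
    time slice; this reduces it to the function \<open>F\<close> on \<open>B\<close>.\<close>
  obtain B J where BJ: "open B" "open J" "?c z0 \<in> B \<times> J" "B \<times> J \<subseteq> ?O"
    using O q0O by (rule open_prod_elim)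
  define X0 t0 where "X0 = fst (?c z0)" and "t0 = snd (?c z0)"
  have X0: "X0 \<in> B" and t0: "t0 \<in> J" using BJ(3) by (auto simp: X0_def t0_def mem_Times_iff)
  have BO: "B \<subseteq> chart_map M i ` chart_dom M i"
  proof
    fix x assume "x \<in> B"
    then have "(x, t0) \<in> ?O" using BJ(4) t0 by blast
    then show "x \<in> chart_map M i ` chart_dom M i" by auto
  qed
  have pO: "?p q \<in> U\<^sub>0" "?p q \<in> chart_dom ?N i" "?c (?p q) = q" "?p q = (param M i (fst q), snd q)"
    if "q \<in> B \<times> J" for q
  proof -
    have "q \<in> ?O" using that BJ(4) by blast
    from param_in_Int[OF NS iN this] show "?p q \<in> U\<^sub>0" "?p q \<in> chart_dom ?N i" by blast+
    show "?c (?p q) = q" by (rule chart_map_param[OF NS iN]) (use \<open>q \<in> ?O\<close> in blast)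
    have "fst q \<in> chart_map M i ` chart_dom M i" using that BO by auto
    from param_product_line[OF M i this, of "snd q"] show "?p q = (param M i (fst q), snd q)" by simp
  qed
  define F where "F x = \<phi> (param M i x)" for x
  have fF: "(?\<Phi> \<circ> ?p) q = F (fst q)" if "q \<in> B \<times> J" for q
    unfolding o_apply pO(4)[OF that] F_def by simp
  have "Ck_on 2 B (\<lambda>x. (?\<Phi> \<circ> ?p) (x, t0))"
    by (rule Ck_on_compose[OF BJ(1) O Ck_on_Pair[OF BJ(1) Ck_on_id Ck_on_const] C2f]) (use BJ(4) t0 in blast)
  moreover have "(?\<Phi> \<circ> ?p) (x, t0) = F x" if "x \<in> B" for x using fF[of "(x, t0)"] that t0 by (simp only: mem_Times_iff fst_conv snd_conv simp_thms)
  ultimately have C2F: "Ck_on 2 B F" using Ck_on_cong[OF BJ(1), of "\<lambda>x. (?\<Phi> \<circ> ?p) (x, t0)" F 2] by blast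
  have dF1: "frechet_derivative (?\<Phi> \<circ> ?p) (at q) v = frechet_derivative F (at (fst q)) (fst v)"
    and dF2: "frechet_derivative (\<lambda>y. frechet_derivative (?\<Phi> \<circ> ?p) (at y) w) (at q) v =
      frechet_derivative (\<lambda>y. frechet_derivative F (at y) (fst w)) (at (fst q)) (fst v)"
    if "q \<in> B \<times> J" for q v w
    by (rule derivatives_compose_fst[OF BJ(1,2) C2F fF that]; assumption)+
  have zeroF: "F (fst q) = 0 \<longleftrightarrow> ?p q \<in> ?H" if "q \<in> B \<times> J" for q
  proof -
    have "?\<Phi> (?p q) = F (fst q)" using fF[OF that] unfolding o_apply .
    moreover have "?\<Phi> p = 0 \<longleftrightarrow> p \<in> ?H" if "p \<in> U\<^sub>0" for p
      using eqset_imp_iff[OF zero, of p] that by (simp only: mem_Collect_eq Int_iff simp_thms)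
    ultimately show ?thesis using pO(1)[OF that] by metis
  qed
  have "?p (?c z0) \<in> ?H" unfolding param_chart_map[OF NS iN zi] using z0 by (rule IntD2)
  then have "F X0 = 0" using zeroF[OF BJ(3)] unfolding X0_def by (rule iffD2[rotated])
  obtain v where "differential ?N ?\<Phi> i z0 v \<noteq> 0" using nz[OF z0 iN zi] by blast
  then have "frechet_derivative F (at X0) (fst v) \<noteq> 0"
    unfolding differential_def X0_def dF1[OF BJ(3)] .
  moreover define w where "w = fst v"
  moreover define D where "D = frechet_derivative F (at X0) w"
  ultimately have D: "D \<noteq> 0" by simp
  have linF: "linear (frechet_derivative F (at X0))" by (rule has_derivative_linear[OF Ck_on_2_has_derivative(1)[OF C2F X0]])
  have w0: "w \<noteq> 0" using D linear_0[OF linF] by (auto simp: D_def)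
  \<comment> \<open>The sign of \<open>D\<close> orients \<open>n\<close> so that \<open>F\<close>
    increases along it at \<open>X0\<close>.\<close>
  define n where "n = (sgn D / norm w) *\<^sub>R w"
  have n: "norm n = 1" using w0 D by (simp add: n_def abs_sgn_eq)
  have "frechet_derivative F (at X0) n = \<bar>D\<bar> / norm w"
    by (simp add: n_def linear_scale[OF linF] D_def[symmetric] abs_sgn mult.commute)
  then have pos: "frechet_derivative F (at X0) n > 0" using D w0 by simp
  obtain N \<delta> \<psi> where N: "open N" "X0 \<in> N" "\<delta> > 0" "Ck_on 2 N \<psi>"
    and sh': "\<forall>x\<in>N. \<forall>s. x + s *\<^sub>R n \<in> N \<and> \<psi> (x + s *\<^sub>R n) = \<psi> x + s"
    and near': "\<forall>x\<in>N. \<bar>(x - X0) \<bullet> n\<bar> < \<delta> \<longrightarrow> x \<in> B \<and> frechet_derivative F (at x) n > 0 \<and> (F x = 0 \<longleftrightarrow> \<psi> x = 0)"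
    and proj': "\<forall>x\<in>N. \<bar>(x - \<psi> x *\<^sub>R n - X0) \<bullet> n\<bar> < \<delta>"
    and fac': "\<forall>x\<in>N. \<forall>u. frechet_derivative F (at (x - \<psi> x *\<^sub>R n)) u =
      frechet_derivative \<psi> (at x) u * frechet_derivative F (at (x - \<psi> x *\<^sub>R n)) n"
    using implicit_graph[OF BJ(1) X0 C2F \<open>F X0 = 0\<close> n pos] by (elim exE conjE) (rule that)
  note sh = sh'[THEN bspec, THEN spec] and near = near'[THEN bspec, THEN mp]
    and proj = proj'[THEN bspec] and fac = fac'[THEN bspec, THEN spec]
  \<comment> \<open>The slab in which \<open>F\<close> and \<open>\<psi>\<close> have the same
    zeros; on the rest of the cylinder \<open>N\<close> nothing is known about
    \<open>F\<close>.\<close>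
  define Y where "Y = N \<inter> {x. \<bar>(x - X0) \<bullet> n\<bar> < \<delta>}"
  have Y: "open Y" unfolding Y_def by (intro open_Int N(1) open_Collect_less continuous_intros)
  have YB: "x \<in> B" "frechet_derivative F (at x) n > 0" "F x = 0 \<longleftrightarrow> \<psi> x = 0" "x \<in> N" if "x \<in> Y" for x
    using near[of x] that by (auto simp: Y_def)
  let ?A = "Y \<times> J"
  have AB: "?A \<subseteq> B \<times> J" using YB(1) by blast
  define U where "U = chart_dom ?N i \<inter> ?c -` ?A"
  have zU: "z0 \<in> U"
    using zi N(2,3) t0 by (simp add: U_def Y_def X0_def t0_def)
  have YN: "Y \<subseteq> N" by (simp add: Y_def)
  have def': "defining_function ?N ?H U (\<lambda>(x, t). \<psi> (chart_map M i x))"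
  proof (rule defining_function_of_graph[OF M i Y BJ(2) _ Ck_on_subset[OF N(4) YN] _ U_def])
    show "Y \<subseteq> chart_map M i ` chart_dom M i" using YB(1) BO by blast
    show "frechet_derivative \<psi> (at x) n = 1" if "x \<in> Y" for x
      using shift_equivariant_derivatives(3)[OF N(1) YB(4)[OF that] N(4) sh] .
    fix p assume "p \<in> U"
    then have p: "p \<in> chart_dom ?N i" "?c p \<in> ?A" by (simp_all only: U_def Int_iff vimage_eq)
    have pc: "?p (?c p) = p" by (rule param_chart_map[OF NS iN p(1)])
    have pB: "?c p \<in> B \<times> J" by (rule subsetD[OF AB p(2)])
    have pY: "fst (?c p) \<in> Y" using p(2) by (simp only: mem_Times_iff)
    have e: "fst (?c p) = chart_map M i (fst p)" by simp
    show "\<psi> (chart_map M i (fst p)) = 0 \<longleftrightarrow> p \<in> ?H"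
      using trans[OF YB(3)[OF pY, symmetric] zeroF[OF pB]] unfolding pc e .
  qed
  have "geodesically_light_convex ?N ?g ?H U (\<lambda>(x, t). \<psi> (chart_map M i x))"
  proof (rule geodesically_light_convex_of_graph[OF ss i open_Times[OF Y BJ(2)] _ N(1) _ N(4) n sh U_def def'])
    show "?A \<subseteq> ?c ` chart_dom ?N i" using AB BJ(4) by blast
    show "fst ` ?A \<subseteq> N" using YN by auto
    fix q v
    assume q: "q \<in> ?A" and \<psi>0: "\<psi> (fst q) = 0" and v: "v \<noteq> 0" and null: "?g i (?p q) v v = 0"
      and tan: "frechet_derivative \<psi> (at (fst q)) (fst v) = 0"
    have qB: "q \<in> B \<times> J" by (rule subsetD[OF AB q])
    have qY: "fst q \<in> Y" using q by (simp only: mem_Times_iff)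
    have qN: "fst q \<in> N" by (rule YB(4)[OF qY])
    \<comment> \<open>\<open>tangent_to\<close> requires a curve in the hypersurface: the line in
      direction \<open>fst v\<close> is projected to the graph along \<open>n\<close>, while time
      runs linearly. Since \<open>fst v\<close> is annihilated by the differential of
      \<open>\<psi>\<close>, the projection leaves the velocity at 0 unchanged.\<close>
    define l where "l s = fst q + s *\<^sub>R fst v" for s
    define c where "c s = (l s - \<psi> (l s) *\<^sub>R n, snd q + s * snd v)" for s
    have l: "(l has_vector_derivative fst v) (at 0)" unfolding l_def[abs_def] by (auto intro!: derivative_eq_intros)
    have l0: "l 0 = fst q" by (simp add: l_def)
    have c0: "c 0 = q" using \<psi>0 by (simp add: c_def l0)
    obtain e where e: "e > 0" "\<And>s. dist s 0 < e \<Longrightarrow> l s \<in> N"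
      using continuous_within_openD[OF has_vector_derivative_continuous[OF l] N(1)] qN unfolding l0 by blast
    have cs: "fst (c s) \<in> Y \<and> \<psi> (fst (c s)) = 0" if "dist s 0 < e" for s
      using sh[OF e(2)[OF that], of "- \<psi> (l s)"] proj[OF e(2)[OF that]] by (simp add: c_def Y_def)
    have "((\<lambda>s. \<psi> (l s)) has_vector_derivative 0) (at 0)"
      using has_vector_derivative_compose_field[of \<psi> _ l 0, OF _ l] Ck_on_2_has_derivative(1)[OF N(4) qN] tan
      unfolding l0 by fastforce
    then have "((\<lambda>s. l s - \<psi> (l s) *\<^sub>R n) has_vector_derivative (fst v - 0 *\<^sub>R n)) (at 0)"
      by (intro has_vector_derivative_diff l bounded_linear.has_vector_derivative[OF bounded_linear_scaleR_left])
    moreover have "((\<lambda>s. snd q + s * snd v) has_vector_derivative snd v) (at 0)"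
      by (auto intro!: derivative_eq_intros)
    ultimately have "(c has_vector_derivative (fst v - 0 *\<^sub>R n, snd v)) (at 0)"
      unfolding c_def[abs_def] by (rule has_vector_derivative_Pair)
    then have c': "(c has_vector_derivative v) (at 0)" by simp
    have "tangent_to ?N ?H i (?p (c 0)) v"
    proof (rule tangent_to_curve_in_chart[OF NS iN e(1) _ _ c'])
      fix s :: real assume s: "dist s 0 < e"
      have csB: "fst (c s) \<in> B" and F0: "F (fst (c s)) = 0"
        using YB(1)[OF conjunct1[OF cs[OF s]]] YB(3)[OF conjunct1[OF cs[OF s]]] conjunct2[OF cs[OF s]]
        by (simp_all only:)
      then have csO: "fst (c s) \<in> chart_map M i ` chart_dom M i" using BO by blast
      then have "(fst (c s), snd (c s)) \<in> (chart_map M i ` chart_dom M i) \<times> UNIV" by blast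
      then show "c s \<in> ?c ` chart_dom ?N i"
        unfolding product_line_simps(2) image_chart_product_line by (simp only: prod.collapse)
      \<comment> \<open>The time \<open>snd (c s)\<close> may leave \<open>J\<close>. Membership in
        \<open>H\<^sub>S\<close> does not depend on time, so it is checked at
        \<open>t0\<close>.\<close>
      have "(fst (c s), t0) \<in> B \<times> J" using csB t0 by blast
      from zeroF[OF this] pO(4)[OF this] F0 have "param M i (fst (c s)) \<in> H\<^sub>S" by simp
      then show "?p (c s) \<in> ?H"
        using param_product_line[OF M i csO, of "snd (c s)"] by simp
    qed
    then have tanH: "tangent_to ?N ?H i (?p q) v" by (simp only: c0)
    have "F (fst q) = 0" using YB(3)[OF qY] \<psi>0 by blast
    then have zH: "?p q \<in> U\<^sub>0 \<inter> ?H" using zeroF[OF qB] pO(1)[OF qB] by (simp only: Int_iff simp_thms)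
    have "lightlike ?g i (?p q) v" using v null by (simp only: lightlike_def simp_thms)
    then have "hessian ?N ?g ?\<Phi> i (?p q) v v \<le> 0"
      by (intro conv[unfolded hessian_light_convex_def, THEN bspec, THEN bspec, THEN mp, THEN spec, THEN mp,
            OF zH iN pO(2)[OF qB]] conjI tanH)
    then have hess: "frechet_derivative (\<lambda>y. frechet_derivative F (at y) (fst v)) (at (fst q)) (fst v) \<le>
        frechet_derivative F (at (fst q)) (fst (pseudo_riemannian.chr (\<lambda>y. ?g i (?p y)) q v v))"
      unfolding hessian_def differential_def christoffel_eq_chr[OF NS NG iN pO(2)[OF qB]] pO(3)[OF qB]
        dF1[OF qB] dF2[OF qB] by linarith
    let ?\<Gamma> = "pseudo_riemannian.chr (\<lambda>y. ?g i (?p y)) q v v"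
    have F1: "frechet_derivative F (at (fst q)) u = frechet_derivative \<psi> (at (fst q)) u * frechet_derivative F (at (fst q)) n" for u
      using fac[OF qN, of u] \<psi>0 by simp
    have F2: "frechet_derivative (\<lambda>y. frechet_derivative F (at y) (fst v)) (at (fst q)) (fst v) =
      frechet_derivative (\<lambda>y. frechet_derivative \<psi> (at y) (fst v)) (at (fst q)) (fst v) * frechet_derivative F (at (fst q)) n"
      by (rule second_derivative_proportional[OF N(1) qN N(4) \<psi>0 BJ(1) C2F YB(1)[OF qY] fac tan])
    \<comment> \<open>Both the second-derivative term and the Christoffel term of \<open>F\<close>
      are those of \<open>\<psi>\<close> times the derivative of \<open>F\<close> along
      \<open>n\<close>, which is positive and can be divided out.\<close>
    have "frechet_derivative (\<lambda>y. frechet_derivative \<psi> (at y) (fst v)) (at (fst q)) (fst v) * frechet_derivative F (at (fst q)) n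
      \<le> frechet_derivative \<psi> (at (fst q)) (fst ?\<Gamma>) * frechet_derivative F (at (fst q)) n"
      using hess unfolding F2 F1[of "fst ?\<Gamma>"] .
    then show "frechet_derivative (\<lambda>y. frechet_derivative \<psi> (at y) (fst v)) (at (fst q)) (fst v)
      \<le> frechet_derivative \<psi> (at (fst q)) (fst ?\<Gamma>)"
      using YB(2)[OF qY] by simp
  qed
  with zU def' show ?thesis by (intro exI[of _ U] exI[of _ "\<lambda>x. \<psi> (chart_map M i x)"]) blast
qed

theorem corollary3p6:
  fixes M :: "('i, 'a::{t2_space,second_countable_topology}, 'e::euclidean_space) atlas"
    and g\<^sub>0 :: "('i, 'a, 'e) bilinear_field"
    and \<omega>\<^sub>0 :: "('i, 'a, 'e) one_form_field"
    and \<beta> :: "'a \<Rightarrow> real"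
    and H\<^sub>S :: "'a set"
  assumes "standard_stationary M g\<^sub>0 \<omega>\<^sub>0 \<beta>"
    and "Ck_embedded_hypersurface 2 M H\<^sub>S"
  shows "infinitesimally_light_convex M (stationary_metric g\<^sub>0 \<omega>\<^sub>0 \<beta>) H\<^sub>S \<longleftrightarrow>
         locally_light_convex M (stationary_metric g\<^sub>0 \<omega>\<^sub>0 \<beta>) H\<^sub>S"
proof
  assume inf: "infinitesimally_light_convex M (stationary_metric g\<^sub>0 \<omega>\<^sub>0 \<beta>) H\<^sub>S"
  show "locally_light_convex M (stationary_metric g\<^sub>0 \<omega>\<^sub>0 \<beta>) H\<^sub>S"
    unfolding locally_light_convex_def
  proof
    fix p assume p: "p \<in> H\<^sub>S \<times> (UNIV :: real set)"
    from bspec[OF inf[unfolded infinitesimally_light_convex_def] p]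
    obtain U \<phi> where U: "p \<in> U" "defining_function (product_line M) (H\<^sub>S \<times> UNIV) U (\<lambda>(x, t). \<phi> x)"
      "hessian_light_convex (product_line M) (stationary_metric g\<^sub>0 \<omega>\<^sub>0 \<beta>) (H\<^sub>S \<times> UNIV) U (\<lambda>(x, t). \<phi> x)"
      by (elim exE conjE) (rule that)
    show "\<exists>U\<^sub>0 \<phi>. p \<in> U\<^sub>0 \<and> defining_function (product_line M) (H\<^sub>S \<times> UNIV) U\<^sub>0 (\<lambda>(x, t). \<phi> x) \<and>
        geodesically_light_convex (product_line M) (stationary_metric g\<^sub>0 \<omega>\<^sub>0 \<beta>) (H\<^sub>S \<times> UNIV) U\<^sub>0 (\<lambda>(x, t). \<phi> x)"
      by (rule local_light_convexity_at_point[OF assms(1) U(2,3) IntI[OF U(1) p]])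
  qed
next
  assume loc: "locally_light_convex M (stationary_metric g\<^sub>0 \<omega>\<^sub>0 \<beta>) H\<^sub>S"
  have M: "smooth_manifold M" using assms(1) by (simp add: standard_stationary_def)
  note NS = smooth_manifold_product_line[OF M]
  note NG = semi_riemannian_stationary_metric[OF assms(1)]
  show "infinitesimally_light_convex M (stationary_metric g\<^sub>0 \<omega>\<^sub>0 \<beta>) H\<^sub>S"
    unfolding infinitesimally_light_convex_def
  proof
    fix p assume p: "p \<in> H\<^sub>S \<times> (UNIV :: real set)"
    from bspec[OF loc[unfolded locally_light_convex_def] p]
    obtain U \<phi> where U: "p \<in> U" "defining_function (product_line M) (H\<^sub>S \<times> UNIV) U (\<lambda>(x, t). \<phi> x)"
      "geodesically_light_convex (product_line M) (stationary_metric g\<^sub>0 \<omega>\<^sub>0 \<beta>) (H\<^sub>S \<times> UNIV) U (\<lambda>(x, t). \<phi> x)"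
      by (elim exE conjE) (rule that)
    show "\<exists>U\<^sub>0 \<phi>. p \<in> U\<^sub>0 \<and> defining_function (product_line M) (H\<^sub>S \<times> UNIV) U\<^sub>0 (\<lambda>(x, t). \<phi> x) \<and>
        hessian_light_convex (product_line M) (stationary_metric g\<^sub>0 \<omega>\<^sub>0 \<beta>) (H\<^sub>S \<times> UNIV) U\<^sub>0 (\<lambda>(x, t). \<phi> x)"
      by (intro exI[of _ U] exI[of _ \<phi>] conjI U(1,2)
          hessian_light_convex_of_geodesically_light_convex[OF NS NG U(2,3)])
  qed
qed

end
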